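(* Let $\psi\in \mathcal{O}_M(\mathbb{R})$ be a real-valued function such that $\psi:\mathbb{R}\to\mathbb{R}$ is bijective. The following conditions are equivalent. (i) The operator $C_\psi\colon\mathcal{O}_M(\mathbb{R})\to \mathcal{O}_M(\mathbb{R})$, $f\mapsto f \circ \psi$, is mixing and for every $v\in \mathcal{S}(\mathbb{R})$ $$\lim_{n\to\infty}v(\psi_n(0))\cdot n=0\quad\text{and}\quad\lim_{n\to\infty}v(\psi_{-n}(0))\cdot n=0.$$ (ii) There exists a real-valued function $H\in \mathcal{O}_M(\mathbb{R})$ with $H'(x)\neq 0$ for every $x\in\mathbb{R}$ which satisfies the equation $$H(\psi(x))=H(x)+1\quad\text{for every }x\in \mathbb{R}.$$
   Context: $\mathbb{N}=\{1,2,3,\ldots\}$. $\mathcal{S}(\mathbb{R})$ is the Schwartz space of rapidly decreasing smooth functions. For $m,n\in\mathbb{N}$ let $\mathcal{O}_n^m(\mathbb{R})=\{f\in C^m(\mathbb{R}): |f|_{m,n}:=\sup_{x\in\mathbb{R},\,0\le j\le m}(1+|x|^2)^{-n}|f^{(j)}(x)|<\infty\}$, a Banach space under $|\cdot|_{m,n}$, and $\mathcal{O}_M(\mathbb{R})=\bigcap_{m=1}^\infty\bigcup_{n=1}^\infty\mathcal{O}_n^m(\mathbb{R})$ (slowly increasing smooth functions, the multipliers of $\mathcal{S}(\mathbb{R})$). It carries the locally convex topology of the projective limit over $m$ of the (LB)-spaces $\operatorname{ind}_{n\to\infty}\mathcal{O}_n^m(\mathbb{R})$; equivalently, the topology given by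 the seminorms $p_{m,v}(f)=\sup_{x\in\mathbb{R}}\max_{0\le j\le m}|v(x)f^{(j)}(x)|$, $m\ge 0$, $v\in\mathcal{S}(\mathbb{R})$. For a smooth $\psi:\mathbb{R}\to\mathbb{R}$, the operator $C_\psi$ is well defined (and then continuous) on $\mathcal{O}_M(\mathbb{R})$ if and only if $\psi\in\mathcal{O}_M(\mathbb{R})$. Iterates: $\psi_0(x)=x$, $\psi_n=\psi\circ\psi_{n-1}$ for $n\in\mathbb{N}$; for bijective $\psi$ and $n\in\mathbb{N}$, $\psi_{-n}$ is the inverse of $\psi_n$. A continuous linear operator $T$ on a topological vector space $E$ is mixing if for every pair of non-empty open sets $U,V\subseteq E$ one has $T^n(U)\cap V\neq\emptyset$ for all sufficiently large $n\in\mathbb{N}$. *)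

theory Defs
  imports "HOL-Analysis.Analysis"
begin

definition nth_deriv :: "nat \<Rightarrow> (real \<Rightarrow> 'a::real_normed_vector) \<Rightarrow> real \<Rightarrow> 'a" where
  "nth_deriv j f = ((\<lambda>g x. vector_derivative g (at x)) ^^ j) f"

definition C_k :: "nat \<Rightarrow> (real \<Rightarrow> 'a::real_normed_vector) set" where
  "C_k m = {f. (\<forall>j<m. \<forall>x. nth_deriv j f differentiable (at x)) \<and>
               continuous_on UNIV (nth_deriv m f)}"

definition schwartz :: "(real \<Rightarrow> complex) set" where
  "schwartz = {v. (\<forall>m. v \<in> C_k m) \<and>
                  (\<forall>k j. bdd_above (range (\<lambda>x. \<bar>x\<bar> ^ k * norm (nth_deriv j v x))))}"

definition O_space :: "nat \<Rightarrow> nat \<Rightarrow> (real \<Rightarrow> 'a::real_normed_vector) set" where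
  "O_space m n = {f \<in> C_k m.
     bdd_above {norm (nth_deriv j f x) / (1 + \<bar>x\<bar>\<^sup>2) ^ n | x j. j \<le> m}}"

text \<open>The codomain is left open so that ``a real-valued function in \<open>O_M\<close>'' can be stated as
  membership at type \<^typ>\<open>real \<Rightarrow> real\<close>; the topological vector space itself is
  the complex-valued instance.\<close>

definition O_M :: "(real \<Rightarrow> 'a::real_normed_vector) set" where
  "O_M = (\<Inter>m\<in>{1..}. \<Union>n\<in>{1..}. O_space m n)"

text \<open>For \<open>v\<close> in \<^const>\<open>schwartz\<close> and \<open>f\<close> in \<^const>\<open>O_M\<close> the supremum
  below ranges over a bounded set; elsewhere the value is irrelevant.\<close>

definition O_M_seminorm :: "nat \<Rightarrow> (real \<Rightarrow> complex) \<Rightarrow> (real \<Rightarrow> complex) \<Rightarrow> real" where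
  "O_M_seminorm m v f = (SUP x. Max ((\<lambda>j. norm (v x * nth_deriv j f x)) ` {..m}))"

definition O_M_topology :: "(real \<Rightarrow> complex) topology" where
  "O_M_topology = topology_generated_by
     {{g \<in> O_M. O_M_seminorm m v (\<lambda>x. g x - f x) < e} | m v f e.
        v \<in> schwartz \<and> f \<in> O_M \<and> e > 0}"

definition composition_operator :: "('a \<Rightarrow> 'a) \<Rightarrow> ('a \<Rightarrow> 'b) \<Rightarrow> ('a \<Rightarrow> 'b)" where
  "composition_operator \<psi> f = f \<circ> \<psi>"

text \<open>For a topology whose carrier is a space of complex-valued functions under
  pointwise operations.\<close>

definition continuous_linear_operator ::
    "('a \<Rightarrow> complex) topology \<Rightarrow> (('a \<Rightarrow> complex) \<Rightarrow> ('a \<Rightarrow> complex)) \<Rightarrow> bool" where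
  "continuous_linear_operator E T \<longleftrightarrow>
     continuous_map E E T \<and>
     (\<forall>f\<in>topspace E. \<forall>g\<in>topspace E. T (\<lambda>x. f x + g x) = (\<lambda>x. T f x + T g x)) \<and>
     (\<forall>c. \<forall>f\<in>topspace E. T (\<lambda>x. c * f x) = (\<lambda>x. c * T f x))"

definition mixing_operator ::
    "('a \<Rightarrow> complex) topology \<Rightarrow> (('a \<Rightarrow> complex) \<Rightarrow> ('a \<Rightarrow> complex)) \<Rightarrow> bool" where
  "mixing_operator E T \<longleftrightarrow>
     continuous_linear_operator E T \<and>
     (\<forall>U V. openin E U \<and> U \<noteq> {} \<and> openin E V \<and> V \<noteq> {} \<longrightarrow>
        (\<forall>\<^sub>F n in sequentially. (T ^^ n) ` U \<inter> V \<noteq> {}))"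

end

(* A solution H of Abel's equation satisfies H o sigma = H + c for every iterate sigma of psi. The
   chain rule, solved for the derivatives of sigma, then bounds the derivatives of f o sigma, for f
   of compact support, by a polynomial that does not depend on sigma, while the support of f o sigma
   moves off to infinity; this gives mixing. Conversely, let H be any smooth increasing solution of
   Abel's equation. For a high iterate sigma of psi or of its inverse, mixing provides f close to the
   identity on a fundamental interval such that f o sigma is small in the seminorm with weight v.
   The same chain rule bounds the derivatives of sigma by those of f o sigma, that is, by powers of
   1/v. Since H o sigma = H + c, the function v H^(j) is bounded for every Schwartz function v, which
   forces H^(j) to grow polynomially. *)
theory Submission
  imports Defs "HOL-Computational_Algebra.Polynomial"
begin

section \<open>Smooth functions\<close>

text \<open>The seminorms are indexed by Schwartz functions, while the arguments produce only
  pointwise rates: weights pushed forward along psi, j-th roots, indicator functions.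
  \<open>rapidly_decreasing_dominated\<close> bridges the gap: every rapidly decreasing function,
  however irregular, lies below the modulus of a Schwartz function.

  The estimates bound the i-th derivative of the inner function by \<open>G ^ i\<close>. The chain
  rule preserves this scaling in both directions, and order j costs exactly the j-th power of 1/|w|.
  Hence the weight w handed to mixing is a majorant of the j-th root of |v|.

  Solving for the derivatives of sigma needs an outer derivative bounded away from 0. From Abel's
  equation to mixing, compact support confines sigma y to an interval on which |H'| has a positive
  lower bound. In the converse, f' is within 1/2 of 1 on a fundamental interval. Points that reach
  this interval only under iterates of order below N lie in a compact set, where continuity
  suffices.

  Two uses of mixing are needed: approximating the pair (identity, 0) controls the iterates of psi,
  the pair (0, identity) those of its inverse.\<close>

definition smooth :: "(real \<Rightarrow> 'a::real_normed_vector) \<Rightarrow> bool" where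
  "smooth f \<longleftrightarrow> (\<forall>j x. nth_deriv j f differentiable (at x))"

text \<open>Smoothness is proved by induction on the number of derivatives, because the derivative
  of a product, a reciprocal or a composite contains the given functions again. Only
  differentiability is counted; continuity of the top derivative, as in \<open>C_k\<close>, is not
  asked for.\<close>

definition differentiable_times :: "nat \<Rightarrow> (real \<Rightarrow> 'a::real_normed_vector) \<Rightarrow> bool" where
  "differentiable_times k f \<longleftrightarrow> (\<forall>j<k. \<forall>x. nth_deriv j f differentiable (at x))"

lemma nth_deriv_0 [simp]: "nth_deriv 0 f = f"
  by (simp add: nth_deriv_def)

lemma nth_deriv_Suc: "nth_deriv (Suc j) f = (\<lambda>x. vector_derivative (nth_deriv j f) (at x))"
  by (simp add: nth_deriv_def)

lemma nth_deriv_Suc_shift: "nth_deriv (Suc j) f = nth_deriv j (\<lambda>x. vector_derivative f (at x))"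
  unfolding nth_deriv_def by (subst funpow_Suc_right) simp

lemma nth_deriv_add_index: "nth_deriv (i + j) f = nth_deriv i (nth_deriv j f)"
  by (simp add: nth_deriv_def funpow_add)

lemma nth_deriv_one: "nth_deriv 1 f = (\<lambda>x. vector_derivative f (at x))"
  by (simp add: nth_deriv_Suc)

lemma smooth_iff_differentiable_times: "smooth f \<longleftrightarrow> (\<forall>k. differentiable_times k f)"
  unfolding smooth_def differentiable_times_def by blast

lemma differentiable_times_0 [simp]: "differentiable_times 0 f"
  by (simp add: differentiable_times_def)

lemma differentiable_times_Suc:
  "differentiable_times (Suc k) f \<longleftrightarrow>
     (\<forall>x. f differentiable (at x)) \<and> differentiable_times k (\<lambda>x. vector_derivative f (at x))"
  unfolding differentiable_times_def nth_deriv_Suc_shift[symmetric]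
  by (metis Suc_less_eq gr0_conv_Suc less_Suc_eq_0_disj nth_deriv_0)

lemma differentiable_times_mono:
  "differentiable_times k f \<Longrightarrow> l \<le> k \<Longrightarrow> differentiable_times l f"
  by (auto simp: differentiable_times_def)

lemma differentiable_timesI:
  assumes "\<And>x. (f has_vector_derivative f' x) (at x)" "differentiable_times k f'"
  shows "differentiable_times (Suc k) f"
proof -
  have "(\<lambda>x. vector_derivative f (at x)) = f'"
    using assms(1) by (auto intro!: ext vector_derivative_at)
  with assms show ?thesis
    unfolding differentiable_times_Suc by (metis differentiableI_vector)
qed

lemma smooth_has_vector_derivative:
  "smooth f \<Longrightarrow> (nth_deriv j f has_vector_derivative nth_deriv (Suc j) f x) (at x)"
  by (simp add: smooth_def nth_deriv_Suc vector_derivative_works[symmetric])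

lemma smooth_deriv1:
  "smooth f \<Longrightarrow> (f has_vector_derivative nth_deriv 1 f x) (at x)"
  using smooth_has_vector_derivative[of f 0 x] by simp

lemma smooth_nth_deriv: "smooth f \<Longrightarrow> smooth (nth_deriv i f)"
  unfolding smooth_def by (metis nth_deriv_add_index)

lemma smooth_continuous_nth_deriv: "smooth f \<Longrightarrow> continuous_on S (nth_deriv j f)"
  by (meson smooth_has_vector_derivative continuous_on_vector_derivative has_vector_derivative_at_within)

lemma smooth_continuous: "smooth f \<Longrightarrow> continuous_on S f"
  using smooth_continuous_nth_deriv[of f S 0] by simp

lemma smooth_isCont: "smooth f \<Longrightarrow> isCont f x"
  by (meson smooth_deriv1 has_vector_derivative_continuous)

lemma smoothI:
  assumes "\<And>x. (f has_vector_derivative f' x) (at x)" "smooth f'"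
  shows "smooth f"
  unfolding smooth_iff_differentiable_times
proof
  fix k show "differentiable_times k f"
    using differentiable_timesI[OF assms(1)] assms(2)
    by (meson differentiable_times_mono le_Suc_eq order_refl smooth_iff_differentiable_times)
qed

lemma nth_deriv_eqI:
  assumes "\<And>x. (f has_vector_derivative f' x) (at x)"
  shows "nth_deriv (Suc j) f = nth_deriv j f'"
proof -
  have "(\<lambda>x. vector_derivative f (at x)) = f'"
    using assms(1) by (auto intro!: ext vector_derivative_at)
  then show ?thesis by (simp add: nth_deriv_Suc_shift)
qed

lemma nth_deriv_const: "nth_deriv j (\<lambda>x. c) = (\<lambda>x. if j = 0 then c else 0)"
proof (induction j arbitrary: c)
  case (Suc j)
  have "nth_deriv (Suc j) (\<lambda>x. c) = nth_deriv j (\<lambda>x. 0)"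
    by (rule nth_deriv_eqI) simp
  with Suc show ?case by auto
qed simp

lemma smooth_const [simp]: "smooth (\<lambda>x. c)"
  by (auto simp: smooth_def nth_deriv_const)

lemma smooth_linear:
  fixes a b :: "'a::real_normed_vector"
  shows "smooth (\<lambda>x. x *\<^sub>R a + b)"
proof (rule smoothI)
  show "((\<lambda>x. x *\<^sub>R a + b) has_vector_derivative a) (at x)" for x
    by (auto intro!: derivative_eq_intros)
qed simp

lemma nth_deriv_linear:
  fixes a b :: "'a::real_normed_vector"
  shows "nth_deriv (Suc j) (\<lambda>x. x *\<^sub>R a + b) = (\<lambda>x. if j = 0 then a else 0)"
proof -
  have "nth_deriv (Suc j) (\<lambda>x. x *\<^sub>R a + b) = nth_deriv j (\<lambda>x. a)"
    by (rule nth_deriv_eqI) (auto intro!: derivative_eq_intros)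
  then show ?thesis by (simp add: nth_deriv_const)
qed

lemma differentiable_times_add:
  "differentiable_times k f \<Longrightarrow> differentiable_times k g \<Longrightarrow> differentiable_times k (\<lambda>x. f x + g x)"
proof (induction k arbitrary: f g)
  case (Suc k)
  then show ?case
    by (intro differentiable_timesI[where f' = "\<lambda>x. vector_derivative f (at x) + vector_derivative g (at x)"])
       (auto simp: differentiable_times_Suc vector_derivative_works intro!: has_vector_derivative_add)
qed simp

lemma smooth_add: "smooth f \<Longrightarrow> smooth g \<Longrightarrow> smooth (\<lambda>x. f x + g x)"
  by (simp add: smooth_iff_differentiable_times differentiable_times_add)

text \<open>\<open>scaleR\<close> in place of multiplication covers real and complex functions at
  once. Both factors reappear in the derivative, so the induction keeps \<open>r\<close> and
  \<open>f\<close> arbitrary.\<close>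

lemma differentiable_times_scaleR:
  "differentiable_times k r \<Longrightarrow> differentiable_times k f \<Longrightarrow> differentiable_times k (\<lambda>x. r x *\<^sub>R f x)"
proof (induction k arbitrary: r f)
  case (Suc k)
  have *: "differentiable_times k r" "differentiable_times k f"
    using Suc.prems differentiable_times_mono by (metis le_Suc_eq order_refl)+
  have "differentiable_times k (\<lambda>x. r x *\<^sub>R vector_derivative f (at x) + vector_derivative r (at x) *\<^sub>R f x)"
    using Suc.prems * by (intro differentiable_times_add Suc.IH) (auto simp: differentiable_times_Suc)
  moreover have "((\<lambda>x. r x *\<^sub>R f x) has_vector_derivative
       r x *\<^sub>R vector_derivative f (at x) + vector_derivative r (at x) *\<^sub>R f x) (at x)" for x
    using Suc.prems
    by (intro has_vector_derivative_scaleR)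
       (auto simp: differentiable_times_Suc vector_derivative_works has_real_derivative_iff_has_vector_derivative)
  ultimately show ?case by (rule differentiable_timesI[rotated])
qed simp

lemma smooth_scaleR: "smooth r \<Longrightarrow> smooth f \<Longrightarrow> smooth (\<lambda>x. r x *\<^sub>R f x)"
  by (simp add: smooth_iff_differentiable_times differentiable_times_scaleR)

lemma smooth_mult: "smooth r \<Longrightarrow> smooth f \<Longrightarrow> smooth (\<lambda>x. r x * f x :: real)"
  using smooth_scaleR[of r f] by simp

lemma smooth_cscaleR: "smooth f \<Longrightarrow> smooth (\<lambda>x. c *\<^sub>R f x)"
  using smooth_scaleR[of "\<lambda>x. c" f] by simp

lemma smooth_diff: "smooth f \<Longrightarrow> smooth g \<Longrightarrow> smooth (\<lambda>x. f x - g x)"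
  using smooth_add[of f "\<lambda>x. (-1) *\<^sub>R g x"] smooth_cscaleR[of g "-1"] by simp

lemma smooth_sum: "(\<And>i. i \<in> I \<Longrightarrow> smooth (f i)) \<Longrightarrow> smooth (\<lambda>x. \<Sum>i\<in>I. f i x)"
  by (induction I rule: infinite_finite_induct) (auto intro: smooth_add)

lemma has_vector_derivative_compose_real:
  assumes "(s has_vector_derivative s') (at x)" "(f has_vector_derivative f') (at (s x))"
  shows "((\<lambda>x. f (s x)) has_vector_derivative s' *\<^sub>R f') (at x)"
  using vector_diff_chain_at[OF assms] by (simp add: o_def)

lemma differentiable_times_compose:
  "differentiable_times k s \<Longrightarrow> differentiable_times k f \<Longrightarrow> differentiable_times k (\<lambda>x. f (s x))"
proof (induction k arbitrary: f)
  case (Suc k)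
  have *: "differentiable_times k s"
    using Suc.prems differentiable_times_mono by (metis le_Suc_eq order_refl)
  have "differentiable_times k (\<lambda>x. vector_derivative s (at x) *\<^sub>R vector_derivative f (at (s x)))"
    using Suc.prems * Suc.IH[of "\<lambda>x. vector_derivative f (at x)"]
    by (intro differentiable_times_scaleR) (auto simp: differentiable_times_Suc)
  moreover have "((\<lambda>x. f (s x)) has_vector_derivative
      vector_derivative s (at x) *\<^sub>R vector_derivative f (at (s x))) (at x)" for x
    using Suc.prems
    by (intro has_vector_derivative_compose_real)
       (auto simp: differentiable_times_Suc vector_derivative_works)
  ultimately show ?case by (rule differentiable_timesI[rotated])
qed simp

lemma smooth_compose: "smooth s \<Longrightarrow> smooth f \<Longrightarrow> smooth (\<lambda>x. f (s x))"
  by (simp add: smooth_iff_differentiable_times differentiable_times_compose)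

lemma differentiable_times_inverse:
  fixes r :: "real \<Rightarrow> real"
  assumes "\<And>x. r x \<noteq> 0"
  shows "differentiable_times k r \<Longrightarrow> differentiable_times k (\<lambda>x. inverse (r x))"
proof (induction k)
  case (Suc k)
  have *: "differentiable_times k r" "differentiable_times k (\<lambda>x. inverse (r x))"
    using Suc differentiable_times_mono by (metis le_Suc_eq order_refl)+
  have "differentiable_times k (\<lambda>x. (-1) *\<^sub>R (inverse (r x) *\<^sub>R vector_derivative r (at x) *\<^sub>R inverse (r x)))"
    using Suc.prems *
    by (intro differentiable_times_scaleR)
      (auto simp: differentiable_times_Suc smooth_const[unfolded smooth_iff_differentiable_times])
  moreover have "((\<lambda>x. inverse (r x)) has_vector_derivative
      (-1) *\<^sub>R (inverse (r x) *\<^sub>R vector_derivative r (at x) *\<^sub>R inverse (r x))) (at x)" for x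
    using Suc.prems assms
    by (auto simp: differentiable_times_Suc vector_derivative_works
        has_real_derivative_iff_has_vector_derivative[symmetric] mult_ac intro!: derivative_eq_intros)
  ultimately show ?case by (rule differentiable_timesI[rotated])
qed simp

lemma smooth_inverse:
  fixes r :: "real \<Rightarrow> real"
  shows "smooth r \<Longrightarrow> (\<And>x. r x \<noteq> 0) \<Longrightarrow> smooth (\<lambda>x. inverse (r x))"
  by (simp add: smooth_iff_differentiable_times differentiable_times_inverse)

section \<open>Inverse functions\<close>

lemma has_vector_derivative_inv_function:
  fixes s t :: "real \<Rightarrow> real"
  assumes "smooth s" "\<And>x. nth_deriv 1 s x \<noteq> 0" "\<And>x. t (s x) = x" "\<And>x. s (t x) = x"
  shows "(t has_vector_derivative inverse (nth_deriv 1 s (t x))) (at x)"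
proof -
  have "isCont t (s (t x))"
    by (rule isCont_inverse_function[where d = 1]) (use assms smooth_isCont in auto)
  then have "DERIV t x :> inverse (nth_deriv 1 s (t x))"
    using assms smooth_deriv1[OF assms(1), of "t x"]
    by (intro DERIV_inverse_function[where f = s and a = "x - 1" and b = "x + 1"])
       (auto simp: has_real_derivative_iff_has_vector_derivative)
  then show ?thesis by (simp add: has_real_derivative_iff_has_vector_derivative)
qed

text \<open>The formula t' = (1/s') o t is circular for an induction on t alone. Proving the claim
  for f o t with every smooth f closes it, since (f o t)' = (f'/s') o t is again of this form; f is
  the identity at the end.\<close>

lemma smooth_inv_function:
  fixes s t :: "real \<Rightarrow> real"
  assumes "smooth s" "\<And>x. nth_deriv 1 s x \<noteq> 0" "\<And>x. t (s x) = x" "\<And>x. s (t x) = x"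
  shows "smooth t"
proof -
  have "differentiable_times k (\<lambda>x. f (t x))" if "smooth f" for k and f :: "real \<Rightarrow> real"
    using that
  proof (induction k arbitrary: f)
    case (Suc k)
    have "smooth (\<lambda>x. inverse (nth_deriv 1 s x) *\<^sub>R nth_deriv 1 f x)"
      using Suc.prems assms by (intro smooth_scaleR smooth_inverse smooth_nth_deriv)
    from Suc.IH[OF this]
    have "differentiable_times k (\<lambda>x. inverse (nth_deriv 1 s (t x)) *\<^sub>R nth_deriv 1 f (t x))" .
    moreover have "((\<lambda>x. f (t x)) has_vector_derivative
        inverse (nth_deriv 1 s (t x)) *\<^sub>R nth_deriv 1 f (t x)) (at x)" for x
      by (intro has_vector_derivative_compose_real has_vector_derivative_inv_function assms
          smooth_deriv1 Suc.prems)
    ultimately show ?case by (rule differentiable_timesI[rotated])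
  qed simp
  from this[of "\<lambda>x. x *\<^sub>R 1 + 0"] show ?thesis
    using smooth_linear[of "1::real" 0] by (simp add: smooth_iff_differentiable_times)
qed

lemma smooth_id [simp]: "smooth (\<lambda>x::real. x)"
  using smooth_linear[of "1::real" 0] by simp

lemma smooth_funpow:
  fixes s :: "real \<Rightarrow> real"
  shows "smooth s \<Longrightarrow> smooth (s ^^ n)"
proof (induction n)
  case (Suc n)
  then show ?case using smooth_compose[of "s ^^ n" s] by (simp add: o_def)
qed (simp add: id_def)

lemma nth_deriv_cong_open:
  assumes "open S" "\<And>x. x \<in> S \<Longrightarrow> f x = g x" "x \<in> S"
  shows "nth_deriv j f x = nth_deriv j g x"
  using assms(3)
proof (induction j arbitrary: x)
  case (Suc j)
  have "eventually (\<lambda>x. nth_deriv j f x = nth_deriv j g x) (nhds x)"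
    using Suc assms(1) eventually_nhds by blast
  then show ?case
    unfolding nth_deriv_Suc
    by (intro vector_derivative_cong_eq) (auto simp: eventually_nhds eventually_at_filter)
qed (use assms in auto)

text \<open>Needed for locally finite sums, which agree near each point with a finite sum but with
  no single finite sum globally.\<close>

lemma smooth_local:
  assumes "\<And>x. \<exists>S g. open S \<and> x \<in> S \<and> smooth g \<and> (\<forall>y\<in>S. f y = g y)"
  shows "smooth f"
  unfolding smooth_def
proof (intro allI)
  fix j x
  obtain S g where S: "open S" "x \<in> S" "smooth g" "\<And>y. y\<in>S \<Longrightarrow> f y = g y"
    using assms[of x] by metis
  have "(nth_deriv j g has_vector_derivative nth_deriv (Suc j) g x) (at x)"
    by (rule smooth_has_vector_derivative[OF S(3)])
  then have "(nth_deriv j f has_vector_derivative nth_deriv (Suc j) g x) (at x)"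
    by (rule has_vector_derivative_transform_within_open[OF _ S(1,2)])
       (rule nth_deriv_cong_open[OF S(1) S(4)[symmetric]])
  then show "nth_deriv j f differentiable (at x)" by (rule differentiableI_vector)
qed

section \<open>Higher derivatives: linearity, Leibniz rule, chain rule\<close>

lemma nth_deriv_add:
  assumes "smooth f" "smooth g"
  shows "nth_deriv j (\<lambda>x. f x + g x) x = nth_deriv j f x + nth_deriv j g x"
  using assms
proof (induction j arbitrary: f g)
  case (Suc j)
  have "nth_deriv (Suc j) (\<lambda>x. f x + g x) = nth_deriv j (\<lambda>x. nth_deriv 1 f x + nth_deriv 1 g x)"
    by (intro nth_deriv_eqI has_vector_derivative_add smooth_deriv1 Suc.prems)
  then show ?case
    using Suc.IH[of "nth_deriv 1 f" "nth_deriv 1 g"] Suc.prems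
    by (simp add: smooth_nth_deriv nth_deriv_add_index[symmetric])
qed simp

lemma nth_deriv_cscaleR:
  assumes "smooth f"
  shows "nth_deriv j (\<lambda>x. c *\<^sub>R f x) x = c *\<^sub>R nth_deriv j f x"
  using assms
proof (induction j arbitrary: f)
  case (Suc j)
  have "nth_deriv (Suc j) (\<lambda>x. c *\<^sub>R f x) = nth_deriv j (\<lambda>x. c *\<^sub>R nth_deriv 1 f x)"
    by (intro nth_deriv_eqI)
       (use smooth_deriv1[OF Suc.prems] in \<open>auto intro!: derivative_eq_intros\<close>)
  then show ?case
    using Suc.IH[of "nth_deriv 1 f"] Suc.prems
    by (simp add: smooth_nth_deriv nth_deriv_add_index[symmetric])
qed simp

lemma nth_deriv_diff:
  assumes "smooth f" "smooth g"
  shows "nth_deriv j (\<lambda>x. f x - g x) x = nth_deriv j f x - nth_deriv j g x"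
  using nth_deriv_add[OF assms(1) smooth_cscaleR[OF assms(2)], of j "-1" x]
  by (simp add: nth_deriv_cscaleR[OF assms(2), of _ "-1", simplified])

lemma nth_deriv_sum:
  assumes "\<And>i. i \<in> I \<Longrightarrow> smooth (f i)"
  shows "nth_deriv j (\<lambda>x. \<Sum>i\<in>I. f i x) x = (\<Sum>i\<in>I. nth_deriv j (f i) x)"
  using assms
  by (induction I rule: infinite_finite_induct)
     (auto simp: nth_deriv_const nth_deriv_add smooth_sum)

lemma nth_deriv_scaleR:
  assumes "smooth r" "smooth f"
  shows "nth_deriv m (\<lambda>x. r x *\<^sub>R f x) x
    = (\<Sum>i\<le>m. real (m choose i) *\<^sub>R nth_deriv i r x *\<^sub>R nth_deriv (m - i) f x)"
  using assms
proof (induction m arbitrary: r f)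
  case (Suc m)
  have "((\<lambda>x. r x *\<^sub>R f x) has_vector_derivative
      r x *\<^sub>R nth_deriv 1 f x + nth_deriv 1 r x *\<^sub>R f x) (at x)" for x
    by (intro has_vector_derivative_scaleR smooth_deriv1 Suc.prems
         smooth_deriv1[OF Suc.prems(1), folded has_real_derivative_iff_has_vector_derivative])
  from nth_deriv_eqI[OF this]
  have "nth_deriv (Suc m) (\<lambda>x. r x *\<^sub>R f x) x
     = nth_deriv m (\<lambda>x. r x *\<^sub>R nth_deriv 1 f x) x + nth_deriv m (\<lambda>x. nth_deriv 1 r x *\<^sub>R f x) x"
    using Suc.prems by (simp add: nth_deriv_add smooth_scaleR smooth_nth_deriv)
  also have "\<dots> = (\<Sum>i\<le>m. real (m choose i) *\<^sub>R nth_deriv i r x *\<^sub>R nth_deriv (Suc m - i) f x)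
     + (\<Sum>i\<le>m. real (m choose i) *\<^sub>R nth_deriv (Suc i) r x *\<^sub>R nth_deriv (m - i) f x)"
    using Suc.prems Suc.IH[of r "nth_deriv 1 f"] Suc.IH[of "nth_deriv 1 r" f]
    by (simp add: smooth_nth_deriv nth_deriv_add_index[symmetric] Suc_diff_le)
  \<comment> \<open>The added summand vanishes because \<open>m choose Suc m = 0\<close>. After the
    shift below both sums run over the same indices, and Pascal's rule merges them.\<close>
  also have "(\<Sum>i\<le>m. real (m choose i) *\<^sub>R nth_deriv i r x *\<^sub>R nth_deriv (Suc m - i) f x)
     = (\<Sum>i\<le>Suc m. real (m choose i) *\<^sub>R nth_deriv i r x *\<^sub>R nth_deriv (Suc m - i) f x)"
    by simp
  also have "\<dots> = r x *\<^sub>R nth_deriv (Suc m) f x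
     + (\<Sum>i\<le>m. real (m choose Suc i) *\<^sub>R nth_deriv (Suc i) r x *\<^sub>R nth_deriv (m - i) f x)"
    by (subst sum.atMost_Suc_shift) simp
  finally show ?case
    by (subst sum.atMost_Suc_shift) (simp add: sum.distrib[symmetric] algebra_simps)
qed simp

text \<open>A recursive substitute for the formula of Faa di Bruno: the Leibniz rule for s' times f'
  o s. The summand i = 0 is the only one with the top derivative of s, and its cofactor is f' o
  s.\<close>

lemma nth_deriv_compose_Suc:
  fixes s :: "real \<Rightarrow> real"
  assumes "smooth s" "smooth f"
  shows "nth_deriv (Suc m) (\<lambda>x. f (s x)) x
    = (\<Sum>i\<le>m. real (m choose i) *\<^sub>R nth_deriv (Suc (m - i)) s x *\<^sub>R nth_deriv i (\<lambda>x. nth_deriv 1 f (s x)) x)"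
proof -
  have "nth_deriv (Suc m) (\<lambda>x. f (s x)) x = nth_deriv m (\<lambda>x. nth_deriv 1 s x *\<^sub>R nth_deriv 1 f (s x)) x"
    by (rule fun_cong, rule nth_deriv_eqI) (intro has_vector_derivative_compose_real smooth_deriv1 assms)
  also have "\<dots> = (\<Sum>i\<le>m. real (m choose i) *\<^sub>R nth_deriv (Suc i) s x *\<^sub>R
      nth_deriv (m - i) (\<lambda>x. nth_deriv 1 f (s x)) x)"
    using assms
    by (subst nth_deriv_scaleR)
       (auto intro: smooth_nth_deriv smooth_compose simp: nth_deriv_add_index[symmetric])
  also have "\<dots> = (\<Sum>i\<le>m. real (m choose i) *\<^sub>R nth_deriv (Suc (m - i)) s x *\<^sub>R
      nth_deriv i (\<lambda>x. nth_deriv 1 f (s x)) x)"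
    by (rule sum.reindex_bij_witness[of _ "\<lambda>i. m - i" "\<lambda>i. m - i"])
       (auto simp: binomial_symmetric[symmetric])
  finally show ?thesis .
qed

section \<open>Smooth steps and bounds from the chain rule\<close>

text \<open>The functions p(1/x) exp(-1/x), extended by zero. With the polynomial as a parameter the
  family is closed under differentiation, so smoothness of exp(-1/x) at 0 needs no formula for its
  higher derivatives.\<close>

definition flat_poly :: "real poly \<Rightarrow> real \<Rightarrow> real" where
  "flat_poly p x = (if x > 0 then poly p (1 / x) * exp (- (1 / x)) else 0)"

lemma tendsto_poly_mult_exp_minus:
  "((\<lambda>x::real. poly p x * exp (- x)) \<longlongrightarrow> 0) at_top"
proof -
  have "((\<lambda>x::real. \<Sum>i\<le>degree p. coeff p i * (x ^ i / exp x)) \<longlongrightarrow> (\<Sum>i\<le>degree p. coeff p i * 0)) at_top"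
    by (intro tendsto_sum tendsto_mult tendsto_const tendsto_power_div_exp_0)
  moreover have "poly p x * exp (- x) = (\<Sum>i\<le>degree p. coeff p i * (x ^ i / exp x))" for x :: real
    by (simp add: poly_altdef sum_distrib_right exp_minus divide_inverse mult.assoc)
  ultimately show ?thesis by simp
qed

text \<open>For x > 0 the derivative -1/x^2 of 1/x enters once through p and once, with opposite
  sign, through the exponential. The result is (p - p')(1/x) exp(-1/x) / x^2, and
  \<open>[:0, 0, 1:]\<close> stands for the factor 1/x^2.\<close>

lemma flat_poly_has_derivative:
  "(flat_poly p has_vector_derivative flat_poly ([:0, 0, 1:] * (p - pderiv p)) x) (at x)"
proof -
  consider "x > 0" | "x < 0" | "x = 0" by linarith
  then show ?thesis
  proof cases
    case 1
    have "((\<lambda>x. poly p (1 / x) * exp (- (1 / x))) has_vector_derivative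
        flat_poly ([:0, 0, 1:] * (p - pderiv p)) x) (at x)"
      unfolding has_real_derivative_iff_has_vector_derivative[symmetric]
      using 1 by (auto intro!: derivative_eq_intros poly_DERIV[THEN DERIV_chain2]
           simp: flat_poly_def power2_eq_square field_simps)
    then show ?thesis
      by (rule has_vector_derivative_transform_within_open[where S = "{0<..}"])
         (use 1 in \<open>auto simp: flat_poly_def\<close>)
  next
    case 2
    have "((\<lambda>x. 0) has_vector_derivative flat_poly ([:0, 0, 1:] * (p - pderiv p)) x) (at x)"
      using 2 by (auto simp: flat_poly_def)
    then show ?thesis
      by (rule has_vector_derivative_transform_within_open[where S = "{..<0}"])
         (use 2 in \<open>auto simp: flat_poly_def\<close>)
  next
    case 3
    have "((\<lambda>h. flat_poly p h / h) \<longlongrightarrow> 0) (at 0)"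
    proof (rule filterlim_split_at_real)
      \<comment> \<open>With z = 1/h the difference quotient at 0 is z p(z) exp(-z), and
        \<open>pCons 0 p\<close> is the polynomial z p(z).\<close>
      have "((\<lambda>h. poly (pCons 0 p) (inverse h) * exp (- inverse h)) \<longlongrightarrow> 0) (at_right 0)"
        by (rule filterlim_compose[OF tendsto_poly_mult_exp_minus filterlim_inverse_at_top_right])
      then show "((\<lambda>h. flat_poly p h / h) \<longlongrightarrow> 0) (at_right 0)"
        by (rule Lim_transform_eventually)
           (auto simp: eventually_at_filter flat_poly_def field_simps)
      show "((\<lambda>h. flat_poly p h / h) \<longlongrightarrow> 0) (at_left 0)"
        by (rule tendsto_eventually) (auto simp: eventually_at_filter flat_poly_def)
    qed
    then show ?thesis
      using 3 by (simp add: has_real_derivative_iff_has_vector_derivative[symmetric]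
          has_field_derivative_iff) (simp add: flat_poly_def)
  qed
qed

lemma smooth_flat_poly: "smooth (flat_poly p)"
  unfolding smooth_iff_differentiable_times
proof
  fix k show "differentiable_times k (flat_poly p)"
    by (induction k arbitrary: p) (auto intro: differentiable_timesI flat_poly_has_derivative)
qed

text \<open>The classical quotient e(x) / (e(x) + e(1 - x)) with e(x) = exp(-1/x) for x > 0;
  \<open>1\<close> is the constant polynomial. Since x and 1 - x are never both nonpositive, the
  denominator is positive.\<close>

definition smooth_step :: "real \<Rightarrow> real" where
  "smooth_step x = flat_poly 1 x * inverse (flat_poly 1 x + flat_poly 1 (1 - x))"

lemma flat_poly_one_nonneg: "0 \<le> flat_poly 1 x"
  by (simp add: flat_poly_def)

lemma smooth_step_denominator: "0 < flat_poly 1 x + flat_poly 1 (1 - x)"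
  by (auto simp: flat_poly_def add_pos_nonneg)

lemma smooth_smooth_step: "smooth smooth_step"
proof -
  have "smooth (\<lambda>x. flat_poly 1 (1 - x))"
    using smooth_compose[OF smooth_linear[of "-1" "1::real"] smooth_flat_poly[of 1]] by simp
  then show ?thesis
    unfolding smooth_step_def[abs_def] using smooth_step_denominator
    by (intro smooth_mult smooth_inverse smooth_add smooth_flat_poly) (auto simp: less_le)
qed

lemma smooth_step_eq_0: "x \<le> 0 \<Longrightarrow> smooth_step x = 0"
  by (simp add: smooth_step_def flat_poly_def)

lemma smooth_step_eq_1: "1 \<le> x \<Longrightarrow> smooth_step x = 1"
  using smooth_step_denominator[of x] by (simp add: smooth_step_def flat_poly_def)

lemma smooth_step_nonneg: "0 \<le> smooth_step x"
  unfolding smooth_step_def using smooth_step_denominator[of x] flat_poly_one_nonneg[of x] by simp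

text \<open>In the quotient rule the products e(x) e'(x) cancel, which leaves a visibly nonnegative
  numerator. \<open>[:0,0,1:]\<close> comes from \<open>flat_poly_has_derivative\<close> for the
  constant polynomial.\<close>

lemma smooth_step_deriv:
  "nth_deriv 1 smooth_step x =
     (flat_poly [:0,0,1:] x * flat_poly 1 (1 - x) + flat_poly 1 x * flat_poly [:0,0,1:] (1 - x))
       / (flat_poly 1 x + flat_poly 1 (1 - x))\<^sup>2"
proof -
  have *: "(flat_poly 1 has_real_derivative flat_poly [:0,0,1:] x) (at x)" for x
    using flat_poly_has_derivative[of 1 x]
    by (simp add: has_real_derivative_iff_has_vector_derivative pderiv_1)
  have "(smooth_step has_real_derivative (flat_poly [:0,0,1:] x * flat_poly 1 (1 - x)
      + flat_poly 1 x * flat_poly [:0,0,1:] (1 - x))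
       / (flat_poly 1 x + flat_poly 1 (1 - x))\<^sup>2) (at x)"
    unfolding smooth_step_def[abs_def] using smooth_step_denominator[of x]
    by (auto intro!: derivative_eq_intros DERIV_chain2[OF *] * simp: field_simps power2_eq_square)
  then show ?thesis
    unfolding nth_deriv_one
    by (simp add: has_real_derivative_iff_has_vector_derivative vector_derivative_at)
qed

lemma smooth_step_deriv_nonneg: "0 \<le> nth_deriv 1 smooth_step x"
  unfolding smooth_step_deriv by (simp add: flat_poly_def)

lemma smooth_step_deriv_pos: "0 < x \<Longrightarrow> x < 1 \<Longrightarrow> 0 < nth_deriv 1 smooth_step x"
  unfolding smooth_step_deriv using smooth_step_denominator[of x]
  by (intro divide_pos_pos zero_less_power add_pos_pos) (auto simp: flat_poly_def)

section \<open>Cutoffs and functions of compact support\<close>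

definition plateau :: "real \<Rightarrow> real" where
  "plateau x = smooth_step (2 + x) * smooth_step (2 - x)"

lemma smooth_plateau: "smooth plateau"
proof -
  have "smooth (\<lambda>x. smooth_step (2 + x))" "smooth (\<lambda>x. smooth_step (2 - x))"
    using smooth_compose[OF smooth_linear[of 1 "2::real"] smooth_smooth_step]
          smooth_compose[OF smooth_linear[of "-1" "2::real"] smooth_smooth_step]
    by (simp_all add: add.commute)
  then show ?thesis unfolding plateau_def[abs_def] by (rule smooth_mult)
qed

lemma plateau_eq_1: "\<bar>x\<bar> \<le> 1 \<Longrightarrow> plateau x = 1"
  by (simp add: plateau_def smooth_step_eq_1)

lemma plateau_eq_0: "2 \<le> \<bar>x\<bar> \<Longrightarrow> plateau x = 0"
  by (auto simp: plateau_def smooth_step_eq_0 abs_if split: if_splits)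

lemma plateau_nonneg: "0 \<le> plateau x"
  by (simp add: plateau_def smooth_step_nonneg)

lemma nth_deriv_eq_0_outside:
  assumes "\<And>x. \<bar>x\<bar> > R \<Longrightarrow> f x = 0" "\<bar>x\<bar> > R"
  shows "nth_deriv j f x = 0"
proof -
  have "open {x::real. \<bar>x\<bar> > R}"
    by (intro open_Collect_less continuous_intros)
  from nth_deriv_cong_open[OF this, of f "\<lambda>x. 0" x j] assms show ?thesis
    by (simp add: nth_deriv_const)
qed

lemma continuous_real_bounded_on_interval:
  fixes f :: "real \<Rightarrow> 'a::real_normed_vector"
  assumes "continuous_on {a..b} f"
  obtains C where "C > 0" "\<And>x. x \<in> {a..b} \<Longrightarrow> norm (f x) \<le> C"
proof -
  have "bounded (f ` {a..b})"
    using assms compact_continuous_image compact_imp_bounded compact_Icc by blast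
  then show ?thesis using that by (auto simp: bounded_pos)
qed

lemma compact_support_bounded:
  assumes "smooth f" "\<And>x. \<bar>x\<bar> > R \<Longrightarrow> f x = 0"
  obtains C where "C > 0" "\<And>x. norm (nth_deriv j f x) \<le> C"
proof -
  obtain C where C: "C > 0" "\<And>x. x \<in> {-R..R} \<Longrightarrow> norm (nth_deriv j f x) \<le> C"
    using continuous_real_bounded_on_interval[OF smooth_continuous_nth_deriv[OF assms(1)]] by metis
  show ?thesis
  proof (rule that[OF C(1)])
    fix x show "norm (nth_deriv j f x) \<le> C"
    proof (cases "\<bar>x\<bar> > R")
      case True
      then show ?thesis using nth_deriv_eq_0_outside[OF assms(2) True] C(1) by simp
    next
      case False
      then have "x \<in> {-R..R}" by auto
      then show ?thesis by (rule C)
    qed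
  qed
qed

lemma plateau_deriv_bounded:
  obtains C where "C > 0" "\<And>x. \<bar>nth_deriv j plateau x\<bar> \<le> C"
  using compact_support_bounded[OF smooth_plateau, of 2 j] plateau_eq_0
  by (metis less_imp_le real_norm_def)

text \<open>In each term of the m-th chain rule the orders of the derivatives of s add up to m, so
  their bounds multiply to \<open>G ^ m\<close>. The constant depends on m alone and is quantified
  first: it is later applied to infinitely many iterates and to all points at once.\<close>

lemma nth_deriv_compose_bound:
  "\<exists>C\<ge>0. \<forall>s (f::real \<Rightarrow> 'a::real_normed_vector) x G M. smooth s \<longrightarrow> smooth f \<longrightarrow> 0 \<le> G \<longrightarrow>
     (\<forall>i\<in>{1..m}. \<bar>nth_deriv i s x\<bar> \<le> G ^ i) \<longrightarrow> (\<forall>i\<le>m. norm (nth_deriv i f (s x)) \<le> M) \<longrightarrow>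
     norm (nth_deriv m (\<lambda>x. f (s x)) x) \<le> C * M * G ^ m"
proof (induction m rule: less_induct)
  case (less m)
  show ?case
  proof (cases m)
    case 0
    then show ?thesis by (intro exI[of _ 1]) auto
  next
    case (Suc k)
    obtain C where C: "\<And>i. i \<le> k \<Longrightarrow> 0 \<le> C i"
      "\<And>i s (f::real \<Rightarrow> 'a) x G M. i \<le> k \<Longrightarrow> smooth s \<Longrightarrow> smooth f \<Longrightarrow> 0 \<le> G \<Longrightarrow>
       (\<forall>i\<in>{1..i}. \<bar>nth_deriv i s x\<bar> \<le> G ^ i) \<Longrightarrow> (\<forall>j\<le>i. norm (nth_deriv j f (s x)) \<le> M) \<Longrightarrow>
       norm (nth_deriv i (\<lambda>x. f (s x)) x) \<le> C i * M * G ^ i"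
      using less[unfolded Suc less_Suc_eq_le] by metis
    show ?thesis
    proof (intro exI[of _ "\<Sum>i\<le>k. real (k choose i) * C i"] conjI allI impI)
      show "0 \<le> (\<Sum>i\<le>k. real (k choose i) * C i)"
        using C(1) by (intro sum_nonneg mult_nonneg_nonneg) auto
      fix s and f :: "real \<Rightarrow> 'a" and x G M
      assume s: "smooth s" and f: "smooth f" and G: "0 \<le> G"
        and sG: "\<forall>i\<in>{1..m}. \<bar>nth_deriv i s x\<bar> \<le> G ^ i" and fM: "\<forall>i\<le>m. norm (nth_deriv i f (s x)) \<le> M"
      have "norm (real (k choose i) *\<^sub>R nth_deriv (Suc (k - i)) s x *\<^sub>R nth_deriv i (\<lambda>x. nth_deriv 1 f (s x)) x)
         \<le> real (k choose i) * C i * M * G ^ m" if i: "i \<le> k" for i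
      proof -
        \<comment> \<open>Induction hypothesis for f' in place of f; its derivatives up to order i
          are derivatives of f up to order at most m.\<close>
        have "norm (nth_deriv i (\<lambda>x. nth_deriv 1 f (s x)) x) \<le> C i * M * G ^ i"
          using sG fM i
          by (intro C s smooth_nth_deriv f G) (auto simp: Suc nth_deriv_add_index[symmetric])
        moreover have "\<bar>nth_deriv (Suc (k - i)) s x\<bar> \<le> G ^ Suc (k - i)"
          using sG[rule_format, of "Suc (k - i)"] i by (simp add: Suc)
        ultimately have "\<bar>nth_deriv (Suc (k - i)) s x\<bar> * norm (nth_deriv i (\<lambda>x. nth_deriv 1 f (s x)) x)
            \<le> G ^ Suc (k - i) * (C i * M * G ^ i)"
          using G by (intro mult_mono) auto
        also have "\<dots> = C i * M * G ^ (Suc (k - i) + i)"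
          unfolding power_add by (simp only: mult_ac)
        also have "Suc (k - i) + i = m" using i Suc by simp
        finally have "real (k choose i) * (\<bar>nth_deriv (Suc (k - i)) s x\<bar> * norm (nth_deriv i (\<lambda>x. nth_deriv 1 f (s x)) x))
            \<le> real (k choose i) * (C i * M * G ^ m)"
          by (rule mult_left_mono) simp
        then show ?thesis by (simp add: abs_mult mult_ac)
      qed
      then have "norm (nth_deriv m (\<lambda>x. f (s x)) x) \<le> (\<Sum>i\<le>k. real (k choose i) * C i * M * G ^ m)"
        unfolding Suc nth_deriv_compose_Suc[OF s f] by (intro sum_norm_le) (auto simp: Suc)
      then show "norm (nth_deriv m (\<lambda>x. f (s x)) x) \<le> (\<Sum>i\<le>k. real (k choose i) * C i) * M * G ^ m"
        by (simp add: sum_distrib_right)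
    qed
  qed
qed

text \<open>In the chain rule the top derivative of the inner function enters only through its product
  with the first derivative of the outer one, so it can be solved for.\<close>

lemma nth_deriv_inner_bound:
  assumes "c > 0" "M \<ge> 0"
  shows "\<exists>A\<ge>1. \<forall>s (f::real \<Rightarrow> 'a::real_normed_vector) x G. smooth s \<longrightarrow> smooth f \<longrightarrow> 0 \<le> G \<longrightarrow>
     c \<le> norm (nth_deriv 1 f (s x)) \<longrightarrow> (\<forall>i\<in>{1..m}. norm (nth_deriv i f (s x)) \<le> M) \<longrightarrow>
     (\<forall>i\<in>{1..m}. norm (nth_deriv i (\<lambda>x. f (s x)) x) \<le> G ^ i) \<longrightarrow>
     (\<forall>i\<in>{1..m}. \<bar>nth_deriv i s x\<bar> \<le> (A * G) ^ i)"
proof (induction m)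
  case 0
  then show ?case by (intro exI[of _ 1]) auto
next
  case (Suc m)
  then obtain A where A: "A \<ge> 1"
    "\<And>s (f::real \<Rightarrow> 'a) x G. smooth s \<Longrightarrow> smooth f \<Longrightarrow> 0 \<le> G \<Longrightarrow>
     c \<le> norm (nth_deriv 1 f (s x)) \<Longrightarrow> (\<forall>i\<in>{1..m}. norm (nth_deriv i f (s x)) \<le> M) \<Longrightarrow>
     (\<forall>i\<in>{1..m}. norm (nth_deriv i (\<lambda>x. f (s x)) x) \<le> G ^ i) \<Longrightarrow>
     (\<forall>i\<in>{1..m}. \<bar>nth_deriv i s x\<bar> \<le> (A * G) ^ i)"
    by blast
  obtain C where C: "\<And>i. 0 \<le> C i"
     "\<And>i s (f::real \<Rightarrow> 'a) x G M. smooth s \<Longrightarrow> smooth f \<Longrightarrow> 0 \<le> G \<Longrightarrow>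
       (\<forall>i\<in>{1..i}. \<bar>nth_deriv i s x\<bar> \<le> G ^ i) \<Longrightarrow> (\<forall>j\<le>i. norm (nth_deriv j f (s x)) \<le> M) \<Longrightarrow>
       norm (nth_deriv i (\<lambda>x. f (s x)) x) \<le> C i * M * G ^ i"
    using nth_deriv_compose_bound[where 'a = 'a] by metis
  define S where "S = (\<Sum>i\<in>{1..m}. real (m choose i) * C i * M)"
  have S: "S \<ge> 0" unfolding S_def using C(1) assms by (intro sum_nonneg mult_nonneg_nonneg) auto
  \<comment> \<open>The factor (1 + S)/c arises when the chain rule is divided by the first outer
    derivative; the maximum with 1 makes B at most \<open>B ^ Suc m\<close>.\<close>
  define B where "B = max 1 ((1 + S) / c)"
  have B: "B \<ge> 1" "(1 + S) / c \<le> B" by (auto simp: B_def)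
  show ?case
  proof (intro exI[of _ "A * B"] conjI allI impI ballI)
    show "1 \<le> A * B" using A(1) B(1) by (simp add: mult_ge1_I)
    fix s and f :: "real \<Rightarrow> 'a" and x G i
    assume s: "smooth s" and f: "smooth f" and G: "0 \<le> G"
      and c: "c \<le> norm (nth_deriv 1 f (s x))"
      and fM: "\<forall>i\<in>{1..Suc m}. norm (nth_deriv i f (s x)) \<le> M"
      and gG: "\<forall>i\<in>{1..Suc m}. norm (nth_deriv i (\<lambda>x. f (s x)) x) \<le> G ^ i"
      and i: "i \<in> {1..Suc m}"
    have IH: "\<forall>i\<in>{1..m}. \<bar>nth_deriv i s x\<bar> \<le> (A * G) ^ i"
      by (rule A(2)[OF s f G c]) (use fM gG in auto)
    have AG: "0 \<le> A * G" "G \<le> A * G" using A(1) G mult_right_mono[OF A(1) G] by auto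
    show "\<bar>nth_deriv i s x\<bar> \<le> (A * B * G) ^ i"
    proof (cases "i = Suc m")
      case False
      then have "\<bar>nth_deriv i s x\<bar> \<le> (A * G) ^ i" using IH i by auto
      also have "\<dots> \<le> (A * B * G) ^ i"
      proof (rule power_mono[OF _ AG(1)])
        show "A * G \<le> A * B * G" using mult_left_mono[OF B(1) AG(1)] by (simp add: mult_ac)
      qed
      finally show ?thesis .
    next
      case True
      let ?t = "\<lambda>i. real (m choose i) *\<^sub>R nth_deriv (Suc (m - i)) s x *\<^sub>R nth_deriv i (\<lambda>x. nth_deriv 1 f (s x)) x"
      have "norm (?t i) \<le> real (m choose i) * C i * M * (A * G) ^ Suc m" if i: "i \<in> {1..m}" for i
      proof -
        have "norm (nth_deriv i (\<lambda>x. nth_deriv 1 f (s x)) x) \<le> C i * M * (A * G) ^ i"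
          using IH fM i
          by (intro C s smooth_nth_deriv f AG) (auto simp: nth_deriv_add_index[symmetric])
        moreover have "\<bar>nth_deriv (Suc (m - i)) s x\<bar> \<le> (A * G) ^ Suc (m - i)"
          by (rule IH[rule_format]) (use i in auto)
        ultimately have "\<bar>nth_deriv (Suc (m - i)) s x\<bar> * norm (nth_deriv i (\<lambda>x. nth_deriv 1 f (s x)) x)
            \<le> (A * G) ^ Suc (m - i) * (C i * M * (A * G) ^ i)"
          using AG by (intro mult_mono) auto
        also have "\<dots> = C i * M * (A * G) ^ (Suc (m - i) + i)"
          unfolding power_add by (simp only: mult_ac)
        also have "Suc (m - i) + i = Suc m" using i by simp
        finally have "real (m choose i) * (\<bar>nth_deriv (Suc (m - i)) s x\<bar> * norm (nth_deriv i (\<lambda>x. nth_deriv 1 f (s x)) x))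
            \<le> real (m choose i) * (C i * M * (A * G) ^ Suc m)"
          by (rule mult_left_mono) simp
        then show ?thesis by (simp add: abs_mult mult_ac)
      qed
      then have rest: "norm (\<Sum>i\<in>{1..m}. ?t i) \<le> S * (A * G) ^ Suc m"
        unfolding S_def sum_distrib_right by (rule sum_norm_le)
      \<comment> \<open>Isolates the summand i = 0, the one that contains the top derivative of
        s.\<close>
      have "{..m} = insert 0 {1..m}" by auto
      then have "nth_deriv (Suc m) (\<lambda>x. f (s x)) x = nth_deriv (Suc m) s x *\<^sub>R nth_deriv 1 f (s x) + (\<Sum>i\<in>{1..m}. ?t i)"
        unfolding nth_deriv_compose_Suc[OF s f] by simp
      then have "nth_deriv (Suc m) s x *\<^sub>R nth_deriv 1 f (s x) = nth_deriv (Suc m) (\<lambda>x. f (s x)) x - (\<Sum>i\<in>{1..m}. ?t i)"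
        by (simp only: add_diff_cancel_right')
      then have "norm (nth_deriv (Suc m) s x *\<^sub>R nth_deriv 1 f (s x))
         \<le> norm (nth_deriv (Suc m) (\<lambda>x. f (s x)) x) + norm (\<Sum>i\<in>{1..m}. ?t i)"
        by (simp only: norm_triangle_ineq4)
      also have "\<dots> \<le> G ^ Suc m + S * (A * G) ^ Suc m"
        by (rule add_mono[OF bspec[OF gG] rest]) auto
      also have "\<dots> \<le> (A * G) ^ Suc m + S * (A * G) ^ Suc m"
        by (rule add_right_mono[OF power_mono[OF AG(2) G]])
      finally have "\<bar>nth_deriv (Suc m) s x\<bar> * norm (nth_deriv 1 f (s x)) \<le> (1 + S) * (A * G) ^ Suc m"
        by (simp add: algebra_simps)
      moreover have "\<bar>nth_deriv (Suc m) s x\<bar> * c \<le> \<bar>nth_deriv (Suc m) s x\<bar> * norm (nth_deriv 1 f (s x))"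
        using c by (intro mult_left_mono) auto
      ultimately have "\<bar>nth_deriv (Suc m) s x\<bar> * c \<le> (1 + S) * (A * G) ^ Suc m" by linarith
      then have "\<bar>nth_deriv (Suc m) s x\<bar> \<le> ((1 + S) / c) * (A * G) ^ Suc m"
        using assms(1) by (simp add: field_simps)
      also have "\<dots> \<le> B * (A * G) ^ Suc m"
        using B AG by (intro mult_right_mono) auto
      \<comment> \<open>Raising B to the same power as \<open>A * G\<close> restores the homogeneous
        form of the bound.\<close>
      also have "\<dots> \<le> B ^ Suc m * (A * G) ^ Suc m"
        using B AG self_le_power[of B "Suc m"] by (intro mult_right_mono) auto
      also have "\<dots> = (A * B * G) ^ Suc m"
        by (simp add: power_mult_distrib mult_ac)
      finally show ?thesis using True by simp
    qed
  qed
qed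

section \<open>Polynomial growth and rapid decrease\<close>

lemma nth_deriv_translate:
  fixes c :: real
  assumes "smooth f"
  shows "nth_deriv j (\<lambda>x. f (x + c)) = (\<lambda>x. nth_deriv j f (x + c))"
  using assms
proof (induction j arbitrary: f)
  case (Suc j)
  have "((\<lambda>x. f (x + c)) has_vector_derivative 1 *\<^sub>R nth_deriv 1 f (x + c)) (at x)" for x
    by (rule has_vector_derivative_compose_real)
       (auto intro!: derivative_eq_intros smooth_deriv1[OF Suc.prems, unfolded One_nat_def])
  then have "nth_deriv (Suc j) (\<lambda>x. f (x + c)) = nth_deriv j (\<lambda>x. nth_deriv 1 f (x + c))"
    by (intro nth_deriv_eqI) simp
  then show ?case
    using Suc.IH[OF smooth_nth_deriv[OF Suc.prems, of 1]] by (simp add: nth_deriv_add_index[symmetric])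
qed simp

lemma nth_deriv_scaleR_const:
  fixes c :: "'a::real_normed_vector"
  assumes "smooth r"
  shows "nth_deriv j (\<lambda>x. r x *\<^sub>R c) = (\<lambda>x. nth_deriv j r x *\<^sub>R c)"
  using assms
proof (induction j arbitrary: r)
  case (Suc j)
  have "((\<lambda>x. r x *\<^sub>R c) has_vector_derivative r x *\<^sub>R 0 + nth_deriv 1 r x *\<^sub>R c) (at x)" for x
    by (intro has_vector_derivative_scaleR has_vector_derivative_const
        smooth_deriv1[OF Suc.prems, folded has_real_derivative_iff_has_vector_derivative])
  then have "nth_deriv (Suc j) (\<lambda>x. r x *\<^sub>R c) = nth_deriv j (\<lambda>x. nth_deriv 1 r x *\<^sub>R c)"
    by (intro nth_deriv_eqI) simp
  then show ?case
    using Suc.IH[OF smooth_nth_deriv[OF Suc.prems, of 1]] by (simp add: nth_deriv_add_index[symmetric])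
qed simp

definition poly_bounded :: "(real \<Rightarrow> 'a::real_normed_vector) \<Rightarrow> bool" where
  "poly_bounded f \<longleftrightarrow> (\<exists>k C. \<forall>x. norm (f x) \<le> C * (1 + x\<^sup>2) ^ k)"

text \<open>A condition on values only, without any regularity, so that roots, moduli and indicator
  functions can qualify. \<open>rapidly_decreasing_dominated\<close> replaces them by Schwartz
  functions.\<close>

definition rapidly_decreasing :: "(real \<Rightarrow> 'a::real_normed_vector) \<Rightarrow> bool" where
  "rapidly_decreasing f \<longleftrightarrow> (\<forall>k. \<exists>C. \<forall>x. (1 + x\<^sup>2) ^ k * norm (f x) \<le> C)"

lemma one_le_weight: "1 \<le> (1 + (x::real)\<^sup>2) ^ k"
  by (simp add: one_le_power)

lemma weight_pos: "0 < (1 + (x::real)\<^sup>2) ^ k"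
  by (intro zero_less_power add_pos_nonneg) auto

lemma weight_mono: "k \<le> l \<Longrightarrow> (1 + (x::real)\<^sup>2) ^ k \<le> (1 + x\<^sup>2) ^ l"
  by (intro power_increasing) auto

lemma poly_boundedE:
  assumes "poly_bounded f"
  obtains k C where "C \<ge> 1" "\<And>x. norm (f x) \<le> C * (1 + x\<^sup>2) ^ k"
proof -
  obtain k C where C: "\<And>x. norm (f x) \<le> C * (1 + x\<^sup>2) ^ k"
    using assms by (auto simp: poly_bounded_def)
  have "norm (f x) \<le> max 1 C * (1 + x\<^sup>2) ^ k" for x
    by (rule order_trans[OF C mult_right_mono]) (use weight_pos less_imp_le in auto)
  then show ?thesis by (intro that[of "max 1 C" k]) auto
qed

lemma poly_boundedE_uniform:
  fixes F :: "nat \<Rightarrow> real \<Rightarrow> 'a::real_normed_vector"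
  assumes "\<And>j. j \<le> m \<Longrightarrow> poly_bounded (F j)"
  obtains k C where "C \<ge> 1" "\<And>j x. j \<le> m \<Longrightarrow> norm (F j x) \<le> C * (1 + x\<^sup>2) ^ k"
proof -
  have "\<exists>k C. C \<ge> 1 \<and> (\<forall>x. norm (F j x) \<le> C * (1 + x\<^sup>2) ^ k)" if "j \<le> m" for j
    using poly_boundedE[OF assms[OF that]] by metis
  then obtain k C where kC: "\<And>j. j \<le> m \<Longrightarrow> C j \<ge> (1::real)"
      "\<And>j x. j \<le> m \<Longrightarrow> norm (F j x) \<le> C j * (1 + x\<^sup>2) ^ k j"
    by metis
  have C0: "\<And>j. j \<le> m \<Longrightarrow> 0 \<le> C j" using kC(1) by force
  show ?thesis
  proof (rule that[of "\<Sum>j\<le>m. C j" "\<Sum>j\<le>m. k j"])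
    have "1 \<le> C 0" using kC by simp
    also have "\<dots> \<le> (\<Sum>j\<le>m. C j)" by (rule member_le_sum) (use C0 in auto)
    finally show "1 \<le> (\<Sum>j\<le>m. C j)" .
    fix j x assume j: "j \<le> m"
    have "norm (F j x) \<le> C j * (1 + x\<^sup>2) ^ k j" using kC j by blast
    also have "\<dots> \<le> (\<Sum>j\<le>m. C j) * (1 + x\<^sup>2) ^ (\<Sum>j\<le>m. k j)"
    proof (rule mult_mono)
      show "C j \<le> (\<Sum>j\<le>m. C j)" by (rule member_le_sum) (use C0 j in auto)
      show "(1 + x\<^sup>2) ^ k j \<le> (1 + x\<^sup>2) ^ (\<Sum>j\<le>m. k j)"
        by (intro weight_mono member_le_sum) (use j in auto)
      show "0 \<le> (\<Sum>j\<le>m. C j)" by (intro sum_nonneg) (use C0 in auto)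
    qed (use less_imp_le[OF weight_pos] in auto)
    finally show "norm (F j x) \<le> (\<Sum>j\<le>m. C j) * (1 + x\<^sup>2) ^ (\<Sum>j\<le>m. k j)" .
  qed
qed

lemma bounded_imp_poly_bounded: "(\<And>x. norm (f x) \<le> C) \<Longrightarrow> poly_bounded f"
  unfolding poly_bounded_def by (intro exI[of _ 0] exI[of _ C]) simp

lemma poly_bounded_add:
  assumes "poly_bounded f" "poly_bounded g"
  shows "poly_bounded (\<lambda>x. f x + g x)"
proof -
  obtain k C where C: "C \<ge> 1" "\<And>x. norm (f x) \<le> C * (1 + x\<^sup>2) ^ k"
    using poly_boundedE[OF assms(1)] by metis
  obtain l D where D: "D \<ge> 1" "\<And>x. norm (g x) \<le> D * (1 + x\<^sup>2) ^ l"
    using poly_boundedE[OF assms(2)] by metis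
  have "norm (f x + g x) \<le> (C + D) * (1 + x\<^sup>2) ^ (k + l)" for x
  proof -
    have "norm (f x) \<le> C * (1 + x\<^sup>2) ^ (k + l)"
      by (rule order_trans[OF C(2) mult_left_mono]) (use C in \<open>auto intro: weight_mono\<close>)
    moreover have "norm (g x) \<le> D * (1 + x\<^sup>2) ^ (k + l)"
      by (rule order_trans[OF D(2) mult_left_mono]) (use D in \<open>auto intro: weight_mono\<close>)
    ultimately show ?thesis
      using norm_triangle_ineq[of "f x" "g x"] by (simp add: algebra_simps)
  qed
  then show ?thesis unfolding poly_bounded_def by blast
qed

lemma poly_bounded_cscaleR:
  assumes "poly_bounded f"
  shows "poly_bounded (\<lambda>x. c *\<^sub>R f x)"
proof -
  obtain k C where C: "C \<ge> 1" "\<And>x. norm (f x) \<le> C * (1 + x\<^sup>2) ^ k"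
    using poly_boundedE[OF assms(1)] by metis
  have "norm (c *\<^sub>R f x) \<le> (\<bar>c\<bar> * C) * (1 + x\<^sup>2) ^ k" for x
    using mult_left_mono[OF C(2)[of x], of "\<bar>c\<bar>"] by (simp add: mult_ac)
  then show ?thesis unfolding poly_bounded_def by blast
qed

lemma O_M_iff:
  "f \<in> O_M \<longleftrightarrow> smooth f \<and> (\<forall>j. poly_bounded (nth_deriv j f))"
proof (intro iffI conjI allI)
  assume f: "f \<in> O_M"
  \<comment> \<open>Order \<open>Suc j\<close>, because \<open>C_k m\<close> grants
    differentiability only to derivatives of order below m.\<close>
  have *: "\<exists>n. f \<in> O_space (Suc j) n" for j
    using f by (auto simp: O_M_def)
  show "smooth f"
    unfolding smooth_def
  proof (intro allI)
    fix j x show "nth_deriv j f differentiable (at x)"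
      using *[of j] by (auto simp: O_space_def C_k_def)
  qed
  fix j
  obtain n where "f \<in> O_space (Suc j) n" using * by blast
  then obtain C where C: "\<And>y. y \<in> {norm (nth_deriv i f x) / (1 + \<bar>x\<bar>\<^sup>2) ^ n | x i. i \<le> Suc j} \<Longrightarrow> y \<le> C"
    unfolding O_space_def bdd_above_def by blast
  have "norm (nth_deriv j f x) \<le> C * (1 + x\<^sup>2) ^ n" for x
  proof -
    have "norm (nth_deriv j f x) / (1 + \<bar>x\<bar>\<^sup>2) ^ n \<le> C"
      by (rule C) (blast intro: le_SucI)
    then show ?thesis using weight_pos[of x n] by (simp add: field_simps)
  qed
  then show "poly_bounded (nth_deriv j f)" unfolding poly_bounded_def by blast
next
  assume f: "smooth f \<and> (\<forall>j. poly_bounded (nth_deriv j f))"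
  have "\<exists>n\<ge>1. f \<in> O_space m n" for m
  proof -
    obtain k C where C: "C \<ge> 1" "\<And>j x. j \<le> m \<Longrightarrow> norm (nth_deriv j f x) \<le> C * (1 + x\<^sup>2) ^ k"
      by (rule poly_boundedE_uniform[of m "\<lambda>j. nth_deriv j f"]) (use f in auto)
    \<comment> \<open>The exponent is raised to \<open>Suc k\<close> because the union in
      \<open>O_M\<close> starts at n = 1, while k may be 0.\<close>
    have "norm (nth_deriv j f x) / (1 + \<bar>x\<bar>\<^sup>2) ^ Suc k \<le> C" if "j \<le> m" for j x
    proof -
      have "norm (nth_deriv j f x) \<le> C * (1 + x\<^sup>2) ^ Suc k"
        by (rule order_trans[OF C(2)[OF that] mult_left_mono]) (use C in \<open>auto intro: weight_mono simp del: power_Suc\<close>)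
      then show ?thesis using weight_pos[of x "Suc k"] by (simp add: field_simps del: power_Suc)
    qed
    then have "bdd_above {norm (nth_deriv j f x) / (1 + \<bar>x\<bar>\<^sup>2) ^ Suc k | x j. j \<le> m}"
      by (auto intro!: bdd_aboveI[of _ C] simp del: power_Suc)
    moreover have "f \<in> C_k m"
      using f by (auto simp: C_k_def smooth_def[of f] smooth_continuous_nth_deriv)
    ultimately show ?thesis
      unfolding O_space_def by (intro exI[of _ "Suc k"]) (simp del: power_Suc)
  qed
  then show "f \<in> O_M" by (auto simp: O_M_def)
qed

lemma schwartz_iff:
  "v \<in> schwartz \<longleftrightarrow> smooth v \<and> (\<forall>j. rapidly_decreasing (nth_deriv j v))"
proof (intro iffI conjI allI)
  assume v: "v \<in> schwartz"
  show "smooth v"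
    unfolding smooth_def
  proof (intro allI)
    fix j x show "nth_deriv j v differentiable (at x)"
      using v by (auto simp: schwartz_def C_k_def)
  qed
  fix j
  show "rapidly_decreasing (nth_deriv j v)"
    unfolding rapidly_decreasing_def
  proof
    fix k
    have bdd: "bdd_above (range (\<lambda>x. \<bar>x\<bar> ^ l * norm (nth_deriv j v x)))" for l
      using v by (auto simp: schwartz_def)
    obtain C where C: "\<And>x. \<bar>x\<bar> ^ (2 * k) * norm (nth_deriv j v x) \<le> C"
      using bdd[of "2 * k"] by (auto simp: bdd_above_def)
    obtain D where D: "\<And>x. \<bar>x\<bar> ^ 0 * norm (nth_deriv j v x) \<le> D"
      using bdd[of 0] by (auto simp: bdd_above_def)
    have "(1 + x\<^sup>2) ^ k * norm (nth_deriv j v x) \<le> 2 ^ k * (C + D)" for x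
    proof -
      have "(1 + x\<^sup>2) ^ k \<le> (2 * max 1 (x\<^sup>2)) ^ k" by (rule power_mono) auto
      also have "\<dots> = 2 ^ k * max 1 (x\<^sup>2) ^ k" by (rule power_mult_distrib)
      also have "max 1 (x\<^sup>2) ^ k \<le> \<bar>x\<bar> ^ (2 * k) + 1"
        by (auto simp: max_def power_mult)
      finally have "(1 + x\<^sup>2) ^ k * norm (nth_deriv j v x) \<le> 2 ^ k * (\<bar>x\<bar> ^ (2 * k) + 1) * norm (nth_deriv j v x)"
        by (intro mult_right_mono) auto
      also have "\<dots> = 2 ^ k * (\<bar>x\<bar> ^ (2 * k) * norm (nth_deriv j v x) + \<bar>x\<bar> ^ 0 * norm (nth_deriv j v x))"
        by (simp add: algebra_simps)
      also have "\<dots> \<le> 2 ^ k * (C + D)" by (intro mult_left_mono add_mono C D) auto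
      finally show ?thesis .
    qed
    then show "\<exists>C. \<forall>x. (1 + x\<^sup>2) ^ k * norm (nth_deriv j v x) \<le> C" by blast
  qed
next
  assume v: "smooth v \<and> (\<forall>j. rapidly_decreasing (nth_deriv j v))"
  have "bdd_above (range (\<lambda>x. \<bar>x\<bar> ^ k * norm (nth_deriv j v x)))" for k j
  proof -
    obtain C where C: "\<And>x. (1 + x\<^sup>2) ^ k * norm (nth_deriv j v x) \<le> C"
      using v unfolding rapidly_decreasing_def by metis
    have "\<bar>x\<bar> ^ k * norm (nth_deriv j v x) \<le> C" for x
    proof -
      have "\<bar>x\<bar> \<le> 1 + x\<^sup>2" using zero_le_power2[of "\<bar>x\<bar> - 1"] by (simp add: power2_eq_square algebra_simps)
      then have "\<bar>x\<bar> ^ k * norm (nth_deriv j v x) \<le> (1 + x\<^sup>2) ^ k * norm (nth_deriv j v x)"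
        by (intro mult_right_mono power_mono) auto
      with C[of x] show ?thesis by linarith
    qed
    then show ?thesis by (auto intro!: bdd_aboveI[of _ C])
  qed
  moreover have "v \<in> C_k m" for m
    using v by (auto simp: C_k_def smooth_def[of v] smooth_continuous_nth_deriv)
  ultimately show "v \<in> schwartz" by (auto simp: schwartz_def)
qed

text \<open>A form of Peetre's inequality: moving the point by at most c costs only a constant
  factor. It rests on (x - 2y)^2 >= 0.\<close>

lemma weight_le_translate:
  fixes x y :: real
  assumes "\<bar>x - y\<bar> \<le> c" "c \<ge> 0"
  shows "(1 + x\<^sup>2) ^ k \<le> (2 * (1 + c\<^sup>2)) ^ k * (1 + y\<^sup>2) ^ k"
proof -
  have "x\<^sup>2 \<le> 2 * y\<^sup>2 + 2 * (x - y)\<^sup>2"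
    using zero_le_power2[of "x - 2 * y"] by (simp add: power2_eq_square algebra_simps)
  moreover have "(x - y)\<^sup>2 \<le> c\<^sup>2" using assms abs_le_square_iff[of "x - y" c] by simp
  moreover have "0 \<le> c\<^sup>2 * y\<^sup>2" by (intro mult_nonneg_nonneg) auto
  moreover have "2 * (1 + c\<^sup>2) * (1 + y\<^sup>2) = 2 + 2 * c\<^sup>2 + 2 * y\<^sup>2 + 2 * (c\<^sup>2 * y\<^sup>2)"
    by (simp add: algebra_simps)
  ultimately have "1 + x\<^sup>2 \<le> 2 * (1 + c\<^sup>2) * (1 + y\<^sup>2)" by linarith
  then show ?thesis unfolding power_mult_distrib[symmetric] by (intro power_mono) auto
qed

text \<open>The majorant is the sum over integers n of \<open>E n\<close> times a plateau centred at
  n. Differentiation falls on the plateaus only, whose derivatives are bounded, so all derivatives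
  inherit the rapid decrease of the numbers \<open>E n\<close>.\<close>

lemma rapidly_decreasing_dominated:
  fixes \<epsilon> :: "real \<Rightarrow> real"
  assumes "rapidly_decreasing \<epsilon>"
  obtains v where "v \<in> schwartz" "\<And>x. \<bar>\<epsilon> x\<bar> \<le> norm (v x)"
proof -
  \<comment> \<open>Local suprema over the interval on which the plateau centred at n equals
    1.\<close>
  define E where "E n = (SUP x\<in>{real_of_int n - 1..real_of_int n + 1}. \<bar>\<epsilon> x\<bar>)" for n
  obtain C where C: "\<And>k x. (1 + x\<^sup>2) ^ k * \<bar>\<epsilon> x\<bar> \<le> C k"
    using assms unfolding rapidly_decreasing_def real_norm_def by metis
  have bdd: "bdd_above ((\<lambda>x. \<bar>\<epsilon> x\<bar>) ` {real_of_int n - 1..real_of_int n + 1})" for n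
    using C[of _ 0] by (auto intro!: bdd_aboveI[of _ "C 0"])
  have E_ge: "\<bar>\<epsilon> x\<bar> \<le> E n" if "x \<in> {real_of_int n - 1..real_of_int n + 1}" for n x
    unfolding E_def using bdd that by (rule cSUP_upper2) auto
  have E0: "0 \<le> E n" for n
    using E_ge[of "real_of_int n" n] by auto
  have E_le: "(1 + (real_of_int n)\<^sup>2) ^ k * E n \<le> 4 ^ k * C k" for k n
  proof -
    have "E n \<le> 4 ^ k * C k / (1 + (real_of_int n)\<^sup>2) ^ k"
      unfolding E_def
    proof (rule cSUP_least)
      fix x assume "x \<in> {real_of_int n - 1..real_of_int n + 1}"
      then have "(1 + (real_of_int n)\<^sup>2) ^ k \<le> 4 ^ k * (1 + x\<^sup>2) ^ k"
        using weight_le_translate[of "real_of_int n" x 1 k] by (simp add: abs_le_iff)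
      then have "(1 + (real_of_int n)\<^sup>2) ^ k * \<bar>\<epsilon> x\<bar> \<le> 4 ^ k * (1 + x\<^sup>2) ^ k * \<bar>\<epsilon> x\<bar>"
        by (rule mult_right_mono) simp
      also have "\<dots> = 4 ^ k * ((1 + x\<^sup>2) ^ k * \<bar>\<epsilon> x\<bar>)" by simp
      also have "\<dots> \<le> 4 ^ k * C k" by (intro mult_left_mono C) auto
      finally show "\<bar>\<epsilon> x\<bar> \<le> 4 ^ k * C k / (1 + (real_of_int n)\<^sup>2) ^ k"
        using weight_pos[of "real_of_int n" k] by (simp add: field_simps)
    qed simp
    then show ?thesis using weight_pos[of "real_of_int n" k] by (simp add: field_simps)
  qed
  \<comment> \<open>Outside this window of indices |x - n| >= 2, and the plateau vanishes; the sum
    is the full series, written finitely.\<close>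
  define r where "r x = (\<Sum>n\<in>{\<lfloor>x\<rfloor> - 2..\<lfloor>x\<rfloor> + 3}. E n * plateau (x + - real_of_int n))" for x
  \<comment> \<open>One more index on each side: the same finite set then serves all x at distance
    less than 1 from x0, which makes \<open>r\<close> a fixed finite sum there.\<close>
  define F where "F x0 = {\<lfloor>x0\<rfloor> - 3..\<lfloor>x0\<rfloor> + 4}" for x0 :: real
  have r_local: "r x = (\<Sum>n\<in>F x0. E n * plateau (x + - real_of_int n))" if "x \<in> ball x0 1" for x x0
    unfolding r_def
  proof (rule sum.mono_neutral_left)
    have "\<bar>x - x0\<bar> < 1" using that by (simp add: dist_real_def abs_minus_commute)
    then show "{\<lfloor>x\<rfloor> - 2..\<lfloor>x\<rfloor> + 3} \<subseteq> F x0"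
      unfolding F_def by (auto; linarith)
    show "\<forall>n\<in>F x0 - {\<lfloor>x\<rfloor> - 2..\<lfloor>x\<rfloor> + 3}. E n * plateau (x + - real_of_int n) = 0"
    proof
      fix n assume "n \<in> F x0 - {\<lfloor>x\<rfloor> - 2..\<lfloor>x\<rfloor> + 3}"
      then have "n < \<lfloor>x\<rfloor> - 2 \<or> n > \<lfloor>x\<rfloor> + 3" by auto
      then have "2 \<le> \<bar>x + - real_of_int n\<bar>" by linarith
      then show "E n * plateau (x + - real_of_int n) = 0" by (simp add: plateau_eq_0)
    qed
  qed (simp add: F_def)
  have smooth_term: "smooth (\<lambda>x. E n * plateau (x + - real_of_int n))" for n
    using smooth_cscaleR[OF smooth_compose[OF smooth_linear[of 1 "- real_of_int n"] smooth_plateau]]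
    by simp
  have smooth_r: "smooth r"
  proof (rule smooth_local)
    fix x0
    show "\<exists>S g. open S \<and> x0 \<in> S \<and> smooth g \<and> (\<forall>y\<in>S. r y = g y)"
      using r_local[of _ x0] smooth_sum[of "F x0", OF smooth_term]
      by (intro exI[of _ "ball x0 1"] exI[of _ "\<lambda>x. \<Sum>n\<in>F x0. E n * plateau (x + - real_of_int n)"]) auto
  qed
  have r_deriv: "nth_deriv j r x = (\<Sum>n\<in>F x. E n * nth_deriv j plateau (x + - real_of_int n))" for j x
  proof -
    have "nth_deriv j r x = nth_deriv j (\<lambda>x'. \<Sum>n\<in>F x. E n * plateau (x' + - real_of_int n)) x"
      by (rule nth_deriv_cong_open[of "ball x 1"]) (use r_local in auto)
    also have "\<dots> = (\<Sum>n\<in>F x. nth_deriv j (\<lambda>x. E n * plateau (x + - real_of_int n)) x)"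
      by (rule nth_deriv_sum) (rule smooth_term)
    also have "\<dots> = (\<Sum>n\<in>F x. E n * nth_deriv j plateau (x + - real_of_int n))"
    proof (rule sum.cong[OF refl])
      fix n
      have "smooth (\<lambda>x. plateau (x + - real_of_int n))"
        using smooth_compose[OF smooth_linear[of 1 "- real_of_int n"] smooth_plateau] by simp
      then show "nth_deriv j (\<lambda>x. E n * plateau (x + - real_of_int n)) x
        = E n * nth_deriv j plateau (x + - real_of_int n)"
        using nth_deriv_cscaleR[of "\<lambda>x. plateau (x + - real_of_int n)" j "E n" x]
          nth_deriv_translate[OF smooth_plateau, of j "- real_of_int n"] by simp
    qed
    finally show ?thesis .
  qed
  have rapid: "rapidly_decreasing (nth_deriv j r)" for j
    unfolding rapidly_decreasing_def
  proof
    fix k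
    obtain P where P: "P > 0" "\<And>x. \<bar>nth_deriv j plateau x\<bar> \<le> P"
      using plateau_deriv_bounded by metis
    \<comment> \<open>Here 8 is the number of indices in \<open>F x\<close>, 5 bounds |x - n| on it
      and enters through \<open>weight_le_translate\<close>, and \<open>4 ^ k * C k\<close> comes
      from \<open>E_le\<close>.\<close>
    have "(1 + x\<^sup>2) ^ k * norm (nth_deriv j r x) \<le> 8 * ((2 * (1 + 5\<^sup>2)) ^ k * (4 ^ k * C k) * P)" for x
    proof -
      have "norm ((1 + x\<^sup>2) ^ k * (E n * nth_deriv j plateau (x + - real_of_int n)))
          \<le> (2 * (1 + 5\<^sup>2)) ^ k * (4 ^ k * C k) * P" if "n \<in> F x" for n
      proof -
        have "\<bar>x - real_of_int n\<bar> \<le> 5" using that unfolding F_def by (auto; linarith)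
        then have "(1 + x\<^sup>2) ^ k \<le> (2 * (1 + 5\<^sup>2)) ^ k * (1 + (real_of_int n)\<^sup>2) ^ k"
          by (rule weight_le_translate) simp
        then have "(1 + x\<^sup>2) ^ k * E n \<le> (2 * (1 + 5\<^sup>2)) ^ k * (1 + (real_of_int n)\<^sup>2) ^ k * E n"
          by (rule mult_right_mono) (rule E0)
        also have "\<dots> \<le> (2 * (1 + 5\<^sup>2)) ^ k * (4 ^ k * C k)"
          unfolding mult.assoc[of "(2 * (1 + 5\<^sup>2)) ^ k"] by (intro mult_left_mono E_le) auto
        finally have *: "(1 + x\<^sup>2) ^ k * E n \<le> (2 * (1 + 5\<^sup>2)) ^ k * (4 ^ k * C k)" .
        have "(1 + x\<^sup>2) ^ k * E n * \<bar>nth_deriv j plateau (x + - real_of_int n)\<bar>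
          \<le> (2 * (1 + 5\<^sup>2)) ^ k * (4 ^ k * C k) * P"
        proof (rule mult_mono[OF * P(2)])
          have "0 \<le> (1 + x\<^sup>2) ^ k * E n" using E0 less_imp_le[OF weight_pos] by (intro mult_nonneg_nonneg)
          then show "0 \<le> (2 * (1 + 5\<^sup>2)) ^ k * (4 ^ k * C k)" using * by linarith
        qed simp
        then show ?thesis using E0[of n] weight_pos[of x k] by (simp add: abs_mult mult_ac)
      qed
      from sum_norm_le[of "F x", OF this]
      have "norm (\<Sum>n\<in>F x. (1 + x\<^sup>2) ^ k * (E n * nth_deriv j plateau (x + - real_of_int n)))
         \<le> 8 * ((2 * (1 + 5\<^sup>2)) ^ k * (4 ^ k * C k) * P)"
        by (simp add: F_def)
      then show ?thesis
        using weight_pos[of x k] by (simp add: r_deriv sum_distrib_left[symmetric] abs_mult)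
    qed
    then show "\<exists>C. \<forall>x. (1 + x\<^sup>2) ^ k * norm (nth_deriv j r x) \<le> C" by blast
  qed
  show ?thesis
  proof (rule that)
    show "(\<lambda>x. r x *\<^sub>R (1::complex)) \<in> schwartz"
      unfolding schwartz_iff nth_deriv_scaleR_const[OF smooth_r]
      using rapid smooth_scaleR[OF smooth_r smooth_const] by (simp add: rapidly_decreasing_def)
    fix x
    have "\<bar>\<epsilon> x\<bar> \<le> E \<lfloor>x\<rfloor>" by (rule E_ge) (auto; linarith)
    \<comment> \<open>The single term n = floor x already suffices, since all terms are
      nonnegative.\<close>
    also have "\<bar>x + - real_of_int \<lfloor>x\<rfloor>\<bar> \<le> 1" by linarith
    then have "E \<lfloor>x\<rfloor> = E \<lfloor>x\<rfloor> * plateau (x + - real_of_int \<lfloor>x\<rfloor>)"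
      by (simp only: plateau_eq_1 mult_1_right)
    also have "\<dots> \<le> r x"
      unfolding r_def by (rule member_le_sum) (auto intro!: mult_nonneg_nonneg E0 plateau_nonneg)
    finally show "\<bar>\<epsilon> x\<bar> \<le> norm (r x *\<^sub>R (1::complex))" by simp
  qed
qed

text \<open>If w grew faster than every polynomial along points X k, then |w|^(-1/2) on these points
  would be rapidly decreasing, although its product with |w| is |w|^(1/2), which is unbounded there.
  The weight need not be continuous, so the points may repeat or accumulate.\<close>

lemma poly_bounded_if_schwartz_multiples_bounded:
  assumes "\<And>v. v \<in> schwartz \<Longrightarrow> \<exists>B. \<forall>x. norm (v x) * norm (w x) \<le> B"
  shows "poly_bounded w"
proof (rule ccontr)
  assume not: "\<not> poly_bounded w"
  have "\<exists>x. real k * (1 + x\<^sup>2) ^ k < norm (w x)" for k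
    using not unfolding poly_bounded_def by (meson not_le)
  then obtain X where X: "\<And>k. real k * (1 + (X k)\<^sup>2) ^ k < norm (w (X k))" by metis
  define \<epsilon> where "\<epsilon> x = (if x \<in> range X then 1 / sqrt (norm (w x)) else 0)" for x
  have X_pos: "0 < norm (w (X k))" for k
    by (rule le_less_trans[OF _ X[of k]]) (use weight_pos less_imp_le in auto)
  have \<epsilon>0: "0 \<le> \<epsilon> x" for x by (simp add: \<epsilon>_def)
  have "rapidly_decreasing \<epsilon>"
    unfolding rapidly_decreasing_def
  proof
    fix j
    \<comment> \<open>Absorbs the finitely many points with k <= 2j. For k > 2j the choice of X k
      gives |w| >= (1 + x^2)^(2j), whose square root is the required power.\<close>
    let ?B = "\<Sum>k\<le>2 * j. (1 + (X k)\<^sup>2) ^ j * \<epsilon> (X k)"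
    have t0: "0 \<le> (1 + x\<^sup>2) ^ j * \<epsilon> y" for x y using weight_pos[of x j] \<epsilon>0[of y] by simp
    have B0: "0 \<le> ?B" by (intro sum_nonneg t0)
    have "(1 + x\<^sup>2) ^ j * norm (\<epsilon> x) \<le> 1 + ?B" for x
    proof (cases "x \<in> range X")
      case True
      then obtain k where k: "x = X k" by blast
      show ?thesis
      proof (cases "k \<le> 2 * j")
        case True
        then have "(1 + x\<^sup>2) ^ j * \<epsilon> x \<le> ?B"
          unfolding k by (intro member_le_sum t0) auto
        then show ?thesis using \<epsilon>0[of x] by simp
      next
        case False
        have "((1 + x\<^sup>2) ^ j)\<^sup>2 = (1 + x\<^sup>2) ^ (2 * j)" by (simp add: power_mult[symmetric] mult.commute)
        also have "\<dots> \<le> (1 + x\<^sup>2) ^ k" using False by (intro weight_mono) simp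
        also have "\<dots> \<le> real k * (1 + x\<^sup>2) ^ k"
          using False mult_right_mono[of 1 "real k" "(1 + x\<^sup>2) ^ k"] weight_pos[of x k] by simp
        also have "\<dots> \<le> norm (w x)" using X[of k] k by simp
        finally have "(1 + x\<^sup>2) ^ j \<le> sqrt (norm (w x))" by (rule real_le_rsqrt)
        then have "(1 + x\<^sup>2) ^ j * norm (\<epsilon> x) \<le> 1"
          using True X_pos[of k] k by (simp add: \<epsilon>_def field_simps)
        then show ?thesis using B0 by simp
      qed
    qed (use B0 in \<open>simp add: \<epsilon>_def\<close>)
    then show "\<exists>C. \<forall>x. (1 + x\<^sup>2) ^ j * norm (\<epsilon> x) \<le> C" by blast
  qed
  then obtain v where v: "v \<in> schwartz" "\<And>x. \<bar>\<epsilon> x\<bar> \<le> norm (v x)"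
    using rapidly_decreasing_dominated by blast
  obtain B where B: "\<And>x. norm (v x) * norm (w x) \<le> B" using assms[OF v(1)] by blast
  have "sqrt (real k) \<le> B" for k
  proof -
    have "real k \<le> real k * (1 + (X k)\<^sup>2) ^ k"
      using mult_left_mono[OF one_le_weight[of "X k" k], of "real k"] by simp
    then have "sqrt (real k) \<le> sqrt (norm (w (X k)))" using X[of k] by simp
    also have "\<dots> = \<epsilon> (X k) * norm (w (X k))"
      using X_pos[of k] by (simp add: \<epsilon>_def real_div_sqrt)
    also have "\<dots> \<le> norm (v (X k)) * norm (w (X k))"
      using v(2)[of "X k"] \<epsilon>0[of "X k"] by (intro mult_right_mono) auto
    also have "\<dots> \<le> B" by (rule B)
    finally show ?thesis .
  qed
  then have "real k \<le> B\<^sup>2" for k by (metis of_nat_0_le_iff real_sqrt_le_iff real_sqrt_pow2 power_mono real_sqrt_ge_zero)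
  then show False by (meson reals_Archimedean2 not_le)
qed

section \<open>The topology of slowly increasing functions\<close>

lemma O_M_smooth: "f \<in> O_M \<Longrightarrow> smooth f"
  by (simp add: O_M_iff)

lemma O_M_add: "f \<in> O_M \<Longrightarrow> g \<in> O_M \<Longrightarrow> (\<lambda>x. f x + g x) \<in> O_M"
  unfolding O_M_iff by (simp add: smooth_add poly_bounded_add nth_deriv_add[THEN ext])

lemma O_M_cscaleR: "f \<in> O_M \<Longrightarrow> (\<lambda>x. c *\<^sub>R f x) \<in> O_M"
  unfolding O_M_iff by (simp add: smooth_cscaleR poly_bounded_cscaleR nth_deriv_cscaleR[THEN ext])

lemma O_M_diff: "f \<in> O_M \<Longrightarrow> g \<in> O_M \<Longrightarrow> (\<lambda>x. f x - g x) \<in> O_M"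
  using O_M_add[of f "\<lambda>x. (-1) *\<^sub>R g x"] O_M_cscaleR[of g "-1"] by simp

lemma O_M_compact_support:
  assumes "smooth f" "\<And>x. \<bar>x\<bar> > R \<Longrightarrow> f x = 0"
  shows "f \<in> O_M"
  unfolding O_M_iff
  using assms(1) compact_support_bounded[OF assms] bounded_imp_poly_bounded by metis

lemma O_M_linear:
  fixes a b :: "'a::real_normed_vector"
  shows "(\<lambda>x. x *\<^sub>R a + b) \<in> O_M"
  unfolding O_M_iff
proof (intro conjI allI smooth_linear)
  fix j
  show "poly_bounded (nth_deriv j (\<lambda>x. x *\<^sub>R a + b))"
  proof (cases j)
    case 0
    have "norm (x *\<^sub>R a + b) \<le> (norm a + norm b) * (1 + x\<^sup>2) ^ 1" for x
    proof -
      have "\<bar>x\<bar> \<le> 1 + x\<^sup>2" using zero_le_power2[of "\<bar>x\<bar> - 1"] by (simp add: power2_eq_square algebra_simps)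
      then have "\<bar>x\<bar> * norm a \<le> (1 + x\<^sup>2) * norm a" by (rule mult_right_mono) simp
      moreover have "1 * norm b \<le> (1 + x\<^sup>2) * norm b" by (rule mult_right_mono) auto
      moreover have "norm (x *\<^sub>R a + b) \<le> \<bar>x\<bar> * norm a + norm b"
        using norm_triangle_ineq[of "x *\<^sub>R a" b] by simp
      ultimately have "norm (x *\<^sub>R a + b) \<le> (1 + x\<^sup>2) * norm a + (1 + x\<^sup>2) * norm b" by linarith
      then show ?thesis by (simp add: algebra_simps)
    qed
    then show ?thesis unfolding 0 nth_deriv_0 poly_bounded_def by blast
  next
    case (Suc i)
    show ?thesis unfolding Suc nth_deriv_linear
      by (rule bounded_imp_poly_bounded[of _ "norm a"]) simp
  qed
qed

lemma O_M_const: "(\<lambda>x. c) \<in> O_M"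
  using O_M_linear[of 0 c] by simp

text \<open>C and l are fixed before k, as a transported weight has to be tested against all powers
  at once.\<close>

lemma weight_compose:
  fixes s :: "real \<Rightarrow> real"
  assumes "poly_bounded s"
  obtains C l where "C \<ge> 1" "\<And>x k. (1 + (s x)\<^sup>2) ^ k \<le> C ^ k * (1 + x\<^sup>2) ^ (l * k)"
proof -
  obtain k C where C: "C \<ge> 1" "\<And>x. \<bar>s x\<bar> \<le> C * (1 + x\<^sup>2) ^ k"
    using poly_boundedE[OF assms] real_norm_def by metis
  have "1 + (s x)\<^sup>2 \<le> (2 * C\<^sup>2) * (1 + x\<^sup>2) ^ (2 * k)" for x
  proof -
    have "(s x)\<^sup>2 \<le> (C * (1 + x\<^sup>2) ^ k)\<^sup>2"
      using power_mono[OF C(2)[of x] abs_ge_zero, of 2] by simp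
    moreover have "1 \<le> C * (1 + x\<^sup>2) ^ k"
      using mult_mono[OF C(1) one_le_weight[of x k]] C(1) by simp
    then have "1 \<le> (C * (1 + x\<^sup>2) ^ k)\<^sup>2" by (simp add: one_le_power)
    ultimately show ?thesis by (simp add: power_mult_distrib power_mult[symmetric] mult.commute)
  qed
  then have "(1 + (s x)\<^sup>2) ^ n \<le> ((2 * C\<^sup>2) * (1 + x\<^sup>2) ^ (2 * k)) ^ n" for x n
    by (intro power_mono) auto
  then have "(1 + (s x)\<^sup>2) ^ n \<le> (2 * C\<^sup>2) ^ n * (1 + x\<^sup>2) ^ (2 * k * n)" for x n
    by (simp add: power_mult_distrib power_mult)
  moreover have "2 * C\<^sup>2 \<ge> 1" using one_le_power[OF C(1), of 2] by linarith
  ultimately show ?thesis by (rule that[rotated])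
qed

text \<open>The bound M concerns the single point s x and may vary with x. This serves both the
  growth of f o s, with M a power of 1 + (s x)^2, and continuity, with M a seminorm divided by the
  weight at s x.\<close>

lemma compose_O_M_bound:
  assumes "s \<in> O_M"
  obtains D l where "D > 0" "\<And>(f :: real \<Rightarrow> 'a::real_normed_vector) j x M. smooth f \<Longrightarrow> j \<le> m \<Longrightarrow>
     (\<And>i. i \<le> j \<Longrightarrow> norm (nth_deriv i f (s x)) \<le> M) \<Longrightarrow>
     norm (nth_deriv j (\<lambda>x. f (s x)) x) \<le> D * (1 + x\<^sup>2) ^ l * M"
proof -
  obtain k C where C: "C \<ge> 1" "\<And>j x. j \<le> m \<Longrightarrow> norm (nth_deriv j s x) \<le> C * (1 + x\<^sup>2) ^ k"
    by (rule poly_boundedE_uniform[of m "\<lambda>j. nth_deriv j s"]) (use assms in \<open>auto simp: O_M_iff\<close>)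
  have s: "smooth s" using assms by (rule O_M_smooth)
  obtain B where B: "\<And>i. 0 \<le> B i"
     "\<And>i s (f::real \<Rightarrow> 'a) x G M. smooth s \<Longrightarrow> smooth f \<Longrightarrow> 0 \<le> G \<Longrightarrow>
       (\<forall>i\<in>{1..i}. \<bar>nth_deriv i s x\<bar> \<le> G ^ i) \<Longrightarrow> (\<forall>j\<le>i. norm (nth_deriv j f (s x)) \<le> M) \<Longrightarrow>
       norm (nth_deriv i (\<lambda>x. f (s x)) x) \<le> B i * M * G ^ i"
    using nth_deriv_compose_bound[where 'a = 'a] by metis
  show ?thesis
  proof (rule that[of "(1 + (\<Sum>i\<le>m. B i)) * C ^ m" "k * m"])
    show "0 < (1 + (\<Sum>i\<le>m. B i)) * C ^ m"
      using C(1) B(1) by (intro mult_pos_pos add_pos_nonneg sum_nonneg) auto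
    fix f :: "real \<Rightarrow> 'a" and j x M
    assume f: "smooth f" "j \<le> m" "\<And>i. i \<le> j \<Longrightarrow> norm (nth_deriv i f (s x)) \<le> M"
    have M0: "0 \<le> M" using f(3)[of 0] norm_ge_zero order_trans by blast
    \<comment> \<open>All derivatives of s up to order m are at most G, and G >= 1 gives G <=
      \<open>G ^ i\<close>, the form that the chain rule bound expects.\<close>
    define G where "G = C * (1 + x\<^sup>2) ^ k"
    have G1: "1 \<le> G"
      using mult_mono[OF C(1) one_le_weight[of x k]] C(1) by (simp add: G_def)
    have "norm (nth_deriv j (\<lambda>x. f (s x)) x) \<le> B j * M * G ^ j"
    proof (rule B(2)[OF s f(1)])
      show "\<forall>i\<in>{1..j}. \<bar>nth_deriv i s x\<bar> \<le> G ^ i"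
      proof
        fix i assume i: "i \<in> {1..j}"
        then have "\<bar>nth_deriv i s x\<bar> \<le> G" using C(2)[of i x] f(2) by (simp add: G_def)
        also have "G \<le> G ^ i" using i G1 by (intro self_le_power) auto
        finally show "\<bar>nth_deriv i s x\<bar> \<le> G ^ i" .
      qed
    qed (use G1 f in auto)
    also have "\<dots> \<le> (1 + (\<Sum>i\<le>m. B i)) * M * G ^ m"
    proof (intro mult_mono mult_right_mono)
      have "B j \<le> (\<Sum>i\<le>m. B i)" by (rule member_le_sum) (use B f in auto)
      then show "B j \<le> 1 + (\<Sum>i\<le>m. B i)" by simp
      show "G ^ j \<le> G ^ m" using G1 f(2) by (rule power_increasing[rotated])
      show "0 \<le> 1 + (\<Sum>i\<le>m. B i)" using B(1) by (intro add_nonneg_nonneg sum_nonneg) auto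
      then show "0 \<le> (1 + (\<Sum>i\<le>m. B i)) * M" using M0 by (rule mult_nonneg_nonneg)
    qed (use M0 G1 in auto)
    also have "\<dots> = (1 + (\<Sum>i\<le>m. B i)) * C ^ m * (1 + x\<^sup>2) ^ (k * m) * M"
      by (simp add: G_def power_mult_distrib power_mult)
    finally show "norm (nth_deriv j (\<lambda>x. f (s x)) x) \<le> (1 + (\<Sum>i\<le>m. B i)) * C ^ m * (1 + x\<^sup>2) ^ (k * m) * M" .
  qed
qed

lemma O_M_compose:
  fixes f :: "real \<Rightarrow> 'a::real_normed_vector"
  assumes s: "s \<in> O_M" and f: "f \<in> O_M"
  shows "(\<lambda>x. f (s x)) \<in> O_M"
  unfolding O_M_iff
proof (intro conjI allI)
  show "smooth (\<lambda>x. f (s x))" by (rule smooth_compose[OF O_M_smooth[OF s] O_M_smooth[OF f]])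
  fix m
  obtain D l where D: "D > 0" "\<And>(f :: real \<Rightarrow> 'a) j x M. smooth f \<Longrightarrow> j \<le> m \<Longrightarrow>
     (\<And>i. i \<le> j \<Longrightarrow> norm (nth_deriv i f (s x)) \<le> M) \<Longrightarrow>
     norm (nth_deriv j (\<lambda>x. f (s x)) x) \<le> D * (1 + x\<^sup>2) ^ l * M"
    using compose_O_M_bound[OF s, where 'a = 'a] by metis
  obtain k C where C: "C \<ge> 1" "\<And>j x. j \<le> m \<Longrightarrow> norm (nth_deriv j f x) \<le> C * (1 + x\<^sup>2) ^ k"
    by (rule poly_boundedE_uniform[of m "\<lambda>j. nth_deriv j f"]) (use f in \<open>auto simp: O_M_iff\<close>)
  have "poly_bounded s" using s[unfolded O_M_iff] nth_deriv_0[of s] by metis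
  then obtain B p where B: "B \<ge> 1" "\<And>x k. (1 + (s x)\<^sup>2) ^ k \<le> B ^ k * (1 + x\<^sup>2) ^ (p * k)"
    using weight_compose by metis
  have "norm (nth_deriv m (\<lambda>x. f (s x)) x) \<le> (D * C * B ^ k) * (1 + x\<^sup>2) ^ (l + p * k)" for x
  proof -
    have "norm (nth_deriv m (\<lambda>x. f (s x)) x) \<le> D * (1 + x\<^sup>2) ^ l * (C * (1 + (s x)\<^sup>2) ^ k)"
      by (rule D(2)[OF O_M_smooth[OF f] order_refl]) (use C in auto)
    also have "\<dots> \<le> D * (1 + x\<^sup>2) ^ l * (C * (B ^ k * (1 + x\<^sup>2) ^ (p * k)))"
      using C(1) D(1) weight_pos[of x l] by (intro mult_left_mono B) auto
    also have "\<dots> = (D * C * B ^ k) * (1 + x\<^sup>2) ^ (l + p * k)"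
      by (simp add: power_add)
    finally show ?thesis .
  qed
  then show "poly_bounded (nth_deriv m (\<lambda>x. f (s x)))" unfolding poly_bounded_def by blast
qed

section \<open>Schwartz functions as weights\<close>

lemma schwartz_zero: "(\<lambda>x. 0) \<in> schwartz"
  unfolding schwartz_iff
  by (auto simp: nth_deriv_const rapidly_decreasing_def intro: exI[of _ 0])

lemma schwartz_rapidly_decreasing: "v \<in> schwartz \<Longrightarrow> rapidly_decreasing v"
  unfolding schwartz_iff using nth_deriv_0 by metis

lemma schwartz_weight_bound:
  assumes "v \<in> schwartz"
  obtains C where "C > 0" "\<And>x. (1 + x\<^sup>2) ^ k * norm (v x) \<le> C"
proof -
  obtain C where C: "\<And>x. (1 + x\<^sup>2) ^ k * norm (v x) \<le> C"
    using schwartz_rapidly_decreasing[OF assms] unfolding rapidly_decreasing_def by metis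
  have "(1 + x\<^sup>2) ^ k * norm (v x) \<le> max 1 C" for x using C[of x] by simp
  then show ?thesis by (intro that[of "max 1 C"]) auto
qed

lemma rapidly_decreasing_compact_support:
  fixes \<epsilon> :: "real \<Rightarrow> real"
  assumes "\<And>x. \<bar>\<epsilon> x\<bar> \<le> B" "\<And>x. \<bar>x\<bar> > R \<Longrightarrow> \<epsilon> x = 0"
  shows "rapidly_decreasing \<epsilon>"
  unfolding rapidly_decreasing_def
proof
  fix k
  have B0: "0 \<le> B" using assms(1)[of 0] by simp
  have "(1 + x\<^sup>2) ^ k * norm (\<epsilon> x) \<le> (1 + R\<^sup>2) ^ k * B" for x
  proof (cases "\<bar>x\<bar> > R")
    case False
    then have "x\<^sup>2 \<le> R\<^sup>2" using abs_le_square_iff[of x R] by simp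
    then show ?thesis using assms(1) by (intro mult_mono power_mono) auto
  qed (use assms(2) B0 weight_pos[of R k] in auto)
  then show "\<exists>C. \<forall>x. (1 + x\<^sup>2) ^ k * norm (\<epsilon> x) \<le> C" by blast
qed

text \<open>Obtained by dominating an indicator function. With such a weight, smallness in a
  seminorm means uniform smallness of derivatives on a compact interval.\<close>

lemma schwartz_ge_one_on_interval:
  obtains v where "v \<in> schwartz" "\<And>x. \<bar>x\<bar> \<le> R \<Longrightarrow> 1 \<le> norm (v x)"
proof -
  have "rapidly_decreasing (\<lambda>x. if \<bar>x\<bar> \<le> R then 1 else 0 :: real)"
    by (rule rapidly_decreasing_compact_support[of _ 1 R]) auto
  then obtain v where "v \<in> schwartz" "\<And>x. \<bar>if \<bar>x\<bar> \<le> R then 1 else 0 :: real\<bar> \<le> norm (v x)"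
    using rapidly_decreasing_dominated by blast
  then show ?thesis by (intro that[of v]) (metis abs_one)+
qed

text \<open>Makes the family of seminorms directed, so that two weights can be replaced by
  one.\<close>

lemma schwartz_dominates_two:
  assumes "v \<in> schwartz" "w \<in> schwartz"
  obtains u where "u \<in> schwartz" "\<And>x. norm (v x) \<le> norm (u x)" "\<And>x. norm (w x) \<le> norm (u x)"
proof -
  have "rapidly_decreasing (\<lambda>x. norm (v x) + norm (w x))"
    unfolding rapidly_decreasing_def
  proof
    fix k
    obtain C where C: "\<And>x. (1 + x\<^sup>2) ^ k * norm (v x) \<le> C" using schwartz_weight_bound[OF assms(1)] by metis
    obtain D where D: "\<And>x. (1 + x\<^sup>2) ^ k * norm (w x) \<le> D" using schwartz_weight_bound[OF assms(2)] by metis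
    show "\<exists>C. \<forall>x. (1 + x\<^sup>2) ^ k * norm (norm (v x) + norm (w x)) \<le> C"
      by (intro exI[of _ "C + D"] allI) (use add_mono[OF C D] in \<open>simp add: distrib_left\<close>)
  qed
  then obtain u where u: "u \<in> schwartz" "\<And>x. \<bar>norm (v x) + norm (w x)\<bar> \<le> norm (u x)"
    using rapidly_decreasing_dominated by blast
  show ?thesis
  proof (rule that[OF u(1)])
    fix x
    show "norm (v x) \<le> norm (u x)" "norm (w x) \<le> norm (u x)"
      using u(2)[of x] norm_ge_zero[of "v x"] norm_ge_zero[of "w x"] by linarith+
  qed
qed

text \<open>A real \<open>SUP\<close> is an upper bound only of a set bounded above; here the
  polynomial growth of the derivatives of f against the rapid decrease of v provides that
  bound.\<close>

lemma O_M_seminorm_upper: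
  assumes "v \<in> schwartz" "f \<in> O_M" "j \<le> m"
  shows "norm (v x * nth_deriv j f x) \<le> O_M_seminorm m v f"
proof -
  obtain k C where C: "C \<ge> 1" "\<And>j x. j \<le> m \<Longrightarrow> norm (nth_deriv j f x) \<le> C * (1 + x\<^sup>2) ^ k"
    by (rule poly_boundedE_uniform[of m "\<lambda>j. nth_deriv j f"]) (use assms in \<open>auto simp: O_M_iff\<close>)
  obtain D where D: "\<And>x. (1 + x\<^sup>2) ^ k * norm (v x) \<le> D" using schwartz_weight_bound[OF assms(1)] by metis
  have bound: "norm (v x * nth_deriv j f x) \<le> C * D" if "j \<le> m" for j x
  proof -
    have "norm (v x) * norm (nth_deriv j f x) \<le> norm (v x) * (C * (1 + x\<^sup>2) ^ k)"
      using C(2)[OF that] by (rule mult_left_mono) simp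
    also have "\<dots> = C * ((1 + x\<^sup>2) ^ k * norm (v x))" by simp
    also have "\<dots> \<le> C * D" using C(1) D by (intro mult_left_mono) auto
    finally show ?thesis by (simp add: norm_mult)
  qed
  have "norm (v x * nth_deriv j f x) \<le> Max ((\<lambda>j. norm (v x * nth_deriv j f x)) ` {..m})"
    by (rule Max_ge) (use assms in auto)
  also have "\<dots> \<le> O_M_seminorm m v f"
    unfolding O_M_seminorm_def
    by (rule cSUP_upper) (use bound in \<open>auto intro!: bdd_aboveI[of _ "C * D"]\<close>)
  finally show ?thesis .
qed

lemma O_M_seminorm_least:
  assumes "\<And>x j. j \<le> m \<Longrightarrow> norm (v x * nth_deriv j f x) \<le> e"
  shows "O_M_seminorm m v f \<le> e"
  unfolding O_M_seminorm_def by (rule cSUP_least) (use assms in auto)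

lemma O_M_seminorm_nonneg:
  assumes "v \<in> schwartz" "f \<in> O_M"
  shows "0 \<le> O_M_seminorm m v f"
  using O_M_seminorm_upper[OF assms, of 0 m 0] norm_ge_zero order_trans by blast

lemma O_M_seminorm_add:
  assumes "v \<in> schwartz" "f \<in> O_M" "g \<in> O_M"
  shows "O_M_seminorm m v (\<lambda>x. f x + g x) \<le> O_M_seminorm m v f + O_M_seminorm m v g"
proof (rule O_M_seminorm_least)
  fix x j assume j: "j \<le> m"
  have "norm (v x * nth_deriv j (\<lambda>x. f x + g x) x)
     \<le> norm (v x * nth_deriv j f x) + norm (v x * nth_deriv j g x)"
    using assms by (simp add: nth_deriv_add O_M_smooth distrib_left norm_triangle_ineq)
  then show "norm (v x * nth_deriv j (\<lambda>x. f x + g x) x) \<le> O_M_seminorm m v f + O_M_seminorm m v g"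
    using O_M_seminorm_upper[OF assms(1,2) j, of x] O_M_seminorm_upper[OF assms(1,3) j, of x] by linarith
qed

lemma O_M_seminorm_triangle:
  assumes "v \<in> schwartz" "f \<in> O_M" "g \<in> O_M" "h \<in> O_M"
  shows "O_M_seminorm m v (\<lambda>x. f x - h x) \<le> O_M_seminorm m v (\<lambda>x. f x - g x) + O_M_seminorm m v (\<lambda>x. g x - h x)"
  using O_M_seminorm_add[OF assms(1) O_M_diff[OF assms(2,3)] O_M_diff[OF assms(3,4)]] by simp

lemma O_M_seminorm_mono:
  assumes "w \<in> schwartz" "f \<in> O_M" "m \<le> m'" "\<And>x. norm (v x) \<le> norm (w x)"
  shows "O_M_seminorm m v f \<le> O_M_seminorm m' w f"
proof (rule O_M_seminorm_least)
  fix x j assume j: "j \<le> m"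
  have "norm (v x * nth_deriv j f x) \<le> norm (w x * nth_deriv j f x)"
    unfolding norm_mult using assms(4) by (rule mult_right_mono) simp
  also have "\<dots> \<le> O_M_seminorm m' w f" using assms j by (intro O_M_seminorm_upper) auto
  finally show "norm (v x * nth_deriv j f x) \<le> O_M_seminorm m' w f" .
qed

lemma O_M_seminorm_self: "O_M_seminorm m v (\<lambda>x. f x - f x) = 0"
  by (simp add: O_M_seminorm_def nth_deriv_const)

section \<open>Neighbourhoods in the topology\<close>

definition O_M_ball :: "nat \<Rightarrow> (real \<Rightarrow> complex) \<Rightarrow> (real \<Rightarrow> complex) \<Rightarrow> real \<Rightarrow> (real \<Rightarrow> complex) set" where
  "O_M_ball m v f e = {g \<in> O_M. O_M_seminorm m v (\<lambda>x. g x - f x) < e}"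

lemma O_M_topology_eq:
  "O_M_topology = topology_generated_by {O_M_ball m v f e | m v f e. v \<in> schwartz \<and> f \<in> O_M \<and> e > 0}"
  by (simp add: O_M_topology_def O_M_ball_def)

lemma O_M_ball_center: "f \<in> O_M \<Longrightarrow> e > 0 \<Longrightarrow> f \<in> O_M_ball m v f e"
  using O_M_seminorm_self[of m v f] by (simp add: O_M_ball_def del: diff_self)

lemma openin_O_M_ball:
  "v \<in> schwartz \<Longrightarrow> f \<in> O_M \<Longrightarrow> e > 0 \<Longrightarrow> openin O_M_topology (O_M_ball m v f e)"
  unfolding O_M_topology_eq by (rule topology_generated_by_Basis) blast

lemma topspace_O_M_topology: "topspace O_M_topology = O_M"
  unfolding O_M_topology_eq topology_generated_by_topspace
proof
  show "\<Union> {O_M_ball m v f e |m v f e. v \<in> schwartz \<and> f \<in> O_M \<and> e > 0} \<subseteq> O_M"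
    by (auto simp: O_M_ball_def)
  show "O_M \<subseteq> \<Union> {O_M_ball m v f e |m v f e. v \<in> schwartz \<and> f \<in> O_M \<and> e > 0}"
  proof
    fix f :: "real \<Rightarrow> complex" assume "f \<in> O_M"
    then show "f \<in> \<Union> {O_M_ball m v f e |m v f e. v \<in> schwartz \<and> f \<in> O_M \<and> e > 0}"
      by (intro UnionI[of "O_M_ball 0 (\<lambda>x. 0) f 1"] CollectI exI[of _ "0::nat"] exI[of _ "\<lambda>x. 0"]
           exI[of _ f] exI[of _ "1::real"] conjI refl schwartz_zero zero_less_one O_M_ball_center)
  qed
qed

text \<open>The topology is generated by balls with arbitrary centres as a subbase. The triangle
  inequality recentres a ball at f, and directedness of the weights handles finite
  intersections.\<close>

lemma openin_O_M_topology_ball: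
  assumes "openin O_M_topology U" "f \<in> U"
  shows "\<exists>m v e. v \<in> schwartz \<and> e > 0 \<and> O_M_ball m v f e \<subseteq> U"
proof -
  have "f \<in> O_M" using openin_subset[OF assms(1)] assms(2) topspace_O_M_topology by blast
  have "generate_topology_on {O_M_ball m v f e | m v f e. v \<in> schwartz \<and> f \<in> O_M \<and> e > 0} U"
    using assms(1) unfolding O_M_topology_eq by (rule openin_topology_generated_by)
  then show ?thesis using assms(2)
  proof (induction U)
    case (Int a b)
    obtain m v e where 1: "v \<in> schwartz" "e > 0" "O_M_ball m v f e \<subseteq> a" using Int by blast
    obtain m' v' e' where 2: "v' \<in> schwartz" "e' > 0" "O_M_ball m' v' f e' \<subseteq> b" using Int by blast
    obtain u where u: "u \<in> schwartz" "\<And>x. norm (v x) \<le> norm (u x)" "\<And>x. norm (v' x) \<le> norm (u x)"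
      using schwartz_dominates_two[OF 1(1) 2(1)] by metis
    have "O_M_ball (max m m') u f (min e e') \<subseteq> O_M_ball m v f e \<inter> O_M_ball m' v' f e'"
    proof
      fix g assume g: "g \<in> O_M_ball (max m m') u f (min e e')"
      then have "(\<lambda>x. g x - f x) \<in> O_M" using \<open>f \<in> O_M\<close> by (auto simp: O_M_ball_def intro: O_M_diff)
      from O_M_seminorm_mono[OF u(1) this, of m "max m m'" v] O_M_seminorm_mono[OF u(1) this, of m' "max m m'" v'] u g
      show "g \<in> O_M_ball m v f e \<inter> O_M_ball m' v' f e'" by (auto simp: O_M_ball_def)
    qed
    then show ?case using 1 2 u(1)
      by (intro exI[of _ "max m m'"] exI[of _ u] exI[of _ "min e e'"]) auto
  next
    case (Basis s)
    then obtain m v f0 e where s: "s = O_M_ball m v f0 e" "v \<in> schwartz" "f0 \<in> O_M" "e > 0" by blast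
    have f: "f \<in> O_M" "O_M_seminorm m v (\<lambda>x. f x - f0 x) < e"
      using Basis s by (auto simp: O_M_ball_def)
    have "O_M_ball m v f (e - O_M_seminorm m v (\<lambda>x. f x - f0 x)) \<subseteq> s"
    proof
      fix g assume g: "g \<in> O_M_ball m v f (e - O_M_seminorm m v (\<lambda>x. f x - f0 x))"
      then have "g \<in> O_M" by (simp add: O_M_ball_def)
      from O_M_seminorm_triangle[OF s(2) this f(1) s(3), of m] g
      show "g \<in> s" by (auto simp: O_M_ball_def s(1))
    qed
    then show ?case using s f by (intro exI[of _ m] exI[of _ v]
        exI[of _ "e - O_M_seminorm m v (\<lambda>x. f x - f0 x)"]) auto
  qed blast+
qed

lemma openin_O_M_topologyI:
  assumes "U \<subseteq> O_M" "\<And>f. f \<in> U \<Longrightarrow> \<exists>m v e. v \<in> schwartz \<and> e > 0 \<and> O_M_ball m v f e \<subseteq> U"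
  shows "openin O_M_topology U"
proof (subst openin_subopen, intro ballI)
  fix f assume f: "f \<in> U"
  then obtain m v e where e: "v \<in> schwartz" "e > 0" "O_M_ball m v f e \<subseteq> U" using assms(2) by metis
  have "f \<in> O_M" using f assms(1) by blast
  then show "\<exists>T. openin O_M_topology T \<and> f \<in> T \<and> T \<subseteq> U"
    by (intro exI[of _ "O_M_ball m v f e"] conjI openin_O_M_ball O_M_ball_center e)
qed

text \<open>The weight is pushed forward along psi, together with the polynomial lost in the chain
  rule. It stays rapidly decreasing in y = psi x because 1 + y^2 is bounded by a polynomial in x;
  surjectivity lets every y be reached.\<close>

lemma composition_seminorm_bound:
  fixes \<psi> :: "real \<Rightarrow> real"
  assumes \<psi>: "\<psi> \<in> O_M" "bij \<psi>" and v: "v \<in> schwartz"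
  obtains w D where "w \<in> schwartz" "D > 0"
    "\<And>f. f \<in> O_M \<Longrightarrow> O_M_seminorm m v (\<lambda>x. f (\<psi> x)) \<le> D * O_M_seminorm m w f"
proof -
  obtain D l where D: "D > 0" "\<And>(f :: real \<Rightarrow> complex) j x M. smooth f \<Longrightarrow> j \<le> m \<Longrightarrow>
     (\<And>i. i \<le> j \<Longrightarrow> norm (nth_deriv i f (\<psi> x)) \<le> M) \<Longrightarrow>
     norm (nth_deriv j (\<lambda>x. f (\<psi> x)) x) \<le> D * (1 + x\<^sup>2) ^ l * M"
    using compose_O_M_bound[OF \<psi>(1), where 'a = complex] by metis
  have "poly_bounded \<psi>" using \<psi>(1)[unfolded O_M_iff] nth_deriv_0[of \<psi>] by metis
  then obtain B p where B: "B \<ge> 1" "\<And>x k. (1 + (\<psi> x)\<^sup>2) ^ k \<le> B ^ k * (1 + x\<^sup>2) ^ (p * k)"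
    using weight_compose by metis
  define \<epsilon> where "\<epsilon> y = norm (v (inv \<psi> y)) * (1 + (inv \<psi> y)\<^sup>2) ^ l" for y
  have \<epsilon>_\<psi>: "\<epsilon> (\<psi> x) = norm (v x) * (1 + x\<^sup>2) ^ l" for x
    using \<psi>(2) by (simp add: \<epsilon>_def bij_is_inj)
  have "rapidly_decreasing \<epsilon>"
    unfolding rapidly_decreasing_def
  proof
    fix k
    obtain C where C: "\<And>x. (1 + x\<^sup>2) ^ (p * k + l) * norm (v x) \<le> C"
      using schwartz_weight_bound[OF v] by metis
    have "(1 + y\<^sup>2) ^ k * norm (\<epsilon> y) \<le> B ^ k * C" for y
    proof -
      obtain x where y: "y = \<psi> x" using \<psi>(2) by (metis bij_pointE)
      have "norm (\<epsilon> y) = norm (v x) * (1 + x\<^sup>2) ^ l"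
        using weight_pos[of x l] by (simp add: y \<epsilon>_\<psi>)
      then have "(1 + y\<^sup>2) ^ k * norm (\<epsilon> y) \<le> (B ^ k * (1 + x\<^sup>2) ^ (p * k)) * (norm (v x) * (1 + x\<^sup>2) ^ l)"
        using B(2)[of x k] weight_pos[of x l] by (simp add: y mult_right_mono)
      also have "\<dots> = B ^ k * ((1 + x\<^sup>2) ^ (p * k + l) * norm (v x))" by (simp add: power_add)
      also have "\<dots> \<le> B ^ k * C" using B(1) by (intro mult_left_mono C) auto
      finally show ?thesis .
    qed
    then show "\<exists>C. \<forall>x. (1 + x\<^sup>2) ^ k * norm (\<epsilon> x) \<le> C" by blast
  qed
  then obtain w where w: "w \<in> schwartz" "\<And>x. \<bar>\<epsilon> x\<bar> \<le> norm (w x)"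
    using rapidly_decreasing_dominated by blast
  show ?thesis
  proof (rule that[OF w(1) D(1)])
    fix f :: "real \<Rightarrow> complex" assume f: "f \<in> O_M"
    let ?p = "O_M_seminorm m w f"
    show "O_M_seminorm m v (\<lambda>x. f (\<psi> x)) \<le> D * ?p"
    proof (rule O_M_seminorm_least)
      fix x j assume j: "j \<le> m"
      show "norm (v x * nth_deriv j (\<lambda>x. f (\<psi> x)) x) \<le> D * ?p"
      \<comment> \<open>Only where v x is nonzero is the transported weight known to be positive, as
        the division below requires.\<close>
      proof (cases "v x = 0")
        case True
        then show ?thesis using D(1) O_M_seminorm_nonneg[OF w(1) f, of m] by simp
      next
        case False
        then have "0 < norm (v x) * (1 + x\<^sup>2) ^ l" using weight_pos[of x l] by simp
        also have le: "norm (v x) * (1 + x\<^sup>2) ^ l \<le> norm (w (\<psi> x))"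
          using w(2)[of "\<psi> x"] weight_pos[of x l] by (simp add: \<epsilon>_\<psi>)
        finally have w_pos: "0 < norm (w (\<psi> x))" .
        have "norm (nth_deriv i f (\<psi> x)) \<le> ?p / norm (w (\<psi> x))" if "i \<le> j" for i
          using O_M_seminorm_upper[OF w(1) f, of i m "\<psi> x"] that j w_pos
          by (simp add: norm_mult field_simps)
        then have "norm (nth_deriv j (\<lambda>x. f (\<psi> x)) x) \<le> D * (1 + x\<^sup>2) ^ l * (?p / norm (w (\<psi> x)))"
          by (intro D(2) O_M_smooth[OF f] j) auto
        then have "norm (v x) * norm (nth_deriv j (\<lambda>x. f (\<psi> x)) x)
            \<le> norm (v x) * (D * (1 + x\<^sup>2) ^ l * (?p / norm (w (\<psi> x))))"
          by (rule mult_left_mono) simp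
        also have "\<dots> = D * ?p * (norm (v x) * (1 + x\<^sup>2) ^ l / norm (w (\<psi> x)))"
          by simp
        also have "\<dots> \<le> D * ?p * 1"
          using le w_pos D(1) O_M_seminorm_nonneg[OF w(1) f, of m] by (intro mult_left_mono) auto
        finally show ?thesis by (simp add: norm_mult)
      qed
    qed
  qed
qed

lemma composition_continuous_linear:
  fixes \<psi> :: "real \<Rightarrow> real"
  assumes \<psi>: "\<psi> \<in> O_M" "bij \<psi>"
  shows "continuous_linear_operator O_M_topology (composition_operator \<psi>)"
proof -
  let ?S = "{O_M_ball m v f e | m v f e. v \<in> schwartz \<and> f \<in> O_M \<and> e > 0}"
  have op: "composition_operator \<psi> f = (\<lambda>x. f (\<psi> x))" for f :: "real \<Rightarrow> complex"
    by (simp add: composition_operator_def o_def)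
  have in_O_M: "composition_operator \<psi> f \<in> O_M" if "f \<in> O_M" for f :: "real \<Rightarrow> complex"
    unfolding op by (rule O_M_compose[OF \<psi>(1) that])
  have "openin O_M_topology (composition_operator \<psi> -` U \<inter> O_M)" if "U \<in> ?S" for U
  proof (rule openin_O_M_topologyI)
    fix f assume f: "f \<in> composition_operator \<psi> -` U \<inter> O_M"
    have "openin O_M_topology U" using that openin_O_M_ball by blast
    from openin_O_M_topology_ball[OF this, of "composition_operator \<psi> f"] f
    obtain m v e where e: "v \<in> schwartz" "e > 0" "O_M_ball m v (composition_operator \<psi> f) e \<subseteq> U" by blast
    obtain w D where D: "w \<in> schwartz" "D > 0"
      "\<And>f. f \<in> O_M \<Longrightarrow> O_M_seminorm m v (\<lambda>x. f (\<psi> x)) \<le> D * O_M_seminorm m w f"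
      using composition_seminorm_bound[OF \<psi> e(1)] by metis
    have "O_M_ball m w f (e / D) \<subseteq> composition_operator \<psi> -` U \<inter> O_M"
    proof
      fix g assume g: "g \<in> O_M_ball m w f (e / D)"
      then have g': "g \<in> O_M" "(\<lambda>x. g x - f x) \<in> O_M" using f by (auto simp: O_M_ball_def intro: O_M_diff)
      have "O_M_seminorm m v (\<lambda>x. g (\<psi> x) - f (\<psi> x)) \<le> D * O_M_seminorm m w (\<lambda>x. g x - f x)"
        by (rule D(3)[OF g'(2)])
      also have "\<dots> < e" using g D(2) by (simp add: O_M_ball_def field_simps)
      finally have "composition_operator \<psi> g \<in> O_M_ball m v (composition_operator \<psi> f) e"
        using in_O_M[OF g'(1)] by (simp add: O_M_ball_def op)
      then show "g \<in> composition_operator \<psi> -` U \<inter> O_M" using e(3) g'(1) by auto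
    qed
    then show "\<exists>m v e. v \<in> schwartz \<and> e > 0 \<and> O_M_ball m v f e \<subseteq> composition_operator \<psi> -` U \<inter> O_M"
      using D e(2) by (intro exI[of _ m] exI[of _ w] exI[of _ "e / D"]) auto
  qed auto
  moreover have "\<Union> ?S = O_M"
    using topspace_O_M_topology unfolding O_M_topology_eq topology_generated_by_topspace .
  ultimately have "continuous_map O_M_topology (topology_generated_by ?S) (composition_operator \<psi>)"
    unfolding continuous_on_generated_topo_iff topspace_O_M_topology using in_O_M by auto
  then show ?thesis
    unfolding continuous_linear_operator_def O_M_topology_eq[symmetric] by (auto simp: op)
qed

section \<open>From Abel's equation to mixing\<close>

lemma nth_deriv_add_const:
  assumes "smooth f"
  shows "nth_deriv (Suc j) (\<lambda>x. f x + c) = nth_deriv (Suc j) f"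
proof -
  have "((\<lambda>x. f x + c) has_vector_derivative nth_deriv 1 f x + 0) (at x)" for x
    by (intro has_vector_derivative_add smooth_deriv1 assms has_vector_derivative_const)
  then have "nth_deriv (Suc j) (\<lambda>x. f x + c) = nth_deriv j (nth_deriv 1 f)"
    by (intro nth_deriv_eqI) simp
  then show ?thesis by (simp add: nth_deriv_add_index[symmetric])
qed

text \<open>Connects \<open>deriv\<close>, in which Abel's equation is stated, with the iterated
  vector derivatives that the proof works with.\<close>

lemma smooth_deriv_eq: "smooth f \<Longrightarrow> deriv f x = nth_deriv 1 f x"
  by (rule DERIV_imp_deriv)
     (use smooth_deriv1[of f x] in \<open>simp add: has_real_derivative_iff_has_vector_derivative\<close>)

lemma composition_operator_funpow:
  "(composition_operator \<psi> ^^ n) f = (\<lambda>x. f ((\<psi> ^^ n) x))"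
proof (induction n)
  case (Suc n)
  then show ?case by (simp add: composition_operator_def o_def funpow_swap1)
qed simp

lemma bounded_away_from_0:
  fixes g :: "real \<Rightarrow> real"
  assumes "continuous_on {a..b} g" "\<And>x. x \<in> {a..b} \<Longrightarrow> g x \<noteq> 0"
  obtains c where "c > 0" "\<And>x. x \<in> {a..b} \<Longrightarrow> c \<le> \<bar>g x\<bar>"
proof -
  have "continuous_on {a..b} (\<lambda>x. inverse (g x))" using assms by (intro continuous_on_inverse) auto
  then obtain C where C: "C > 0" "\<And>x. x \<in> {a..b} \<Longrightarrow> norm (inverse (g x)) \<le> C"
    using continuous_real_bounded_on_interval by metis
  show ?thesis
  proof (rule that[of "inverse C"])
    fix x assume x: "x \<in> {a..b}"
    then have "inverse \<bar>g x\<bar> \<le> C" "0 < \<bar>g x\<bar>" using C(2)[OF x] assms(2)[OF x] by auto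
    then show "inverse C \<le> \<bar>g x\<bar>" using C(1) by (simp add: field_simps)
  qed (use C in simp)
qed

text \<open>The cutoff is the plateau stretched by R. Its error vanishes for |x| < R, the
  derivatives of the stretched plateau are bounded uniformly in R >= 1, and one spare factor 1 + x^2
  of the weight gives a gain 1/R outside.\<close>

lemma cutoff_dense:
  fixes f :: "real \<Rightarrow> complex"
  assumes f: "f \<in> O_M" and v: "v \<in> schwartz" and e: "e > 0"
  obtains g R where "smooth g" "\<And>x. \<bar>x\<bar> > R \<Longrightarrow> g x = 0" "O_M_seminorm m v (\<lambda>x. g x - f x) < e"
proof -
  obtain k C where C: "C \<ge> 1" "\<And>j x. j \<le> m \<Longrightarrow> norm (nth_deriv j f x) \<le> C * (1 + x\<^sup>2) ^ k"
    by (rule poly_boundedE_uniform[of m "\<lambda>j. nth_deriv j f"]) (use f in \<open>auto simp: O_M_iff\<close>)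
  \<comment> \<open>\<open>Suc k\<close> instead of k: the additional factor 1 + x^2 is the source
    of the decay in R.\<close>
  obtain D where D: "D > 0" "\<And>x. (1 + x\<^sup>2) ^ Suc k * norm (v x) \<le> D"
    using schwartz_weight_bound[OF v] by metis
  have f_smooth: "smooth f" using f by (rule O_M_smooth)
  define q where "q x = plateau x - 1" for x
  have q: "smooth q" unfolding q_def[abs_def] by (intro smooth_diff smooth_plateau smooth_const)
  have "\<exists>P. \<forall>x. norm (nth_deriv j q x) \<le> P" for j
  proof -
    obtain P where "\<And>x. \<bar>nth_deriv j plateau x\<bar> \<le> P" using plateau_deriv_bounded by metis
    then have "norm (nth_deriv j q x) \<le> P + 1" for x
      unfolding q_def[abs_def] nth_deriv_diff[OF smooth_plateau smooth_const] nth_deriv_const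
      by (smt (verit, best) real_norm_def)
    then show ?thesis by blast
  qed
  then obtain P where P: "\<And>j x. norm (nth_deriv j q x) \<le> P j" by metis
  have P0: "0 \<le> P j" for j using P[of j 0] norm_ge_zero order_trans by blast
  obtain B where B: "\<And>i. 0 \<le> B i"
     "\<And>i s (f::real \<Rightarrow> real) x G M. smooth s \<Longrightarrow> smooth f \<Longrightarrow> 0 \<le> G \<Longrightarrow>
       (\<forall>i\<in>{1..i}. \<bar>nth_deriv i s x\<bar> \<le> G ^ i) \<Longrightarrow> (\<forall>j\<le>i. norm (nth_deriv j f (s x)) \<le> M) \<Longrightarrow>
       norm (nth_deriv i (\<lambda>x. f (s x)) x) \<le> B i * M * G ^ i"
    using nth_deriv_compose_bound[where 'a = real] by metis
  define Q where "Q = (\<Sum>j\<le>m. B j) * (\<Sum>j\<le>m. P j)"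
  have Q0: "0 \<le> Q" unfolding Q_def using B(1) P0 by (intro mult_nonneg_nonneg sum_nonneg) auto
  \<comment> \<open>The error for |x| >= R is at most W/R; the factor \<open>2 ^ m\<close> is the
    sum of the binomial coefficients in the Leibniz rule.\<close>
  define W where "W = 2 ^ m * (Q * C * D)"
  have W0: "0 \<le> W" using Q0 C D by (simp add: W_def)
  define R where "R = max 1 (2 * W / e)"
  have R: "R \<ge> 1" "W / R \<le> e / 2" using W0 e by (auto simp: R_def field_simps max_def)
  define s where "s x = inverse R * x" for x
  have s: "smooth s" using smooth_linear[of "inverse R" "0::real"] by (simp add: s_def[abs_def] mult.commute)
  \<comment> \<open>R >= 1 permits G = 1 in the chain rule bound, which makes it independent of
    R.\<close>
  have s_deriv: "\<bar>nth_deriv i s x\<bar> \<le> 1 ^ i" if i1: "i \<ge> 1" for i x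
  proof -
    obtain i' where i: "i = Suc i'" using i1 by (cases i) auto
    have "s = (\<lambda>x. x *\<^sub>R inverse R + 0)" by (simp add: s_def[abs_def] mult.commute)
    then have "nth_deriv i s x = (if i' = 0 then inverse R else 0)"
      using nth_deriv_linear[of i' "inverse R" "0::real"] by (simp add: i)
    then show ?thesis using R(1) by (auto simp: inverse_le_1_iff)
  qed
  have qs_smooth: "smooth (\<lambda>x. q (s x))" by (rule smooth_compose[OF s q])
  have qs: "\<bar>nth_deriv j (\<lambda>x. q (s x)) x\<bar> \<le> Q" if j: "j \<le> m" for j x
  proof -
    have "norm (nth_deriv j (\<lambda>x. q (s x)) x) \<le> B j * (\<Sum>j\<le>m. P j) * 1 ^ j"
    proof (rule B(2)[OF s q])
      show "\<forall>j'\<le>j. norm (nth_deriv j' q (s x)) \<le> (\<Sum>j\<le>m. P j)"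
      proof (intro allI impI)
        fix j' assume "j' \<le> j"
        then have "P j' \<le> (\<Sum>j\<le>m. P j)" using j P0 by (intro member_le_sum) auto
        then show "norm (nth_deriv j' q (s x)) \<le> (\<Sum>j\<le>m. P j)" using P order_trans by blast
      qed
    qed (use s_deriv in auto)
    also have "\<dots> \<le> Q"
      unfolding Q_def using j B(1) P0
      by (auto intro!: mult_right_mono member_le_sum sum_nonneg)
    finally show ?thesis by simp
  qed
  define g where "g x = plateau (s x) *\<^sub>R f x" for x
  have diff: "(\<lambda>x. g x - f x) = (\<lambda>x. q (s x) *\<^sub>R f x)"
    by (simp add: g_def q_def scaleR_diff_left)
  show ?thesis
  proof (rule that[of g "2 * R"])
    show "smooth g"
      unfolding g_def[abs_def] by (intro smooth_scaleR smooth_compose[OF s smooth_plateau] f_smooth)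
    fix x assume "\<bar>x\<bar> > 2 * R"
    then have "2 \<le> \<bar>s x\<bar>" using R(1) by (simp add: s_def abs_mult field_simps)
    then show "g x = 0" by (simp add: g_def plateau_eq_0)
  next
    have "O_M_seminorm m v (\<lambda>x. g x - f x) \<le> e / 2"
      unfolding diff
    proof (rule O_M_seminorm_least)
      fix x j assume j: "j \<le> m"
      show "norm (v x * nth_deriv j (\<lambda>x. q (s x) *\<^sub>R f x) x) \<le> e / 2"
      proof (cases "\<bar>x\<bar> < R")
        case True
        have "nth_deriv j (\<lambda>x. q (s x) *\<^sub>R f x) x = nth_deriv j (\<lambda>x. 0) x"
        proof (rule nth_deriv_cong_open[of "{-R<..<R}"])
          fix y assume "y \<in> {-R<..<R}"
          then have "\<bar>s y\<bar> \<le> 1" using R(1) by (auto simp: s_def abs_mult field_simps)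
          then show "q (s y) *\<^sub>R f y = 0" by (simp add: q_def plateau_eq_1)
        qed (use True in auto)
        then show ?thesis using e by (simp add: nth_deriv_const)
      next
        case False
        have "norm (nth_deriv j (\<lambda>x. q (s x) *\<^sub>R f x) x) \<le> (\<Sum>i\<le>j. real (j choose i) * (Q * (C * (1 + x\<^sup>2) ^ k)))"
          unfolding nth_deriv_scaleR[OF qs_smooth f_smooth]
        proof (rule sum_norm_le)
          fix i assume "i \<in> {..j}"
          then have "\<bar>nth_deriv i (\<lambda>x. q (s x)) x\<bar> * norm (nth_deriv (j - i) f x) \<le> Q * (C * (1 + x\<^sup>2) ^ k)"
            using qs[of i x] C(2)[of "j - i" x] j Q0 by (intro mult_mono) auto
          then show "norm (real (j choose i) *\<^sub>R nth_deriv i (\<lambda>x. q (s x)) x *\<^sub>R nth_deriv (j - i) f x)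
             \<le> real (j choose i) * (Q * (C * (1 + x\<^sup>2) ^ k))"
            by (simp add: mult_left_mono abs_mult mult.assoc)
        qed
        also have "\<dots> = 2 ^ j * (Q * (C * (1 + x\<^sup>2) ^ k))"
          by (simp add: sum_distrib_right[symmetric] choose_row_sum[of j, THEN arg_cong[of _ _ real], simplified])
        also have "\<dots> \<le> 2 ^ m * (Q * (C * (1 + x\<^sup>2) ^ k))"
          using j Q0 C(1) weight_pos[of x k] by (intro mult_right_mono power_increasing) auto
        finally have "norm (v x * nth_deriv j (\<lambda>x. q (s x) *\<^sub>R f x) x) \<le> norm (v x) * (2 ^ m * (Q * (C * (1 + x\<^sup>2) ^ k)))"
          unfolding norm_mult by (rule mult_left_mono) simp
        also have "\<dots> = 2 ^ m * (Q * C) * ((1 + x\<^sup>2) ^ Suc k * norm (v x)) / (1 + x\<^sup>2)"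
        proof -
          have "1 + x\<^sup>2 \<noteq> 0" using weight_pos[of x 1] by simp
          then show ?thesis by (simp add: field_simps)
        qed
        also have "\<dots> \<le> 2 ^ m * (Q * C) * D / R"
        proof (rule frac_le)
          have "R \<le> R * R" using R(1) by simp
          also have "\<dots> \<le> \<bar>x\<bar> * \<bar>x\<bar>" using False R(1) by (intro mult_mono) auto
          finally show "R \<le> 1 + x\<^sup>2" by (simp add: power2_eq_square)
          show "2 ^ m * (Q * C) * ((1 + x\<^sup>2) ^ Suc k * norm (v x)) \<le> 2 ^ m * (Q * C) * D"
            using Q0 C(1) D(2) by (intro mult_left_mono) auto
        qed (use R(1) Q0 C(1) D(1) in auto)
        also have "\<dots> = W / R" by (simp add: W_def mult_ac)
        also have "\<dots> \<le> e / 2" by (rule R(2))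
        finally show ?thesis .
      qed
    qed
    then show "O_M_seminorm m v (\<lambda>x. g x - f x) < e" using e by simp
  qed
qed

section \<open>Maps that shift H by a constant\<close>

context
  fixes H :: "real \<Rightarrow> real"
  assumes H: "H \<in> O_M" and dH: "\<And>x. nth_deriv 1 H x \<noteq> 0"
begin

text \<open>Where f o sigma can be nonzero, sigma y lies in [-R, R]; there the derivatives of H are
  bounded and |H'| is bounded below, uniformly in sigma. The derivatives of H o sigma at y are those
  of H, hence polynomially bounded in y, and \<open>nth_deriv_inner_bound\<close> passes this bound
  on to sigma. D and l are chosen before sigma and c.\<close>

lemma conjugate_compose_bound:
  fixes f :: "real \<Rightarrow> 'a::real_normed_vector"
  assumes f: "smooth f" "\<And>x. \<bar>x\<bar> > R \<Longrightarrow> f x = 0"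
  obtains D l where "D > 0" "\<And>\<sigma> c j y. smooth \<sigma> \<Longrightarrow> (\<And>x. H (\<sigma> x) = H x + c) \<Longrightarrow> j \<le> m \<Longrightarrow>
     norm (nth_deriv j (\<lambda>x. f (\<sigma> x)) y) \<le> D * (1 + y\<^sup>2) ^ l"
proof -
  obtain c0 where c0: "c0 > 0" "\<And>x. x \<in> {-R..R} \<Longrightarrow> c0 \<le> norm (nth_deriv 1 H x)"
    using bounded_away_from_0[OF smooth_continuous_nth_deriv[OF O_M_smooth[OF H]] dH] real_norm_def by metis
  obtain k C where C: "C \<ge> 1" "\<And>j x. j \<le> m \<Longrightarrow> norm (nth_deriv j H x) \<le> C * (1 + x\<^sup>2) ^ k"
    by (rule poly_boundedE_uniform[of m "\<lambda>j. nth_deriv j H"]) (use H in \<open>auto simp: O_M_iff\<close>)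
  have "f \<in> O_M" using f by (rule O_M_compact_support)
  then obtain k' C' where C': "C' \<ge> 1" "\<And>j x. j \<le> m \<Longrightarrow> norm (nth_deriv j f x) \<le> C' * (1 + x\<^sup>2) ^ k'"
    using poly_boundedE_uniform[of m "\<lambda>j. nth_deriv j f"] by (metis O_M_iff)
  have weight_R: "B * (1 + x\<^sup>2) ^ n \<le> B * (1 + R\<^sup>2) ^ n" if "\<bar>x\<bar> \<le> R" "B \<ge> 1" for x n and B :: real
    using that abs_le_square_iff[of x R] by (intro mult_left_mono power_mono) auto
  define M where "M = C * (1 + R\<^sup>2) ^ k"
  define M' where "M' = C' * (1 + R\<^sup>2) ^ k'"
  have M0: "M \<ge> 0" "M' \<ge> 0" using C(1) C'(1) weight_pos[of R] by (auto simp: M_def M'_def less_imp_le)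
  obtain A where A: "A \<ge> 1"
    "\<And>s (f::real \<Rightarrow> real) x G. smooth s \<Longrightarrow> smooth f \<Longrightarrow> 0 \<le> G \<Longrightarrow>
     c0 \<le> norm (nth_deriv 1 f (s x)) \<Longrightarrow> (\<forall>i\<in>{1..m}. norm (nth_deriv i f (s x)) \<le> M) \<Longrightarrow>
     (\<forall>i\<in>{1..m}. norm (nth_deriv i (\<lambda>x. f (s x)) x) \<le> G ^ i) \<Longrightarrow>
     (\<forall>i\<in>{1..m}. \<bar>nth_deriv i s x\<bar> \<le> (A * G) ^ i)"
    using nth_deriv_inner_bound[OF c0(1) M0(1), where 'a = real, of m] by metis
  obtain B where B: "\<And>i. 0 \<le> B i"
     "\<And>i s (f::real \<Rightarrow> 'a) x G M. smooth s \<Longrightarrow> smooth f \<Longrightarrow> 0 \<le> G \<Longrightarrow>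
       (\<forall>i\<in>{1..i}. \<bar>nth_deriv i s x\<bar> \<le> G ^ i) \<Longrightarrow> (\<forall>j\<le>i. norm (nth_deriv j f (s x)) \<le> M) \<Longrightarrow>
       norm (nth_deriv i (\<lambda>x. f (s x)) x) \<le> B i * M * G ^ i"
    using nth_deriv_compose_bound[where 'a = 'a] by metis
  define D where "D = (1 + (\<Sum>i\<le>m. B i)) * (1 + M') * (A * C) ^ m"
  have D_pos: "0 < D" unfolding D_def
    using A(1) B(1) C(1) M0 by (intro mult_pos_pos add_pos_nonneg sum_nonneg zero_less_power) auto
  show ?thesis
  proof (rule that[OF D_pos])
    fix \<sigma> c j y
    assume \<sigma>: "smooth \<sigma>" "\<And>x. H (\<sigma> x) = H x + c" and j: "j \<le> m"
    show "norm (nth_deriv j (\<lambda>x. f (\<sigma> x)) y) \<le> D * (1 + y\<^sup>2) ^ (k * m)"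
    proof (cases "\<bar>\<sigma> y\<bar> > R")
      case True
      have "open {x. \<bar>\<sigma> x\<bar> > R}"
        by (intro open_Collect_less continuous_intros smooth_continuous \<sigma>)
      from nth_deriv_cong_open[OF this, of "\<lambda>x. f (\<sigma> x)" "\<lambda>x. 0" y j] True f(2)
      have "nth_deriv j (\<lambda>x. f (\<sigma> x)) y = 0" by (simp add: nth_deriv_const)
      then show ?thesis using D_pos weight_pos[of y "k * m"] by simp
    next
      case False
      then have y: "\<bar>\<sigma> y\<bar> \<le> R" "\<sigma> y \<in> {-R..R}" by auto
      \<comment> \<open>Growth of the derivatives of H at y, not at sigma y; this is where the
        polynomial in y comes from.\<close>
      define G where "G = C * (1 + y\<^sup>2) ^ k"
      have G1: "1 \<le> G"
        using mult_mono[OF C(1) one_le_weight[of y k]] C(1) by (simp add: G_def)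
      have H_deriv: "nth_deriv i (\<lambda>x. H (\<sigma> x)) y = nth_deriv i H y" if "i \<in> {1..m}" for i
        using that nth_deriv_add_const[OF O_M_smooth[OF H], of "i - 1" c] by (simp add: \<sigma>(2))
      have "\<forall>i\<in>{1..m}. \<bar>nth_deriv i \<sigma> y\<bar> \<le> (A * G) ^ i"
      proof (rule A(2)[OF \<sigma>(1) O_M_smooth[OF H]])
        show "c0 \<le> norm (nth_deriv 1 H (\<sigma> y))" using c0(2) y(2) by blast
        show "\<forall>i\<in>{1..m}. norm (nth_deriv i H (\<sigma> y)) \<le> M"
          using C(2) weight_R[OF y(1) C(1)] unfolding M_def by (meson atLeastAtMost_iff order_trans)
        show "\<forall>i\<in>{1..m}. norm (nth_deriv i (\<lambda>x. H (\<sigma> x)) y) \<le> G ^ i"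
        proof
          fix i assume i: "i \<in> {1..m}"
          then have "norm (nth_deriv i H y) \<le> G" using C(2)[of i y] by (simp add: G_def)
          also have "G \<le> G ^ i" using i G1 by (intro self_le_power) auto
          finally show "norm (nth_deriv i (\<lambda>x. H (\<sigma> x)) y) \<le> G ^ i" by (simp add: H_deriv[OF i])
        qed
      qed (use G1 in simp)
      moreover have "norm (nth_deriv i f (\<sigma> y)) \<le> M'" if "i \<le> m" for i
        using C'(2)[OF that] weight_R[OF y(1) C'(1)] unfolding M'_def by (meson order_trans)
      ultimately have "norm (nth_deriv j (\<lambda>x. f (\<sigma> x)) y) \<le> B j * M' * (A * G) ^ j"
        using j A(1) G1 by (intro B(2) \<sigma>(1) f(1)) auto
      also have "\<dots> \<le> (1 + (\<Sum>i\<le>m. B i)) * (1 + M') * (A * G) ^ m"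
      proof (intro mult_mono)
        have "B j \<le> (\<Sum>i\<le>m. B i)" by (rule member_le_sum) (use B j in auto)
        then show "B j \<le> 1 + (\<Sum>i\<le>m. B i)" by simp
        show "0 \<le> 1 + (\<Sum>i\<le>m. B i)" using B(1) by (intro add_nonneg_nonneg sum_nonneg) auto
        then show "0 \<le> (1 + (\<Sum>i\<le>m. B i)) * (1 + M')" using M0 by simp
        have "1 \<le> A * G" using A(1) G1 mult_mono[OF A(1) G1] by simp
        then show "(A * G) ^ j \<le> (A * G) ^ m" using j by (intro power_increasing)
      qed (use M0 A(1) G1 in auto)
      also have "\<dots> = D * (1 + y\<^sup>2) ^ (k * m)"
        by (simp add: D_def G_def power_mult_distrib power_mult)
      finally show ?thesis .
    qed
  qed
qed

text \<open>If sigma y lies in [-R, R], then |H y| >= |c| - M. Polynomial growth of H turns this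
  into a lower bound for a power of 1 + y^2, which the rapid decrease of v outweighs.\<close>

lemma conjugate_compose_small:
  fixes f :: "real \<Rightarrow> complex"
  assumes f: "smooth f" "\<And>x. \<bar>x\<bar> > R \<Longrightarrow> f x = 0" and v: "v \<in> schwartz" and e: "e > 0"
  obtains N where "\<And>\<sigma> c. smooth \<sigma> \<Longrightarrow> (\<And>x. H (\<sigma> x) = H x + c) \<Longrightarrow> \<bar>c\<bar> \<ge> N \<Longrightarrow>
      O_M_seminorm m v (\<lambda>x. f (\<sigma> x)) < e"
proof -
  obtain D l where D: "D > 0" "\<And>\<sigma> c j y. smooth \<sigma> \<Longrightarrow> (\<And>x. H (\<sigma> x) = H x + c) \<Longrightarrow> j \<le> m \<Longrightarrow>
     norm (nth_deriv j (\<lambda>x. f (\<sigma> x)) y) \<le> D * (1 + y\<^sup>2) ^ l"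
    using conjugate_compose_bound[OF f] by blast
  have "poly_bounded H" using H[unfolded O_M_iff] nth_deriv_0[of H] by metis
  then obtain k C where C: "C \<ge> 1" "\<And>x. norm (H x) \<le> C * (1 + x\<^sup>2) ^ k"
    using poly_boundedE by blast
  obtain M where M: "M > 0" "\<And>x. x \<in> {-R..R} \<Longrightarrow> norm (H x) \<le> M"
    using continuous_real_bounded_on_interval[OF smooth_continuous[OF O_M_smooth[OF H]]] by blast
  obtain V where V: "V > 0" "\<And>x. (1 + x\<^sup>2) ^ (k + l) * norm (v x) \<le> V"
    using schwartz_weight_bound[OF v] by blast
  \<comment> \<open>The second summand is the lower bound for |H y| that brings the weighted
    derivative down to e/2.\<close>
  define N where "N = M + 2 * (C * D * V) / e"
  have CDV: "0 < C * D * V" using C D V by simp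
  show ?thesis
  proof (rule that[of N])
    fix \<sigma> c
    assume \<sigma>: "smooth \<sigma>" "\<And>x. H (\<sigma> x) = H x + c" and c: "N \<le> \<bar>c\<bar>"
    have "O_M_seminorm m v (\<lambda>x. f (\<sigma> x)) \<le> e / 2"
    proof (rule O_M_seminorm_least)
      fix y j assume j: "j \<le> m"
      show "norm (v y * nth_deriv j (\<lambda>x. f (\<sigma> x)) y) \<le> e / 2"
      proof (cases "\<bar>\<sigma> y\<bar> > R")
        case True
        have "open {x. \<bar>\<sigma> x\<bar> > R}"
          by (intro open_Collect_less continuous_intros smooth_continuous \<sigma>)
        from nth_deriv_cong_open[OF this, of "\<lambda>x. f (\<sigma> x)" "\<lambda>x. 0" y j] True f(2)
        have "nth_deriv j (\<lambda>x. f (\<sigma> x)) y = 0" by (simp add: nth_deriv_const)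
        then show ?thesis using e by simp
      next
        case False
        then have "\<sigma> y \<in> {-R..R}" by auto
        then have "\<bar>H (\<sigma> y)\<bar> \<le> M" using M(2) by fastforce
        then have "N - M \<le> \<bar>H y\<bar>" using c \<sigma>(2)[of y] by linarith
        then have *: "2 * (C * D * V) / e \<le> C * (1 + y\<^sup>2) ^ k" using C(2)[of y] by (simp add: N_def)
        let ?t = "norm (v y * nth_deriv j (\<lambda>x. f (\<sigma> x)) y)"
        have "?t \<le> norm (v y) * (D * (1 + y\<^sup>2) ^ l)"
          unfolding norm_mult by (intro mult_left_mono D(2)[OF \<sigma> j]) auto
        then have "(2 * (C * D * V) / e) * ?t \<le> (C * (1 + y\<^sup>2) ^ k) * (norm (v y) * (D * (1 + y\<^sup>2) ^ l))"
          using * C(1) weight_pos[of y k] by (intro mult_mono) auto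
        also have "\<dots> = C * D * ((1 + y\<^sup>2) ^ (k + l) * norm (v y))" by (simp add: power_add)
        also have "\<dots> \<le> C * D * V" using C(1) D(1) V(2) by (intro mult_left_mono) auto
        finally have "(C * D * V) * (2 * ?t) \<le> (C * D * V) * e" using e by (simp add: field_simps)
        then show ?thesis using CDV by (simp only: mult_le_cancel_left_pos)
      qed
    qed
    then show "O_M_seminorm m v (\<lambda>x. f (\<sigma> x)) < e" using e by simp
  qed
qed

text \<open>Along such a sequence |H| grows at least linearly in n, so a fixed power of 1 + (a n)^2
  does as well.\<close>

lemma schwartz_along_orbit:
  assumes v: "v \<in> schwartz" and a: "\<And>n. real n \<le> \<bar>H (a n)\<bar> + B"
  shows "(\<lambda>n. v (a n) * of_nat n) \<longlonglongrightarrow> 0"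
proof -
  have "poly_bounded H" using H[unfolded O_M_iff] nth_deriv_0[of H] by metis
  then obtain k C where C: "C \<ge> 1" "\<And>x. norm (H x) \<le> C * (1 + x\<^sup>2) ^ k"
    using poly_boundedE by blast
  \<comment> \<open>The doubled exponent gives decay of order 1/n^2, which leaves 1/n after
    multiplication by n.\<close>
  obtain V where V: "V > 0" "\<And>x. (1 + x\<^sup>2) ^ (k + k) * norm (v x) \<le> V"
    using schwartz_weight_bound[OF v] by blast
  show ?thesis
  proof (rule Lim_null_comparison)
    show "\<forall>\<^sub>F n in sequentially. norm (v (a n) * of_nat n) \<le> 4 * (C * C * V) / real n"
    proof (rule eventually_sequentiallyI[of "nat \<lceil>max 1 (2 * B)\<rceil>"])
      fix n assume "nat \<lceil>max 1 (2 * B)\<rceil> \<le> n"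
      then have "max 1 (2 * B) \<le> real n" by linarith
      then have n: "1 \<le> real n" "2 * B \<le> real n" by auto
      let ?w = "(1 + (a n)\<^sup>2) ^ k"
      \<comment> \<open>Since n >= 2B, the constant B is absorbed into half of n.\<close>
      have "real n / 2 \<le> C * ?w" using a[of n] n C(2)[of "a n"] by simp
      then have "(real n / 2) * (real n / 2) \<le> (C * ?w) * (C * ?w)" using n by (intro mult_mono) auto
      then have "((real n / 2) * (real n / 2)) * norm (v (a n)) \<le> ((C * ?w) * (C * ?w)) * norm (v (a n))"
        by (rule mult_right_mono) simp
      also have "\<dots> = C * C * ((1 + (a n)\<^sup>2) ^ (k + k) * norm (v (a n)))"
        by (simp add: power_add)
      also have "\<dots> \<le> C * C * V" using C(1) V(2) by (intro mult_left_mono) auto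
      finally show "norm (v (a n) * of_nat n) \<le> 4 * (C * C * V) / real n"
        using n by (simp add: norm_mult field_simps)
    qed
    show "(\<lambda>n. 4 * (C * C * V) / real n) \<longlonglongrightarrow> 0" by (rule lim_const_over_n)
  qed
qed

text \<open>For compactly supported f and g near the two targets the witness is f + g o tau^n, with
  tau the inverse of psi. Its second term is small, and the n-th power of the operator maps it to g
  + f o psi^n, whose second term is small as well; both facts are instances of
  \<open>conjugate_compose_small\<close>, with c = -n and c = n.\<close>

lemma Abel_imp_mixing:
  assumes \<psi>: "\<psi> \<in> O_M" "bij \<psi>" and Abel: "\<And>x. H (\<psi> x) = H x + 1"
  shows "mixing_operator O_M_topology (composition_operator \<psi>)"
    and "v \<in> schwartz \<Longrightarrow> (\<lambda>n. v ((\<psi> ^^ n) 0) * of_nat n) \<longlonglongrightarrow> 0"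
    and "v \<in> schwartz \<Longrightarrow> (\<lambda>n. v (inv (\<psi> ^^ n) 0) * of_nat n) \<longlonglongrightarrow> 0"
proof -
  let ?\<tau> = "inv \<psi>"
  have inv: "?\<tau> (\<psi> x) = x" "\<psi> (?\<tau> x) = x" for x
    using \<psi>(2) by (simp_all add: bij_is_inj bij_is_surj surj_f_inv_f)
  have \<psi>_smooth: "smooth \<psi>" using \<psi>(1) by (rule O_M_smooth)
  have H_smooth: "smooth H" using H by (rule O_M_smooth)
  \<comment> \<open>Differentiating Abel's equation gives psi' times H' o psi = H', so psi' has no
    zeros and the inverse of psi is smooth.\<close>
  have d\<psi>: "nth_deriv 1 \<psi> x \<noteq> 0" for x
  proof
    assume 0: "nth_deriv 1 \<psi> x = 0"
    have "((\<lambda>x. H (\<psi> x)) has_vector_derivative nth_deriv 1 \<psi> x *\<^sub>R nth_deriv 1 H (\<psi> x)) (at x)"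
      by (intro has_vector_derivative_compose_real smooth_deriv1 \<psi>_smooth H_smooth)
    moreover have "((\<lambda>x. H x + 1) has_vector_derivative nth_deriv 1 H x + 0) (at x)"
      by (intro has_vector_derivative_add smooth_deriv1 H_smooth has_vector_derivative_const)
    ultimately have "nth_deriv 1 H x + 0 = nth_deriv 1 \<psi> x *\<^sub>R nth_deriv 1 H (\<psi> x)"
      unfolding Abel using vector_derivative_unique_at by blast
    then show False using 0 dH[of x] by simp
  qed
  have \<tau>_smooth: "smooth ?\<tau>" by (rule smooth_inv_function[OF \<psi>_smooth d\<psi> inv])
  have H\<psi>: "H ((\<psi> ^^ n) x) = H x + real n" for n x
    by (induction n) (simp_all add: Abel)
  have inv_n: "(?\<tau> ^^ n) ((\<psi> ^^ n) x) = x" "(\<psi> ^^ n) ((?\<tau> ^^ n) x) = x" for n x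
    using inv_fn[OF \<psi>(2), of n] bij_fn[OF \<psi>(2), of n]
    by (metis bij_is_inj inv_f_f) (metis inv_fn[OF \<psi>(2), of n] bij_fn[OF \<psi>(2), of n] bij_is_surj surj_f_inv_f)
  have H\<tau>: "H ((?\<tau> ^^ n) x) = H x + (- real n)" for n x
    using H\<psi>[of n "(?\<tau> ^^ n) x"] by (simp add: inv_n)
  have smooth_n: "smooth (\<psi> ^^ n)" "smooth (?\<tau> ^^ n)" for n
    by (intro smooth_funpow \<psi>_smooth \<tau>_smooth)+
  show "(\<lambda>n. v ((\<psi> ^^ n) 0) * of_nat n) \<longlonglongrightarrow> 0" if "v \<in> schwartz"
    by (rule schwartz_along_orbit[OF that, of _ "\<bar>H 0\<bar>"]) (simp add: H\<psi>; linarith)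
  show "(\<lambda>n. v (inv (\<psi> ^^ n) 0) * of_nat n) \<longlonglongrightarrow> 0" if "v \<in> schwartz"
    unfolding inv_fn[OF \<psi>(2)]
    by (rule schwartz_along_orbit[OF that, of _ "\<bar>H 0\<bar>"]) (simp add: H\<tau>; linarith)
  have "\<forall>\<^sub>F n in sequentially. (composition_operator \<psi> ^^ n) ` U \<inter> V \<noteq> {}"
    if UV: "openin O_M_topology U" "U \<noteq> {}" "openin O_M_topology V" "V \<noteq> {}" for U V
  proof -
    obtain f0 where f0: "f0 \<in> U" "f0 \<in> O_M"
      using UV(1,2) openin_subset topspace_O_M_topology by blast
    obtain g0 where g0: "g0 \<in> V" "g0 \<in> O_M"
      using UV(3,4) openin_subset topspace_O_M_topology by blast
    obtain m1 v1 e1 where 1: "v1 \<in> schwartz" "e1 > 0" "O_M_ball m1 v1 f0 e1 \<subseteq> U"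
      using openin_O_M_topology_ball[OF UV(1) f0(1)] by blast
    obtain m2 v2 e2 where 2: "v2 \<in> schwartz" "e2 > 0" "O_M_ball m2 v2 g0 e2 \<subseteq> V"
      using openin_O_M_topology_ball[OF UV(3) g0(1)] by blast
    obtain f Rf where f: "smooth f" "\<And>x. \<bar>x\<bar> > Rf \<Longrightarrow> f x = 0" "O_M_seminorm m1 v1 (\<lambda>x. f x - f0 x) < e1 / 2"
      using cutoff_dense[OF f0(2) 1(1) half_gt_zero[OF 1(2)]] by metis
    obtain g Rg where g: "smooth g" "\<And>x. \<bar>x\<bar> > Rg \<Longrightarrow> g x = 0" "O_M_seminorm m2 v2 (\<lambda>x. g x - g0 x) < e2 / 2"
      using cutoff_dense[OF g0(2) 2(1) half_gt_zero[OF 2(2)]] by metis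
    obtain N1 where N1: "\<And>\<sigma> c. smooth \<sigma> \<Longrightarrow> (\<And>x. H (\<sigma> x) = H x + c) \<Longrightarrow> \<bar>c\<bar> \<ge> N1 \<Longrightarrow>
      O_M_seminorm m1 v1 (\<lambda>x. g (\<sigma> x)) < e1 / 2"
      using conjugate_compose_small[OF g(1,2) 1(1) half_gt_zero[OF 1(2)]] by metis
    obtain N2 where N2: "\<And>\<sigma> c. smooth \<sigma> \<Longrightarrow> (\<And>x. H (\<sigma> x) = H x + c) \<Longrightarrow> \<bar>c\<bar> \<ge> N2 \<Longrightarrow>
      O_M_seminorm m2 v2 (\<lambda>x. f (\<sigma> x)) < e2 / 2"
      using conjugate_compose_small[OF f(1,2) 2(1) half_gt_zero[OF 2(2)]] by metis
    have f_O_M: "f \<in> O_M" using f(1,2) by (rule O_M_compact_support)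
    have g_O_M: "g \<in> O_M" using g(1,2) by (rule O_M_compact_support)
    \<comment> \<open>The inverse of psi is known here only to be smooth, so
      \<open>O_M_compose\<close> does not apply to it; the uniform bound for maps that shift H takes
      its place.\<close>
    have comp_O_M: "(\<lambda>x. h (\<sigma> x)) \<in> O_M"
      if h: "smooth h" "\<And>x. \<bar>x\<bar> > R \<Longrightarrow> h x = 0" and \<sigma>: "smooth \<sigma>" "\<And>x. H (\<sigma> x) = H x + c"
      for h :: "real \<Rightarrow> complex" and R \<sigma> c
      unfolding O_M_iff
    proof (intro conjI allI)
      show "smooth (\<lambda>x. h (\<sigma> x))" by (rule smooth_compose[OF \<sigma>(1) h(1)])
      fix j
      obtain D l where D: "\<And>\<sigma> c i y. smooth \<sigma> \<Longrightarrow> (\<And>x. H (\<sigma> x) = H x + c) \<Longrightarrow> i \<le> j \<Longrightarrow>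
         norm (nth_deriv i (\<lambda>x. h (\<sigma> x)) y) \<le> D * (1 + y\<^sup>2) ^ l"
        using conjugate_compose_bound[OF h] by metis
      show "poly_bounded (nth_deriv j (\<lambda>x. h (\<sigma> x)))"
        unfolding poly_bounded_def using D[OF \<sigma> order_refl] by blast
    qed
    show ?thesis
    proof (rule eventually_sequentiallyI[of "nat \<lceil>max N1 N2\<rceil>"])
      fix n assume "nat \<lceil>max N1 N2\<rceil> \<le> n"
      then have n: "N1 \<le> \<bar>- real n\<bar>" "N2 \<le> \<bar>real n\<bar>" by linarith+
      define h where "h x = f x + g ((?\<tau> ^^ n) x)" for x
      have g\<tau>: "(\<lambda>x. g ((?\<tau> ^^ n) x)) \<in> O_M" by (rule comp_O_M[OF g(1,2) smooth_n(2) H\<tau>])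
      have f\<psi>: "(\<lambda>x. f ((\<psi> ^^ n) x)) \<in> O_M" by (rule comp_O_M[OF f(1,2) smooth_n(1) H\<psi>])
      have "O_M_seminorm m1 v1 (\<lambda>x. (f x - f0 x) + g ((?\<tau> ^^ n) x)) < e1"
        using O_M_seminorm_add[OF 1(1) O_M_diff[OF f_O_M f0(2)] g\<tau>, of m1] f(3) N1[OF smooth_n(2) H\<tau> n(1)]
        by linarith
      moreover have "(\<lambda>x. (f x - f0 x) + g ((?\<tau> ^^ n) x)) = (\<lambda>x. h x - f0 x)" by (simp add: h_def algebra_simps)
      ultimately have "h \<in> O_M_ball m1 v1 f0 e1"
        using O_M_add[OF f_O_M g\<tau>] by (simp add: O_M_ball_def h_def[abs_def])
      then have hU: "h \<in> U" using 1(3) by blast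
      have eq: "(composition_operator \<psi> ^^ n) h = (\<lambda>x. g x + f ((\<psi> ^^ n) x))"
        by (simp add: composition_operator_funpow h_def inv_n add.commute)
      have "O_M_seminorm m2 v2 (\<lambda>x. (g x - g0 x) + f ((\<psi> ^^ n) x)) < e2"
        using O_M_seminorm_add[OF 2(1) O_M_diff[OF g_O_M g0(2)] f\<psi>, of m2] g(3) N2[OF smooth_n(1) H\<psi> n(2)]
        by linarith
      moreover have "(\<lambda>x. (g x - g0 x) + f ((\<psi> ^^ n) x)) = (\<lambda>x. (composition_operator \<psi> ^^ n) h x - g0 x)"
        by (simp add: eq algebra_simps)
      ultimately have "(composition_operator \<psi> ^^ n) h \<in> O_M_ball m2 v2 g0 e2"
        using O_M_add[OF g_O_M f\<psi>] by (simp add: O_M_ball_def eq)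
      then show "(composition_operator \<psi> ^^ n) ` U \<inter> V \<noteq> {}" using 2(3) hU by blast
    qed
  qed
  then show "mixing_operator O_M_topology (composition_operator \<psi>)"
    unfolding mixing_operator_def using composition_continuous_linear[OF \<psi>] by blast
qed

end

section \<open>From mixing to Abel's equation\<close>

text \<open>A threshold N valid for all later n matters: the order of the iterate will be dictated
  by the point under consideration.\<close>

lemma mixing_approximation:
  assumes mix: "mixing_operator O_M_topology (composition_operator \<psi>)"
    and f: "f \<in> O_M" and g: "g \<in> O_M" and v: "v \<in> schwartz" and e: "e > 0"
  obtains N where "\<And>n. n \<ge> N \<Longrightarrow> \<exists>h\<in>O_M. (\<lambda>x. h ((\<psi> ^^ n) x)) \<in> O_M \<and>
      O_M_seminorm m v (\<lambda>x. h x - f x) < e \<and> O_M_seminorm m v (\<lambda>x. h ((\<psi> ^^ n) x) - g x) < e"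
proof -
  have "O_M_ball m v f e \<noteq> {}" "O_M_ball m v g e \<noteq> {}"
    using O_M_ball_center[OF f e] O_M_ball_center[OF g e] by blast+
  then have "\<forall>\<^sub>F n in sequentially. (composition_operator \<psi> ^^ n) ` O_M_ball m v f e \<inter> O_M_ball m v g e \<noteq> {}"
    using mix openin_O_M_ball[OF v f e] openin_O_M_ball[OF v g e] unfolding mixing_operator_def by blast
  then obtain N where N: "\<And>n. n \<ge> N \<Longrightarrow> (composition_operator \<psi> ^^ n) ` O_M_ball m v f e \<inter> O_M_ball m v g e \<noteq> {}"
    unfolding eventually_sequentially by blast
  show ?thesis
  proof (rule that[of N])
    fix n assume "N \<le> n"
    from N[OF this] obtain h where "h \<in> O_M_ball m v f e" "(composition_operator \<psi> ^^ n) h \<in> O_M_ball m v g e"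
      by blast
    then show "\<exists>h\<in>O_M. (\<lambda>x. h ((\<psi> ^^ n) x)) \<in> O_M \<and>
      O_M_seminorm m v (\<lambda>x. h x - f x) < e \<and> O_M_seminorm m v (\<lambda>x. h ((\<psi> ^^ n) x) - g x) < e"
      unfolding composition_operator_funpow O_M_ball_def by blast
  qed
qed

section \<open>Consequences of mixing for the dynamics\<close>

lemma complex_of_real_in_O_M: "complex_of_real \<in> O_M"
proof -
  have "complex_of_real = (\<lambda>x. x *\<^sub>R 1 + 0)" by (auto simp: of_real_def)
  then show ?thesis using O_M_linear[of "1::complex" 0] by metis
qed

lemma nth_deriv_complex_of_real: "nth_deriv (Suc j) complex_of_real = (\<lambda>x. if j = 0 then 1 else 0)"
proof -
  have "complex_of_real = (\<lambda>x. x *\<^sub>R 1 + 0)" by (auto simp: of_real_def)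
  then show ?thesis using nth_deriv_linear[of j "1::complex" 0] by metis
qed

text \<open>At a fixed point a the functions h and h o psi^n take the same value, which cannot be
  close to both 0 and 1.\<close>

lemma mixing_imp_no_fixed_point:
  assumes "mixing_operator O_M_topology (composition_operator \<psi>)"
  shows "\<psi> a \<noteq> a"
proof
  assume a: "\<psi> a = a"
  then have an: "(\<psi> ^^ n) a = a" for n by (induction n) auto
  obtain v where v: "v \<in> schwartz" "\<And>x. \<bar>x\<bar> \<le> \<bar>a\<bar> \<Longrightarrow> 1 \<le> norm (v x)"
    using schwartz_ge_one_on_interval by metis
  have half: "(0::real) < 1 / 2" by simp
  obtain h n where h: "h \<in> O_M" "(\<lambda>x. h ((\<psi> ^^ n) x)) \<in> O_M"
    "O_M_seminorm 0 v (\<lambda>x. h x - 0) < 1 / 2" "O_M_seminorm 0 v (\<lambda>x. h ((\<psi> ^^ n) x) - 1) < 1 / 2"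
    by (rule mixing_approximation[OF assms O_M_const[of 0] O_M_const[of 1] v(1) half, of 0]) blast
  have le: "norm (f a) \<le> O_M_seminorm 0 v f" if "f \<in> O_M" for f
  proof -
    have "1 * norm (f a) \<le> norm (v a) * norm (f a)" by (rule mult_right_mono) (use v(2) in auto)
    then show ?thesis using O_M_seminorm_upper[OF v(1) that, of 0 0 a] by (simp add: norm_mult)
  qed
  have "norm (h a - 0) < 1 / 2" "norm (h ((\<psi> ^^ n) a) - 1) < 1 / 2"
    using le[OF O_M_diff[OF h(1) O_M_const[of 0]]] le[OF O_M_diff[OF h(2) O_M_const[of 1]]] h(3,4) by auto
  then show False
    unfolding an using norm_triangle_ineq4[of "h a - 0" "h a - 1"] by simp
qed

text \<open>At a zero a of psi' every h o psi^n with n >= 1 has derivative 0, so it cannot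
  approximate the identity in a seminorm of order 1.\<close>

lemma mixing_imp_deriv_nonzero:
  assumes mix: "mixing_operator O_M_topology (composition_operator \<psi>)" and \<psi>: "smooth \<psi>"
  shows "nth_deriv 1 \<psi> a \<noteq> 0"
proof
  assume a: "nth_deriv 1 \<psi> a = 0"
  obtain v where v: "v \<in> schwartz" "\<And>x. \<bar>x\<bar> \<le> \<bar>a\<bar> \<Longrightarrow> 1 \<le> norm (v x)"
    using schwartz_ge_one_on_interval by metis
  have half: "(0::real) < 1 / 2" by simp
  obtain N where N: "\<And>n. n \<ge> N \<Longrightarrow> \<exists>h\<in>O_M. (\<lambda>x. h ((\<psi> ^^ n) x)) \<in> O_M \<and>
      O_M_seminorm 1 v (\<lambda>x. h x - 0) < 1 / 2 \<and> O_M_seminorm 1 v (\<lambda>x. h ((\<psi> ^^ n) x) - complex_of_real x) < 1 / 2"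
    by (rule mixing_approximation[OF mix O_M_const[of 0] complex_of_real_in_O_M v(1) half, of 1]) blast
  \<comment> \<open>\<open>Suc N\<close> guarantees at least one application of psi.\<close>
  obtain h where h: "h \<in> O_M" "(\<lambda>x. h ((\<psi> ^^ Suc N) x)) \<in> O_M"
    "O_M_seminorm 1 v (\<lambda>x. h ((\<psi> ^^ Suc N) x) - complex_of_real x) < 1 / 2"
    using N[of "Suc N"] by auto
  let ?g = "\<lambda>x. h ((\<psi> ^^ Suc N) x)"
  have "smooth (\<lambda>x. h ((\<psi> ^^ N) x))"
    by (rule smooth_compose[OF smooth_funpow[OF \<psi>] O_M_smooth[OF h(1)]])
  from has_vector_derivative_compose_real[OF smooth_deriv1[OF \<psi>] smooth_deriv1[OF this], of a]
  \<comment> \<open>In \<open>(\<psi> ^^ N) \<circ> \<psi>\<close> the map psi acts first, so its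
    derivative at a itself is a factor.\<close>
  have "(?g has_vector_derivative 0) (at a)" by (simp only: a scaleR_zero_left funpow_Suc_right o_def)
  then have 0: "nth_deriv 1 ?g a = 0" unfolding nth_deriv_one by (rule vector_derivative_at)
  have "nth_deriv 1 (\<lambda>x. ?g x - complex_of_real x) a = -1"
    using nth_deriv_diff[OF O_M_smooth[OF h(2)] O_M_smooth[OF complex_of_real_in_O_M], of 1 a]
    unfolding 0 using nth_deriv_complex_of_real[of 0] by simp
  then have "norm (v a) \<le> O_M_seminorm 1 v (\<lambda>x. ?g x - complex_of_real x)"
    using O_M_seminorm_upper[OF v(1) O_M_diff[OF h(2) complex_of_real_in_O_M], of 1 1 a] by simp
  then show False using v(2)[of a] h(3) by simp
qed

text \<open>For the iterates of psi, f is an h near the identity with h o psi^n near 0. For those of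
  the inverse the roles are exchanged: h is near 0, h o psi^n is near the identity, and f is the
  latter.\<close>

lemma mixing_near_identity:
  assumes mix: "mixing_operator O_M_topology (composition_operator \<psi>)" and \<psi>: "bij \<psi>"
    and v: "v \<in> schwartz"
  obtains N where "\<And>n \<sigma>. n \<ge> N \<Longrightarrow> \<sigma> \<in> {\<psi> ^^ n, inv \<psi> ^^ n} \<Longrightarrow> \<exists>f::real \<Rightarrow> complex. f \<in> O_M \<and>
     (\<forall>x i. \<bar>x\<bar> \<le> R \<longrightarrow> i \<le> m \<longrightarrow> norm (nth_deriv i (\<lambda>x. f x - complex_of_real x) x) \<le> 1 / 2) \<and>
     (\<forall>y i. i \<le> m \<longrightarrow> norm (v y) * norm (nth_deriv i (\<lambda>y. f (\<sigma> y)) y) \<le> 1)"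
proof -
  obtain u where u: "u \<in> schwartz" "\<And>x. \<bar>x\<bar> \<le> R \<Longrightarrow> 1 \<le> norm (u x)"
    using schwartz_ge_one_on_interval by metis
  \<comment> \<open>One weight for both demands: u turns smallness into closeness on [-R, R], and v
    gives the global estimate.\<close>
  obtain w where w: "w \<in> schwartz" "\<And>x. norm (v x) \<le> norm (w x)" "\<And>x. norm (u x) \<le> norm (w x)"
    using schwartz_dominates_two[OF v u(1)] by metis
  have half: "(0::real) < 1 / 2" by simp
  have near: "norm (nth_deriv i g x) \<le> 1 / 2"
    if "g \<in> O_M" "O_M_seminorm m w g < 1 / 2" "\<bar>x\<bar> \<le> R" "i \<le> m" for g i x
  proof -
    have "1 \<le> norm (w x)" using u(2)[OF that(3)] w(3)[of x] by linarith
    then have "1 * norm (nth_deriv i g x) \<le> norm (w x) * norm (nth_deriv i g x)" by (rule mult_right_mono) simp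
    then show ?thesis using O_M_seminorm_upper[OF w(1) that(1,4), of x] that(2) by (simp add: norm_mult)
  qed
  have small: "norm (v x) * norm (nth_deriv i g x) \<le> 1"
    if "g \<in> O_M" "O_M_seminorm m w (\<lambda>x. g x - 0) < 1 / 2" "i \<le> m" for g i x
  proof -
    have "norm (v x) * norm (nth_deriv i g x) \<le> norm (w x) * norm (nth_deriv i g x)"
      using w(2) by (rule mult_right_mono) simp
    then show ?thesis using O_M_seminorm_upper[OF w(1) that(1,3), of x] that(2) by (simp add: norm_mult)
  qed
  have inv_n: "(\<psi> ^^ n) ((inv \<psi> ^^ n) x) = x" for n x
    by (metis inv_fn[OF \<psi>, of n] bij_fn[OF \<psi>, of n] bij_is_surj surj_f_inv_f)
  obtain N1 where N1: "\<And>n. n \<ge> N1 \<Longrightarrow> \<exists>h\<in>O_M. (\<lambda>x. h ((\<psi> ^^ n) x)) \<in> O_M \<and>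
      O_M_seminorm m w (\<lambda>x. h x - complex_of_real x) < 1 / 2 \<and> O_M_seminorm m w (\<lambda>x. h ((\<psi> ^^ n) x) - 0) < 1 / 2"
    by (rule mixing_approximation[OF mix complex_of_real_in_O_M O_M_const[of 0] w(1) half, of m]) blast
  obtain N2 where N2: "\<And>n. n \<ge> N2 \<Longrightarrow> \<exists>h\<in>O_M. (\<lambda>x. h ((\<psi> ^^ n) x)) \<in> O_M \<and>
      O_M_seminorm m w (\<lambda>x. h x - 0) < 1 / 2 \<and> O_M_seminorm m w (\<lambda>x. h ((\<psi> ^^ n) x) - complex_of_real x) < 1 / 2"
    by (rule mixing_approximation[OF mix O_M_const[of 0] complex_of_real_in_O_M w(1) half, of m]) blast
  show ?thesis
  proof (rule that[of "max N1 N2"])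
    fix n and \<sigma> :: "real \<Rightarrow> real"
    assume n: "max N1 N2 \<le> n" and \<sigma>: "\<sigma> \<in> {\<psi> ^^ n, inv \<psi> ^^ n}"
    then have "n \<ge> N1" "n \<ge> N2" by auto
    from \<sigma> consider "\<sigma> = \<psi> ^^ n" | "\<sigma> = inv \<psi> ^^ n" by blast
    then show "\<exists>f::real \<Rightarrow> complex. f \<in> O_M \<and>
     (\<forall>x i. \<bar>x\<bar> \<le> R \<longrightarrow> i \<le> m \<longrightarrow> norm (nth_deriv i (\<lambda>x. f x - complex_of_real x) x) \<le> 1 / 2) \<and>
     (\<forall>y i. i \<le> m \<longrightarrow> norm (v y) * norm (nth_deriv i (\<lambda>y. f (\<sigma> y)) y) \<le> 1)"
    proof cases
      case 1
      obtain h where h: "h \<in> O_M" "(\<lambda>x. h ((\<psi> ^^ n) x)) \<in> O_M" "O_M_seminorm m w (\<lambda>x. h x - complex_of_real x) < 1 / 2"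
        "O_M_seminorm m w (\<lambda>x. h ((\<psi> ^^ n) x) - 0) < 1 / 2"
        using N1[OF \<open>n \<ge> N1\<close>] by blast
      have "\<forall>x i. \<bar>x\<bar> \<le> R \<longrightarrow> i \<le> m \<longrightarrow> norm (nth_deriv i (\<lambda>x. h x - complex_of_real x) x) \<le> 1 / 2"
        using near[OF O_M_diff[OF h(1) complex_of_real_in_O_M] h(3)] by blast
      moreover have "\<forall>y i. i \<le> m \<longrightarrow> norm (v y) * norm (nth_deriv i (\<lambda>y. h (\<sigma> y)) y) \<le> 1"
        unfolding 1 using small[OF h(2) h(4)] by blast
      ultimately show ?thesis using h(1) by blast
    next
      case 2
      obtain h where h: "h \<in> O_M" "(\<lambda>x. h ((\<psi> ^^ n) x)) \<in> O_M" "O_M_seminorm m w (\<lambda>x. h x - 0) < 1 / 2"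
        "O_M_seminorm m w (\<lambda>x. h ((\<psi> ^^ n) x) - complex_of_real x) < 1 / 2"
        using N2[OF \<open>n \<ge> N2\<close>] by blast
      \<comment> \<open>Composition with the n-th iterate of the inverse gives back h, which is
        small.\<close>
      let ?f = "\<lambda>x. h ((\<psi> ^^ n) x)"
      have "\<forall>x i. \<bar>x\<bar> \<le> R \<longrightarrow> i \<le> m \<longrightarrow> norm (nth_deriv i (\<lambda>x. ?f x - complex_of_real x) x) \<le> 1 / 2"
        using near[OF O_M_diff[OF h(2) complex_of_real_in_O_M] h(4)] by blast
      moreover have "\<forall>y i. i \<le> m \<longrightarrow> norm (v y) * norm (nth_deriv i (\<lambda>y. ?f (\<sigma> y)) y) \<le> 1"
        unfolding 2 inv_n using small[OF h(1) h(3)] by blast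
      ultimately show ?thesis using h(2) by blast
    qed
  qed
qed

text \<open>A bounded increasing orbit would converge to a fixed point of s.\<close>

lemma funpow_ge_unbounded:
  fixes s :: "real \<Rightarrow> real"
  assumes s: "\<And>x. isCont s x" "\<And>x. s x > x"
  obtains N where "\<And>n. n \<ge> N \<Longrightarrow> B \<le> (s ^^ n) x"
proof -
  have inc: "incseq (\<lambda>n. (s ^^ n) x)" by (rule incseq_SucI) (use s(2) less_imp_le in auto)
  have "\<exists>N. B \<le> (s ^^ N) x"
  proof (rule ccontr)
    assume "\<nexists>N. B \<le> (s ^^ N) x"
    then have "\<And>n. (s ^^ n) x \<le> B" by (meson le_cases)
    then obtain L where L: "(\<lambda>n. (s ^^ n) x) \<longlonglongrightarrow> L" using incseq_convergent[OF inc] by blast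
    have "(\<lambda>n. s ((s ^^ n) x)) \<longlonglongrightarrow> s L" by (rule isCont_tendsto_compose[OF s(1) L])
    moreover have "(\<lambda>n. s ((s ^^ n) x)) \<longlonglongrightarrow> L" using LIMSEQ_Suc[OF L] by simp
    ultimately have "s L = L" by (rule LIMSEQ_unique)
    then show False using s(2)[of L] by simp
  qed
  then obtain N where "B \<le> (s ^^ N) x" by blast
  then show ?thesis using that[of N] incseqD[OF inc] order_trans by blast
qed

text \<open>The previous result, conjugated by the reflection x -> -x.\<close>

lemma funpow_le_unbounded:
  fixes s :: "real \<Rightarrow> real"
  assumes s: "\<And>x. isCont s x" "\<And>x. s x < x"
  obtains N where "\<And>n. n \<ge> N \<Longrightarrow> (s ^^ n) x \<le> B"
proof -
  let ?r = "\<lambda>x. - s (- x)"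
  have "isCont ?r x" for x
    by (intro continuous_intros isCont_o2[OF _ s(1)])
  moreover have "?r x > x" for x using s(2)[of "- x"] by simp
  ultimately obtain N where N: "\<And>n. n \<ge> N \<Longrightarrow> - B \<le> (?r ^^ n) (- x)"
    using funpow_ge_unbounded by metis
  have "(?r ^^ n) (- x) = - (s ^^ n) x" for n by (induction n) auto
  then show ?thesis using N that[of N] by simp
qed

lemma real_has_sign_if_nonzero:
  fixes g :: "real \<Rightarrow> real"
  assumes "continuous_on UNIV g" "\<And>x. g x \<noteq> 0"
  shows "(\<forall>x. g x > 0) \<or> (\<forall>x. g x < 0)"
proof (rule ccontr)
  assume "\<not> ?thesis"
  then obtain a b where ab: "g a \<le> 0" "0 \<le> g b" by (meson not_le)
  have "connected (g ` UNIV)" using assms(1) by (rule connected_continuous_image) simp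
  then have "0 \<in> g ` UNIV" using connectedD_interval[of "g ` UNIV" "g a" "g b" 0] ab by blast
  then show False using assms(2) by force
qed

lemma nth_deriv_one_compose:
  assumes "smooth s" "smooth f"
  shows "nth_deriv 1 (\<lambda>x. f (s x)) x = nth_deriv 1 s x *\<^sub>R nth_deriv 1 f (s x)"
  using has_vector_derivative_compose_real[OF smooth_deriv1[OF assms(1)] smooth_deriv1[OF assms(2)]]
  unfolding nth_deriv_one[of "\<lambda>x. f (s x)"] by (rule vector_derivative_at)

lemma smooth_strict_mono:
  assumes "smooth f" "\<And>x. nth_deriv 1 f x > 0"
  shows "strict_mono (f :: real \<Rightarrow> real)"
proof (rule strict_monoI)
  fix x y :: real assume "x < y"
  then show "f x < f y"
    by (rule DERIV_pos_imp_increasing)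
       (use assms smooth_deriv1[OF assms(1)] in \<open>auto simp: has_real_derivative_iff_has_vector_derivative\<close>)
qed

lemma smooth_nth_deriv_bounded_on_interval:
  assumes "smooth f"
  obtains C where "C > 0" "\<And>i x. i \<le> m \<Longrightarrow> x \<in> {a..b} \<Longrightarrow> norm (nth_deriv i f x) \<le> C"
proof -
  have "\<exists>C>0. \<forall>i\<le>m. \<forall>x\<in>{a..b}. norm (nth_deriv i f x) \<le> C"
  proof (induction m)
    case 0
    then show ?case
      using continuous_real_bounded_on_interval[OF smooth_continuous[OF assms]] by (metis le_zero_eq nth_deriv_0)
  next
    case (Suc m)
    then obtain C where C: "C > 0" "\<And>i x. i \<le> m \<Longrightarrow> x \<in> {a..b} \<Longrightarrow> norm (nth_deriv i f x) \<le> C" by blast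
    obtain D where D: "D > 0" "\<And>x. x \<in> {a..b} \<Longrightarrow> norm (nth_deriv (Suc m) f x) \<le> D"
      using continuous_real_bounded_on_interval[OF smooth_continuous_nth_deriv[OF assms]] by metis
    have "norm (nth_deriv i f x) \<le> C + D" if "i \<le> Suc m" "x \<in> {a..b}" for i x
    proof (cases "i = Suc m")
      case True
      then show ?thesis using D(2)[OF that(2)] C(1) by simp
    next
      case False
      then show ?thesis using C(2)[OF _ that(2), of i] that(1) D(1) by simp
    qed
    then show ?case using C(1) D(1) by (intro exI[of _ "C + D"]) auto
  qed
  then show ?thesis using that by blast
qed

section \<open>Diffeomorphisms above the diagonal and their Abel functions\<close>

context
  fixes \<theta> \<tau> :: "real \<Rightarrow> real"
  assumes \<theta>: "smooth \<theta>" and \<tau>: "smooth \<tau>"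
    and inv: "\<And>x. \<tau> (\<theta> x) = x" "\<And>x. \<theta> (\<tau> x) = x"
    and gt: "\<And>x. \<theta> x > x"
begin

lemma \<tau>_less: "\<tau> x < x"
  using gt[of "\<tau> x"] by (simp add: inv)

lemma deriv_product_inverse: "nth_deriv 1 \<tau> x * nth_deriv 1 \<theta> (\<tau> x) = 1"
proof -
  have "nth_deriv 1 (\<lambda>x::real. x) x = 1"
    unfolding nth_deriv_one by (rule vector_derivative_at) (rule has_vector_derivative_id)
  then show ?thesis using nth_deriv_one_compose[OF \<tau> \<theta>, of x] by (simp add: inv)
qed

text \<open>The derivative has no zeros, hence a constant sign. If it were negative,
  \<open>\<theta>\<close> would be decreasing, and 0 < \<open>\<theta> 0\<close> would give
  \<open>\<theta> (\<theta> 0) < \<theta> 0\<close>.\<close>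

lemma \<theta>_deriv_pos: "nth_deriv 1 \<theta> x > 0"
proof -
  have "nth_deriv 1 \<theta> x \<noteq> 0" for x using deriv_product_inverse[of "\<theta> x"] by (auto simp: inv)
  then consider "\<forall>x. nth_deriv 1 \<theta> x > 0" | "\<forall>x. nth_deriv 1 \<theta> x < 0"
    using real_has_sign_if_nonzero[OF smooth_continuous_nth_deriv[OF \<theta>, of UNIV 1]] by blast
  then show ?thesis
  proof cases
    case 2
    have "\<theta> 0 > \<theta> (\<theta> 0)"
      by (rule DERIV_neg_imp_decreasing[OF gt[of 0]])
         (use 2 smooth_deriv1[OF \<theta>] in \<open>auto simp: has_real_derivative_iff_has_vector_derivative\<close>)
    then show ?thesis using gt[of "\<theta> 0"] by simp
  qed blast
qed

lemma \<tau>_deriv_pos: "nth_deriv 1 \<tau> x > 0"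
  using deriv_product_inverse[of x] \<theta>_deriv_pos[of "\<tau> x"]
    zero_less_mult_iff[of "nth_deriv 1 \<tau> x" "nth_deriv 1 \<theta> (\<tau> x)"] by simp

lemma funpow_deriv_pos:
  assumes "smooth s" "\<And>x. nth_deriv 1 s x > 0"
  shows "nth_deriv 1 (s ^^ n) x > (0::real)"
proof (induction n)
  case 0
  have "nth_deriv 1 (\<lambda>x::real. x) x = 1"
    unfolding nth_deriv_one by (rule vector_derivative_at) (rule has_vector_derivative_id)
  then show ?case by (simp add: id_def)
next
  case (Suc n)
  have "nth_deriv 1 (s ^^ Suc n) x = nth_deriv 1 (s ^^ n) x * nth_deriv 1 s ((s ^^ n) x)"
    using nth_deriv_one_compose[OF smooth_funpow[OF assms(1)] assms(1), of n x]
    by (simp only: funpow.simps o_def real_scaleR_def)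
  then show ?case using Suc assms(2) by (simp del: funpow.simps)
qed

lemma iterate_mono:
  "x \<le> y \<Longrightarrow> (\<theta> ^^ n) x \<le> (\<theta> ^^ n) y" "x \<le> y \<Longrightarrow> (\<tau> ^^ n) x \<le> (\<tau> ^^ n) y"
  using strict_mono_less_eq[OF smooth_strict_mono[OF smooth_funpow[OF \<theta>] funpow_deriv_pos[OF \<theta> \<theta>_deriv_pos]]]
    strict_mono_less_eq[OF smooth_strict_mono[OF smooth_funpow[OF \<tau>] funpow_deriv_pos[OF \<tau> \<tau>_deriv_pos]]]
  by blast+

lemma iterate_inv: "(\<tau> ^^ n) ((\<theta> ^^ n) x) = x" "(\<theta> ^^ n) ((\<tau> ^^ n) x) = x"
proof -
  show "(\<tau> ^^ n) ((\<theta> ^^ n) x) = x"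
    by (induction n) (simp_all add: funpow_swap1[of \<tau>] inv)
  show "(\<theta> ^^ n) ((\<tau> ^^ n) x) = x"
    by (induction n) (simp_all add: funpow_swap1[of \<theta>] inv)
qed

text \<open>The first iterate to cross the end of the interval cannot jump over it, as the interval
  has the length of one step. Points x < 0 need at least one step forward, hence
  \<open>Suc n\<close>; this matches the pairing of terms in the series for H.\<close>

lemma orbit_meets_fundamental_domain:
  "\<exists>n. 0 \<le> (\<tau> ^^ n) x \<and> (\<tau> ^^ n) x < \<theta> 0 \<or> 0 \<le> (\<theta> ^^ Suc n) x \<and> (\<theta> ^^ Suc n) x < \<theta> 0"
proof (cases "0 \<le> x")
  case True
  obtain N where "(\<tau> ^^ N) x \<le> 0"
    using funpow_le_unbounded[OF smooth_isCont[OF \<tau>] \<tau>_less] by blast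
  then have "(\<tau> ^^ N) x < \<theta> 0" using gt[of 0] by simp
  then obtain n where n: "(\<tau> ^^ n) x < \<theta> 0" "\<And>k. k < n \<Longrightarrow> \<not> (\<tau> ^^ k) x < \<theta> 0"
    using exists_least_iff[of "\<lambda>n. (\<tau> ^^ n) x < \<theta> 0"] by blast
  have "0 \<le> (\<tau> ^^ n) x"
  proof (cases n)
    case (Suc k)
    then have "\<theta> 0 \<le> (\<tau> ^^ k) x" using n(2)[of k] by simp
    then have "\<tau> (\<theta> 0) \<le> \<tau> ((\<tau> ^^ k) x)" using iterate_mono(2)[of _ _ 1] by simp
    then show ?thesis by (simp add: Suc inv)
  qed (use True in simp)
  then show ?thesis using n(1) by blast
next
  case False
  obtain N where "0 \<le> (\<theta> ^^ N) x"
    using funpow_ge_unbounded[OF smooth_isCont[OF \<theta>] gt] by blast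
  then obtain n where n: "0 \<le> (\<theta> ^^ n) x" "\<And>k. k < n \<Longrightarrow> \<not> 0 \<le> (\<theta> ^^ k) x"
    using exists_least_iff[of "\<lambda>n. 0 \<le> (\<theta> ^^ n) x"] by blast
  then obtain k where k: "n = Suc k" using False by (cases n) auto
  then have "\<not> 0 \<le> (\<theta> ^^ k) x" using n(2)[of k] by simp
  then have "\<theta> ((\<theta> ^^ k) x) < \<theta> 0"
    using strict_monoD[OF smooth_strict_mono[OF \<theta> \<theta>_deriv_pos], of "(\<theta> ^^ k) x" 0] by simp
  then show ?thesis using n(1) k by auto
qed

text \<open>With a smooth step \<open>b\<close> from 0 to 1, the function \<open>\<Sum>k\<le>0. b \<circ> \<theta>\<^sub>k + \<Sum>k>0. (b \<circ> \<theta>\<^sub>k - 1)\<close>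
  solves Abel's equation; both sums are locally finite.\<close>

lemma Abel_solution:
  "\<exists>H :: real \<Rightarrow> real. smooth H \<and> (\<forall>x. nth_deriv 1 H x > 0) \<and> (\<forall>x. H (\<theta> x) = H x + 1)"
proof -
  \<comment> \<open>b rises from 0 at -1 to 1 at \<open>\<theta> 0 + 1\<close>. The margin of 1 on
    both sides keeps its derivative positive on the whole fundamental interval.\<close>
  define l where "l = 2 + \<theta> 0"
  have l: "l > 0" using gt[of 0] by (simp add: l_def)
  define b where "b x = smooth_step (inverse l * x + inverse l)" for x
  have b_smooth: "smooth b"
    using smooth_compose[OF smooth_linear[of "inverse l" "inverse l"] smooth_smooth_step]
    by (simp add: b_def[abs_def] mult.commute)
  have b0: "b x = 0" if "x \<le> -1" for x
    unfolding b_def by (rule smooth_step_eq_0) (use that l in \<open>simp add: field_simps\<close>)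
  have b1: "b x = 1" if "\<theta> 0 + 1 \<le> x" for x
    unfolding b_def by (rule smooth_step_eq_1) (use that l in \<open>simp add: field_simps l_def\<close>)
  have b_deriv: "nth_deriv 1 b x = inverse l * nth_deriv 1 smooth_step (inverse l * x + inverse l)" for x
  proof -
    have "nth_deriv 1 (\<lambda>x. x *\<^sub>R inverse l + inverse l) x = inverse l"
      using nth_deriv_linear[of 0 "inverse l" "inverse l"] by simp
    then show ?thesis
      using nth_deriv_one_compose[OF smooth_linear[of "inverse l" "inverse l"] smooth_smooth_step, of x]
      by (simp add: b_def[abs_def] mult.commute)
  qed
  have b_deriv_nonneg: "0 \<le> nth_deriv 1 b x" for x
    unfolding b_deriv using l smooth_step_deriv_nonneg by simp
  have b_deriv_pos: "0 < nth_deriv 1 b x" if "0 \<le> x" "x < \<theta> 0" for x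
    unfolding b_deriv using l that
    by (intro mult_pos_pos smooth_step_deriv_pos add_nonneg_pos) (auto simp: field_simps l_def)
  \<comment> \<open>Pairs the term of index -n with the one of index n + 1, so that the two-sided
    series becomes a sum over the natural numbers.\<close>
  define t where "t n x = b ((\<tau> ^^ n) x) + b ((\<theta> ^^ Suc n) x) - 1" for n x
  have t_smooth: "smooth (t n)" for n
    unfolding t_def[abs_def]
    by (intro smooth_diff smooth_add smooth_const)
       (rule smooth_compose[OF smooth_funpow[OF \<tau>] b_smooth], rule smooth_compose[OF smooth_funpow[OF \<theta>] b_smooth])
  have t_deriv: "nth_deriv 1 (t n) x = nth_deriv 1 (\<tau> ^^ n) x * nth_deriv 1 b ((\<tau> ^^ n) x)
      + nth_deriv 1 (\<theta> ^^ Suc n) x * nth_deriv 1 b ((\<theta> ^^ Suc n) x)" for n x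
  proof -
    note s = smooth_compose[OF smooth_funpow[OF \<tau>, of n] b_smooth] smooth_compose[OF smooth_funpow[OF \<theta>, of "Suc n"] b_smooth]
    have "nth_deriv 1 (t n) x = nth_deriv 1 (\<lambda>x. b ((\<tau> ^^ n) x)) x + nth_deriv 1 (\<lambda>x. b ((\<theta> ^^ Suc n) x)) x - 0"
      unfolding t_def[abs_def] nth_deriv_diff[OF smooth_add[OF s] smooth_const] nth_deriv_add[OF s] nth_deriv_const
      by simp
    then show ?thesis
      using nth_deriv_one_compose[OF smooth_funpow[OF \<tau>, of n] b_smooth, of x]
        nth_deriv_one_compose[OF smooth_funpow[OF \<theta>, of "Suc n"] b_smooth, of x] by simp
  qed
  note pos = funpow_deriv_pos[OF \<theta> \<theta>_deriv_pos] funpow_deriv_pos[OF \<tau> \<tau>_deriv_pos]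
  have t_deriv_nonneg: "0 \<le> nth_deriv 1 (t n) x" for n x
    unfolding t_deriv using pos b_deriv_nonneg
    by (intro add_nonneg_nonneg mult_nonneg_nonneg) (auto simp: less_imp_le simp del: funpow.simps)
  have "\<exists>n. 0 < nth_deriv 1 (t n) x" for x
  proof -
    obtain n where "0 \<le> (\<tau> ^^ n) x \<and> (\<tau> ^^ n) x < \<theta> 0 \<or> 0 \<le> (\<theta> ^^ Suc n) x \<and> (\<theta> ^^ Suc n) x < \<theta> 0"
      using orbit_meets_fundamental_domain by blast
    then have "0 < nth_deriv 1 b ((\<tau> ^^ n) x) \<or> 0 < nth_deriv 1 b ((\<theta> ^^ Suc n) x)"
      using b_deriv_pos by blast
    then have "0 < nth_deriv 1 (t n) x"
    proof
      assume "0 < nth_deriv 1 b ((\<tau> ^^ n) x)"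
      then show ?thesis
        unfolding t_deriv using pos(2)[of n x] less_imp_le[OF pos(1)[of "Suc n" x]] b_deriv_nonneg
        by (intro add_pos_nonneg mult_pos_pos mult_nonneg_nonneg)
    next
      assume "0 < nth_deriv 1 b ((\<theta> ^^ Suc n) x)"
      then show ?thesis
        unfolding t_deriv using less_imp_le[OF pos(2)[of n x]] pos(1)[of "Suc n" x] b_deriv_nonneg
        by (intro add_nonneg_pos mult_pos_pos mult_nonneg_nonneg)
    qed
    then show ?thesis ..
  qed
  then obtain n0 where n0: "\<And>x. 0 < nth_deriv 1 (t (n0 x)) x" by metis
  \<comment> \<open>The iterates are increasing, so the orbits of the two endpoints r and -r control
    the whole interval.\<close>
  have "\<exists>N. \<forall>x\<in>{-r<..<r}. \<forall>n\<ge>N. (\<tau> ^^ n) x \<le> -1 \<and> \<theta> 0 + 1 \<le> (\<theta> ^^ n) x" for r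
  proof -
    obtain N1 where N1: "\<And>n. n \<ge> N1 \<Longrightarrow> (\<tau> ^^ n) r \<le> -1"
      using funpow_le_unbounded[OF smooth_isCont[OF \<tau>] \<tau>_less] by blast
    obtain N2 where N2: "\<And>n. n \<ge> N2 \<Longrightarrow> \<theta> 0 + 1 \<le> (\<theta> ^^ n) (- r)"
      using funpow_ge_unbounded[OF smooth_isCont[OF \<theta>] gt] by blast
    have "(\<tau> ^^ n) x \<le> -1 \<and> \<theta> 0 + 1 \<le> (\<theta> ^^ n) x" if "x \<in> {-r<..<r}" "n \<ge> max N1 N2" for x n
      using N1[of n] N2[of n] iterate_mono(1)[of "- r" x n] iterate_mono(2)[of x r n] that by auto
    then show ?thesis by blast
  qed
  then obtain N where N: "\<And>r x n. x \<in> {-r<..<r} \<Longrightarrow> n \<ge> N r \<Longrightarrow> (\<tau> ^^ n) x \<le> -1 \<and> \<theta> 0 + 1 \<le> (\<theta> ^^ n) x"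
    by metis
  define H where "H x = (\<Sum>n. t n x)" for x
  have H_eq: "H x = (\<Sum>n<M. t n x)" if "x \<in> {-r<..<r}" "M \<ge> N r" for x r M
    unfolding H_def
  proof (rule suminf_finite)
    fix n assume "n \<notin> {..<M}"
    then have n: "n \<ge> N r" "Suc n \<ge> N r" using that(2) by auto
    show "t n x = 0"
      unfolding t_def using b0 b1 N[OF that(1) n(1)] N[OF that(1) n(2)] by (simp del: funpow.simps)
  qed simp
  have in_interval: "x \<in> {- (\<bar>x\<bar> + 1)<..<\<bar>x\<bar> + 1}" for x :: real by auto
  have H_smooth: "smooth H"
  proof (rule smooth_local)
    fix x
    show "\<exists>S g. open S \<and> x \<in> S \<and> smooth g \<and> (\<forall>y\<in>S. H y = g y)"
      using H_eq[OF _ order_refl, of _ "\<bar>x\<bar> + 1"] in_interval[of x] smooth_sum[of "{..<N (\<bar>x\<bar> + 1)}" t, OF t_smooth]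
      by (intro exI[of _ "{- (\<bar>x\<bar> + 1)<..<\<bar>x\<bar> + 1}"] exI[of _ "\<lambda>y. \<Sum>n<N (\<bar>x\<bar> + 1). t n y"]) auto
  qed
  have H_deriv: "0 < nth_deriv 1 H x" for x
  proof -
    \<comment> \<open>Large enough for the partial sum to equal H near x and to contain the term
      with positive derivative.\<close>
    define M where "M = max (N (\<bar>x\<bar> + 1)) (Suc (n0 x))"
    have "nth_deriv 1 H x = nth_deriv 1 (\<lambda>y. \<Sum>n<M. t n y) x"
      by (rule nth_deriv_cong_open[of "{- (\<bar>x\<bar> + 1)<..<\<bar>x\<bar> + 1}"])
         (use H_eq[of _ "\<bar>x\<bar> + 1" M] in_interval[of x] in \<open>auto simp: M_def\<close>)
    also have "\<dots> = (\<Sum>n<M. nth_deriv 1 (t n) x)" by (rule nth_deriv_sum) (rule t_smooth)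
    also have "\<dots> > 0"
      by (rule sum_pos2[of _ "n0 x"]) (use n0 t_deriv_nonneg in \<open>auto simp: M_def\<close>)
    finally show ?thesis .
  qed
  have "H (\<theta> x) = H x + 1" for x
  proof -
    define M where "M = max (N (\<bar>x\<bar> + 1)) (N (\<bar>\<theta> x\<bar> + 1))"
    have M: "N (\<bar>x\<bar> + 1) \<le> M" "N (\<bar>\<theta> x\<bar> + 1) \<le> Suc M" "N (\<bar>x\<bar> + 1) \<le> Suc M" "N (\<bar>x\<bar> + 1) \<le> Suc (Suc M)"
      by (auto simp: M_def)
    have shift: "(\<theta> ^^ n) (\<theta> x) = (\<theta> ^^ Suc n) x" for n by (simp add: funpow_swap1)
    have shift': "(\<tau> ^^ Suc n) (\<theta> x) = (\<tau> ^^ n) x" for n by (simp add: funpow_swap1 inv)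
    \<comment> \<open>Replacing x by \<open>\<theta> x\<close> shifts the indices, so the sums
      telescope up to two boundary values of b. For large k both equal 1, which leaves the increment
      1 + 1 - 1.\<close>
    have "(\<Sum>n<Suc k. t n (\<theta> x)) = (\<Sum>n<k. t n x) + b ((\<theta> ^^ Suc k) x) + b ((\<theta> ^^ Suc (Suc k)) x) - 1" for k
    proof (induction k)
      case 0
      show ?case by (simp add: t_def)
    next
      case (Suc k)
      have "t (Suc k) (\<theta> x) = b ((\<tau> ^^ k) x) + b ((\<theta> ^^ Suc (Suc (Suc k))) x) - 1"
        unfolding t_def shift shift' ..
      moreover have "t k x = b ((\<tau> ^^ k) x) + b ((\<theta> ^^ Suc k) x) - 1" unfolding t_def ..
      ultimately show ?case
        using Suc.IH unfolding sum.lessThan_Suc[of _ "Suc k"] sum.lessThan_Suc[of _ k] by linarith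
    qed
    from this[of M] show ?thesis
      using b1 N[OF in_interval[of x] M(3)] N[OF in_interval[of x] M(4)]
      by (simp only: H_eq[OF in_interval M(1)] H_eq[OF in_interval M(2)])
  qed
  then show ?thesis using H_smooth H_deriv by blast
qed

text \<open>The assumption is the outcome of \<open>mixing_near_identity\<close>. It is symmetric in
  \<open>\<theta>\<close> and \<open>\<tau>\<close>, so the result applies whichever of the two is
  psi. Derivatives at y are read off from those on the compact interval
  \<open>[0, \<theta> 0]\<close>, to which some iterate carries y.\<close>

lemma Abel_solution_in_O_M:
  fixes H :: "real \<Rightarrow> real"
  assumes near_id: "\<And>R m v. v \<in> schwartz \<Longrightarrow> \<exists>N. \<forall>n\<ge>N. \<forall>\<sigma>\<in>{\<theta> ^^ n, \<tau> ^^ n}. \<exists>f::real \<Rightarrow> complex. f \<in> O_M \<and>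
     (\<forall>x i. \<bar>x\<bar> \<le> R \<longrightarrow> i \<le> m \<longrightarrow> norm (nth_deriv i (\<lambda>x. f x - complex_of_real x) x) \<le> 1 / 2) \<and>
     (\<forall>y i. i \<le> m \<longrightarrow> norm (v y) * norm (nth_deriv i (\<lambda>y. f (\<sigma> y)) y) \<le> 1)"
    and H: "smooth H" "\<And>x. H (\<theta> x) = H x + 1"
  shows "H \<in> O_M"
proof -
  have \<theta>0: "\<theta> 0 > 0" using gt[of 0] .
  have H_n: "H ((\<theta> ^^ n) x) = H x + real n" for n x
    by (induction n) (simp_all add: H(2))
  have H_n': "H ((\<tau> ^^ n) x) = H x + - real n" for n x
    using H_n[of n "(\<tau> ^^ n) x"] by (simp add: iterate_inv)
  have H_deriv: "poly_bounded (nth_deriv j H)" if j: "j \<ge> 1" for j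
  proof (rule poly_bounded_if_schwartz_multiples_bounded)
    fix v :: "real \<Rightarrow> complex" assume v: "v \<in> schwartz"
    \<comment> \<open>The chain rule of order j will cost 1/|w|^j; a majorant w of the j-th root of
      |v| makes this at most 1/|v|.\<close>
    define \<epsilon> where "\<epsilon> x = root j (norm (v x))" for x
    have \<epsilon>_pow: "\<epsilon> x ^ j = norm (v x)" and \<epsilon>0: "0 \<le> \<epsilon> x" for x
      using j by (auto simp: \<epsilon>_def)
    have "rapidly_decreasing \<epsilon>"
      unfolding rapidly_decreasing_def
    proof
      fix k
      obtain C where C: "C > 0" "\<And>x. (1 + x\<^sup>2) ^ (k * j) * norm (v x) \<le> C" using schwartz_weight_bound[OF v] by metis
      have "(1 + x\<^sup>2) ^ k * norm (\<epsilon> x) \<le> root j C" for x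
      proof (rule power_le_imp_le_base)
        have "((1 + x\<^sup>2) ^ k * norm (\<epsilon> x)) ^ j \<le> C"
          using C(2)[of x] \<epsilon>0[of x] by (simp add: power_mult_distrib \<epsilon>_pow power_mult)
        then show "((1 + x\<^sup>2) ^ k * norm (\<epsilon> x)) ^ Suc (j - 1) \<le> root j C ^ Suc (j - 1)"
          using j C(1) by simp
        show "0 \<le> root j C" using C(1) j by simp
      qed
      then show "\<exists>C. \<forall>x. (1 + x\<^sup>2) ^ k * norm (\<epsilon> x) \<le> C" by blast
    qed
    then obtain w where w: "w \<in> schwartz" "\<And>x. \<bar>\<epsilon> x\<bar> \<le> norm (w x)"
      using rapidly_decreasing_dominated by blast
    obtain T where T: "T > 0" "\<And>x. (1 + x\<^sup>2) ^ 0 * norm (w x) \<le> T"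
      using schwartz_weight_bound[OF w(1)] by metis
    obtain N where N: "\<And>n \<sigma>. n \<ge> N \<Longrightarrow> \<sigma> \<in> {\<theta> ^^ n, \<tau> ^^ n} \<Longrightarrow> \<exists>f::real \<Rightarrow> complex. f \<in> O_M \<and>
     (\<forall>x i. \<bar>x\<bar> \<le> \<theta> 0 \<longrightarrow> i \<le> j \<longrightarrow> norm (nth_deriv i (\<lambda>x. f x - complex_of_real x) x) \<le> 1 / 2) \<and>
     (\<forall>y i. i \<le> j \<longrightarrow> norm (w y) * norm (nth_deriv i (\<lambda>y. f (\<sigma> y)) y) \<le> 1)"
      using near_id[OF w(1), of "\<theta> 0" j] by blast
    \<comment> \<open>On the interval f' is within 1/2 of 1 and the higher derivatives up to order j
      are at most 1/2. Hence |f'| >= 1/2, and all these derivatives are at most 3/2, thus below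
      2.\<close>
    obtain A where A: "A \<ge> 1"
      "\<And>s (f::real \<Rightarrow> complex) x G. smooth s \<Longrightarrow> smooth f \<Longrightarrow> 0 \<le> G \<Longrightarrow>
       1 / 2 \<le> norm (nth_deriv 1 f (s x)) \<Longrightarrow> (\<forall>i\<in>{1..j}. norm (nth_deriv i f (s x)) \<le> 2) \<Longrightarrow>
       (\<forall>i\<in>{1..j}. norm (nth_deriv i (\<lambda>x. f (s x)) x) \<le> G ^ i) \<Longrightarrow>
       (\<forall>i\<in>{1..j}. \<bar>nth_deriv i s x\<bar> \<le> (A * G) ^ i)"
      using nth_deriv_inner_bound[where 'a = complex, of "1 / 2" 2 j] by auto
    obtain B where B: "B \<ge> 0"
       "\<And>s (f::real \<Rightarrow> real) x G M. smooth s \<Longrightarrow> smooth f \<Longrightarrow> 0 \<le> G \<Longrightarrow>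
         (\<forall>i\<in>{1..j}. \<bar>nth_deriv i s x\<bar> \<le> G ^ i) \<Longrightarrow> (\<forall>i\<le>j. norm (nth_deriv i f (s x)) \<le> M) \<Longrightarrow>
         norm (nth_deriv j (\<lambda>x. f (s x)) x) \<le> B * M * G ^ j"
      using nth_deriv_compose_bound[where 'a = real, of j] by auto
    obtain M where M: "M > 0" "\<And>i x. i \<le> j \<Longrightarrow> x \<in> {0..\<theta> 0} \<Longrightarrow> norm (nth_deriv i H x) \<le> M"
      using smooth_nth_deriv_bounded_on_interval[OF H(1)] by metis
    \<comment> \<open>Continuity covers this compact interval; it will turn out that every point
      outside is carried into the fundamental interval by an iterate of order at least N.\<close>
    obtain K where K: "K > 0" "\<And>x. x \<in> {(\<tau> ^^ N) 0..(\<theta> ^^ N) (\<theta> 0)} \<Longrightarrow> norm (nth_deriv j H x) \<le> K"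
      using continuous_real_bounded_on_interval[OF smooth_continuous_nth_deriv[OF H(1)]] by metis
    have far: "norm (v y) * norm (nth_deriv j H y) \<le> B * M * (A * max T 1) ^ j"
      if n: "n \<ge> N" and \<sigma>: "\<sigma> \<in> {\<theta> ^^ n, \<tau> ^^ n}" and y: "\<sigma> y \<in> {0..\<theta> 0}" for n \<sigma> y
    \<comment> \<open>If v y is nonzero, so is w y, and 1/|w y| makes sense.\<close>
    proof (cases "v y = 0")
      case True
      then show ?thesis using B(1) M(1) A(1) by simp
    next
      case False
      obtain f where f: "f \<in> O_M"
        "\<And>x i. \<bar>x\<bar> \<le> \<theta> 0 \<Longrightarrow> i \<le> j \<Longrightarrow> norm (nth_deriv i (\<lambda>x. f x - complex_of_real x) x) \<le> 1 / 2"
        "\<And>y i. i \<le> j \<Longrightarrow> norm (w y) * norm (nth_deriv i (\<lambda>y. f (\<sigma> y)) y) \<le> 1"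
        using N[OF n \<sigma>] by blast
      have \<sigma>_smooth: "smooth \<sigma>" using \<sigma> smooth_funpow[OF \<theta>] smooth_funpow[OF \<tau>] by blast
      have "0 < \<epsilon> y" using False j by (simp add: \<epsilon>_def)
      then have w_pos: "0 < norm (w y)" "\<epsilon> y \<le> norm (w y)" using w(2)[of y] by auto
      \<comment> \<open>The maximum with 1 ensures G <= \<open>G ^ i\<close>; its cost is the
        constant T, the upper bound for |w|.\<close>
      define G where "G = max 1 (1 / norm (w y))"
      have G1: "1 \<le> G" by (simp add: G_def)
      have f_deriv: "norm (nth_deriv (Suc i) f (\<sigma> y) - (if i = 0 then 1 else 0)) \<le> 1 / 2" if "Suc i \<le> j" for i
        using f(2)[of "\<sigma> y" "Suc i"] y that \<theta>0
        unfolding nth_deriv_diff[OF O_M_smooth[OF f(1)] O_M_smooth[OF complex_of_real_in_O_M]]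
          nth_deriv_complex_of_real by simp
      have "\<forall>i\<in>{1..j}. \<bar>nth_deriv i \<sigma> y\<bar> \<le> (A * G) ^ i"
      proof (rule A(2)[OF \<sigma>_smooth O_M_smooth[OF f(1)]])
        show "0 \<le> G" using G1 by simp
        have "norm (1::complex) \<le> norm (nth_deriv 1 f (\<sigma> y)) + norm (nth_deriv 1 f (\<sigma> y) - 1)"
          by (metis diff_diff_eq2 add_diff_cancel_left' norm_triangle_ineq4 diff_add_cancel)
        then show "1 / 2 \<le> norm (nth_deriv 1 f (\<sigma> y))" using f_deriv[of 0] j by simp
        show "\<forall>i\<in>{1..j}. norm (nth_deriv i f (\<sigma> y)) \<le> 2"
        proof
          fix i assume "i \<in> {1..j}"
          then obtain i' where i': "i = Suc i'" "Suc i' \<le> j" by (cases i) auto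
          let ?d = "if i' = 0 then 1 else 0 :: complex"
          have "norm (nth_deriv i f (\<sigma> y)) \<le> norm (nth_deriv i f (\<sigma> y) - ?d) + norm ?d"
            using norm_triangle_ineq[of "nth_deriv i f (\<sigma> y) - ?d" ?d] by simp
          also have "\<dots> \<le> 1 / 2 + 1" using f_deriv[OF i'(2)] i'(1) by (intro add_mono) auto
          finally show "norm (nth_deriv i f (\<sigma> y)) \<le> 2" by simp
        qed
        show "\<forall>i\<in>{1..j}. norm (nth_deriv i (\<lambda>x. f (\<sigma> x)) y) \<le> G ^ i"
        proof
          fix i assume i: "i \<in> {1..j}"
          then have "norm (nth_deriv i (\<lambda>x. f (\<sigma> x)) y) \<le> 1 / norm (w y)"
            using f(3)[of i y] w_pos(1) by (simp add: field_simps)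
          also have "\<dots> \<le> G" by (simp add: G_def)
          also have "G \<le> G ^ i" using i G1 by (intro self_le_power) auto
          finally show "norm (nth_deriv i (\<lambda>x. f (\<sigma> x)) y) \<le> G ^ i" .
        qed
      qed
      then have "norm (nth_deriv j (\<lambda>x. H (\<sigma> x)) y) \<le> B * M * (A * G) ^ j"
        using A(1) G1 M(2) y by (intro B(2) \<sigma>_smooth H(1)) auto
      moreover have "nth_deriv j (\<lambda>x. H (\<sigma> x)) y = nth_deriv j H y"
      proof -
        obtain c where "\<And>x. H (\<sigma> x) = H x + c" using \<sigma> H_n H_n' by blast
        then show ?thesis using nth_deriv_add_const[OF H(1), of "j - 1" c] j by simp
      qed
      ultimately have "norm (v y) * norm (nth_deriv j H y) \<le> \<epsilon> y ^ j * (B * M * (A * G) ^ j)"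
        unfolding \<epsilon>_pow by (simp add: mult_left_mono)
      also have "\<dots> = B * M * (A * (\<epsilon> y * G)) ^ j"
        by (simp add: power_mult_distrib)
      also have "\<dots> \<le> B * M * (A * max T 1) ^ j"
      proof (intro mult_left_mono power_mono)
        have "\<epsilon> y * G \<le> norm (w y) * G" using w_pos G1 by (intro mult_right_mono) auto
        also have "\<dots> = max (norm (w y)) 1" using w_pos(1) by (simp add: G_def max_def field_simps)
        also have "\<dots> \<le> max T 1" using T(2)[of y] by simp
        finally show "\<epsilon> y * G \<le> max T 1" .
        show "0 \<le> A * (\<epsilon> y * G)" using A(1) G1 \<epsilon>0[of y] by simp
      qed (use A(1) B(1) M(1) in auto)
      finally show ?thesis .
    qed
    obtain V where V: "V > 0" "\<And>x. (1 + x\<^sup>2) ^ 0 * norm (v x) \<le> V"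
      using schwartz_weight_bound[OF v] by metis
    have "norm (v y) * norm (nth_deriv j H y) \<le> max (V * K) (B * M * (A * max T 1) ^ j)" for y
    proof (cases "y \<in> {(\<tau> ^^ N) 0..(\<theta> ^^ N) (\<theta> 0)}")
      case True
      have "norm (v y) * norm (nth_deriv j H y) \<le> V * K"
        by (rule mult_mono) (use V(2)[of y] K(2)[OF True] V(1) in auto)
      then show ?thesis by simp
    next
      case False
      have \<tau>_dec: "(\<tau> ^^ N) 0 \<le> (\<tau> ^^ n) 0" if "n \<le> N" for n
        using decseqD[OF decseq_SucI[of "\<lambda>n. (\<tau> ^^ n) 0"] that] less_imp_le[OF \<tau>_less] by simp
      have \<theta>_inc: "(\<theta> ^^ n) (\<theta> 0) \<le> (\<theta> ^^ N) (\<theta> 0)" if "n \<le> N" for n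
        using incseqD[OF incseq_SucI[of "\<lambda>n. (\<theta> ^^ n) (\<theta> 0)"] that] less_imp_le[OF gt] by simp
      have "\<exists>n\<ge>N. \<exists>\<sigma>\<in>{\<theta> ^^ n, \<tau> ^^ n}. \<sigma> y \<in> {0..\<theta> 0}"
      proof -
        obtain n where "0 \<le> (\<tau> ^^ n) y \<and> (\<tau> ^^ n) y < \<theta> 0 \<or> 0 \<le> (\<theta> ^^ Suc n) y \<and> (\<theta> ^^ Suc n) y < \<theta> 0"
          using orbit_meets_fundamental_domain by blast
        then consider "(\<tau> ^^ n) y \<in> {0..\<theta> 0}" | "(\<theta> ^^ Suc n) y \<in> {0..\<theta> 0}" by fastforce
        then show ?thesis
        proof cases
          case 1
          \<comment> \<open>With n < N, monotonicity of the iterates would place y in the excluded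
            compact interval.\<close>
          have "n \<ge> N"
          proof (rule ccontr)
            assume "\<not> n \<ge> N"
            then have n: "n \<le> N" by simp
            have "y \<le> (\<theta> ^^ N) (\<theta> 0)"
              using iterate_mono(1)[of "(\<tau> ^^ n) y" "\<theta> 0" n] 1 \<theta>_inc[OF n] by (simp add: iterate_inv)
            moreover have "0 \<le> (\<theta> ^^ n) 0"
              using incseqD[OF incseq_SucI[of "\<lambda>n. (\<theta> ^^ n) 0"], of 0 n] less_imp_le[OF gt] by simp
            then have "0 \<le> y" using iterate_mono(1)[of 0 "(\<tau> ^^ n) y" n] 1 by (simp add: iterate_inv)
            then have "(\<tau> ^^ N) 0 \<le> y" using \<tau>_dec[of 0] by simp
            ultimately show False using False by simp
          qed
          then show ?thesis using 1 by blast
        next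
          case 2
          have "Suc n \<ge> N"
          proof (rule ccontr)
            assume "\<not> Suc n \<ge> N"
            then have n: "Suc n \<le> N" by simp
            have "(\<tau> ^^ N) 0 \<le> y"
              using iterate_mono(2)[of 0 "(\<theta> ^^ Suc n) y" "Suc n", unfolded iterate_inv] 2 \<tau>_dec[OF n]
              by (simp only: atLeastAtMost_iff) (metis order_trans)
            moreover have "(\<tau> ^^ Suc n) (\<theta> 0) \<le> \<theta> 0"
              using decseqD[OF decseq_SucI[of "\<lambda>n. (\<tau> ^^ n) (\<theta> 0)"], of 0 "Suc n"] less_imp_le[OF \<tau>_less] by simp
            then have "y \<le> \<theta> 0" using iterate_mono(2)[of "(\<theta> ^^ Suc n) y" "\<theta> 0" "Suc n", unfolded iterate_inv] 2
              by (simp only: atLeastAtMost_iff) (metis order_trans)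
            then have "y \<le> (\<theta> ^^ N) (\<theta> 0)" using \<theta>_inc[of 0] by simp
            ultimately show False using False by simp
          qed
          then show ?thesis using 2 by blast
        qed
      qed
      then show ?thesis using far by (meson max.coboundedI2)
    qed
    then show "\<exists>B. \<forall>x. norm (v x) * norm (nth_deriv j H x) \<le> B" by blast
  qed
  \<comment> \<open>Order 0 is separate, since the shift by c changes the values of H but not its
    derivatives. The mean value inequality bounds H through H', with one more factor 1 + x^2 for the
    length |x|.\<close>
  have "poly_bounded H"
  proof -
    obtain k C where C: "C \<ge> 1" "\<And>x. norm (nth_deriv 1 H x) \<le> C * (1 + x\<^sup>2) ^ k"
      using poly_boundedE[OF H_deriv[of 1]] by (metis order_refl)
    have "norm (H x) \<le> (\<bar>H 0\<bar> + C) * (1 + x\<^sup>2) ^ Suc k" for x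
    proof -
      have "norm (H x - H 0) \<le> (C * (1 + x\<^sup>2) ^ k) * norm (x - 0)"
      proof (rule field_differentiable_bound[where S = "{-\<bar>x\<bar>..\<bar>x\<bar>}" and f' = "nth_deriv 1 H"])
        show "(H has_field_derivative nth_deriv 1 H z) (at z within {-\<bar>x\<bar>..\<bar>x\<bar>})" for z
          using smooth_deriv1[OF H(1), of z] has_real_derivative_iff_has_vector_derivative
            has_field_derivative_at_within by blast
        fix z assume "z \<in> {-\<bar>x\<bar>..\<bar>x\<bar>}"
        then have "z\<^sup>2 \<le> x\<^sup>2" using abs_le_square_iff[of z x] by auto
        then have "C * (1 + z\<^sup>2) ^ k \<le> C * (1 + x\<^sup>2) ^ k" using C(1) by (intro mult_left_mono power_mono) auto
        then show "norm (nth_deriv 1 H z) \<le> C * (1 + x\<^sup>2) ^ k" using C(2)[of z] by linarith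
      qed auto
      also have "\<dots> \<le> (C * (1 + x\<^sup>2) ^ k) * (1 + x\<^sup>2)"
      proof (rule mult_left_mono)
        show "norm (x - 0) \<le> 1 + x\<^sup>2" using zero_le_power2[of "\<bar>x\<bar> - 1"] by (simp add: power2_eq_square algebra_simps)
        show "0 \<le> C * (1 + x\<^sup>2) ^ k" using C(1) less_imp_le[OF weight_pos[of x k]] by (intro mult_nonneg_nonneg) auto
      qed
      also have "\<dots> = C * (1 + x\<^sup>2) ^ Suc k" by simp
      finally have "\<bar>H x\<bar> \<le> \<bar>H 0\<bar> * 1 + C * (1 + x\<^sup>2) ^ Suc k" by simp
      also have "\<dots> \<le> \<bar>H 0\<bar> * (1 + x\<^sup>2) ^ Suc k + C * (1 + x\<^sup>2) ^ Suc k"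
        by (intro add_mono mult_left_mono one_le_weight) (use C(1) in auto)
      finally show ?thesis by (simp only: real_norm_def distrib_right)
    qed
    then show ?thesis unfolding poly_bounded_def by blast
  qed
  then show ?thesis
    unfolding O_M_iff using H(1) H_deriv by (metis nth_deriv_0 less_one linorder_not_less)
qed

end

lemma mixing_imp_Abel:
  fixes \<psi> :: "real \<Rightarrow> real"
  assumes \<psi>: "\<psi> \<in> O_M" "bij \<psi>" and mix: "mixing_operator O_M_topology (composition_operator \<psi>)"
  shows "\<exists>H :: real \<Rightarrow> real. H \<in> O_M \<and> (\<forall>x. deriv H x \<noteq> 0) \<and> (\<forall>x. H (\<psi> x) = H x + 1)"
proof -
  have \<psi>_smooth: "smooth \<psi>" using \<psi>(1) by (rule O_M_smooth)
  let ?\<tau> = "inv \<psi>"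
  have inv: "?\<tau> (\<psi> x) = x" "\<psi> (?\<tau> x) = x" for x
    using \<psi>(2) by (simp_all add: bij_is_inj bij_is_surj surj_f_inv_f)
  have \<tau>_smooth: "smooth ?\<tau>"
    by (rule smooth_inv_function[OF \<psi>_smooth mixing_imp_deriv_nonzero[OF mix \<psi>_smooth] inv])
  have near: "\<exists>N. \<forall>n\<ge>N. \<forall>\<sigma>\<in>{\<psi> ^^ n, ?\<tau> ^^ n}. \<exists>f::real \<Rightarrow> complex. f \<in> O_M \<and>
     (\<forall>x i. \<bar>x\<bar> \<le> R \<longrightarrow> i \<le> m \<longrightarrow> norm (nth_deriv i (\<lambda>x. f x - complex_of_real x) x) \<le> 1 / 2) \<and>
     (\<forall>y i. i \<le> m \<longrightarrow> norm (v y) * norm (nth_deriv i (\<lambda>y. f (\<sigma> y)) y) \<le> 1)"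
    if "v \<in> schwartz" for R m v
    by (rule mixing_near_identity[OF mix \<psi>(2) that, of R m]) blast
  \<comment> \<open>Without fixed points the graph of psi stays on one side of the diagonal.\<close>
  have "continuous_on UNIV (\<lambda>x. \<psi> x - x)"
    by (intro continuous_intros smooth_continuous \<psi>_smooth)
  then consider "\<forall>x. \<psi> x - x > 0" | "\<forall>x. \<psi> x - x < 0"
    using real_has_sign_if_nonzero[of "\<lambda>x. \<psi> x - x"] mixing_imp_no_fixed_point[OF mix] by auto
  then show ?thesis
  proof cases
    case 1
    then have gt: "\<And>x. \<psi> x > x" by simp
    obtain H :: "real \<Rightarrow> real" where H: "smooth H" "\<And>x. nth_deriv 1 H x > 0" "\<And>x. H (\<psi> x) = H x + 1"
      using Abel_solution[OF \<psi>_smooth \<tau>_smooth inv gt] by blast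
    have "H \<in> O_M" by (rule Abel_solution_in_O_M[OF \<psi>_smooth \<tau>_smooth inv gt near H(1,3)])
    then show ?thesis using H(2,3) smooth_deriv_eq[OF H(1)] by (metis less_irrefl)
  next
    case 2
    \<comment> \<open>Below the diagonal the inverse takes the role of
      \<open>\<theta>\<close>.\<close>
    have gt: "?\<tau> x > x" for x using 2[rule_format, of "?\<tau> x"] by (simp add: inv)
    obtain H :: "real \<Rightarrow> real" where H: "smooth H" "\<And>x. nth_deriv 1 H x > 0" "\<And>x. H (?\<tau> x) = H x + 1"
      using Abel_solution[OF \<tau>_smooth \<psi>_smooth inv(2,1) gt] by blast
    have "H \<in> O_M"
      by (rule Abel_solution_in_O_M[OF \<tau>_smooth \<psi>_smooth inv(2,1) gt near[unfolded insert_commute[of "\<psi> ^^ _"]] H(1,3)])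
    \<comment> \<open>This H satisfies H o psi = H - 1, so its negative solves the equation for
      psi.\<close>
    then have H_O_M: "(\<lambda>x. (-1) *\<^sub>R H x) \<in> O_M" by (rule O_M_cscaleR)
    have "deriv (\<lambda>x. (-1) *\<^sub>R H x) x = (-1) *\<^sub>R nth_deriv 1 H x" for x
      unfolding smooth_deriv_eq[OF O_M_smooth[OF H_O_M]] by (rule nth_deriv_cscaleR[OF H(1)])
    then have "deriv (\<lambda>x. (-1) *\<^sub>R H x) x \<noteq> 0" for x using H(2)[of x] by simp
    moreover have "(-1) *\<^sub>R H (\<psi> x) = (-1) *\<^sub>R H x + 1" for x
      using H(3)[of "\<psi> x"] by (simp add: inv)
    ultimately show ?thesis using H_O_M by blast
  qed
qed

theorem theorem15:
  fixes \<psi> :: "real \<Rightarrow> real"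
  assumes "\<psi> \<in> O_M" and "bij \<psi>"
  shows "(mixing_operator O_M_topology (composition_operator \<psi>) \<and>
          (\<forall>v\<in>schwartz.
             (\<lambda>n. v ((\<psi> ^^ n) 0) * of_nat n) \<longlonglongrightarrow> 0 \<and>
             (\<lambda>n. v (inv (\<psi> ^^ n) 0) * of_nat n) \<longlonglongrightarrow> 0))
     \<longleftrightarrow> (\<exists>H :: real \<Rightarrow> real. H \<in> O_M \<and>
            (\<forall>x. deriv H x \<noteq> 0) \<and>
            (\<forall>x. H (\<psi> x) = H x + 1))"
proof (intro iffI)
  assume "\<exists>H :: real \<Rightarrow> real. H \<in> O_M \<and> (\<forall>x. deriv H x \<noteq> 0) \<and> (\<forall>x. H (\<psi> x) = H x + 1)"
  then obtain H :: "real \<Rightarrow> real" where H: "H \<in> O_M" "\<And>x. nth_deriv 1 H x \<noteq> 0" "\<And>x. H (\<psi> x) = H x + 1"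
    using smooth_deriv_eq[OF O_M_smooth] by auto
  show "mixing_operator O_M_topology (composition_operator \<psi>) \<and>
          (\<forall>v\<in>schwartz.
             (\<lambda>n. v ((\<psi> ^^ n) 0) * of_nat n) \<longlonglongrightarrow> 0 \<and>
             (\<lambda>n. v (inv (\<psi> ^^ n) 0) * of_nat n) \<longlonglongrightarrow> 0)"
    by (intro conjI ballI Abel_imp_mixing[OF H(1,2) assms H(3)])
next
  assume "mixing_operator O_M_topology (composition_operator \<psi>) \<and>
          (\<forall>v\<in>schwartz.
             (\<lambda>n. v ((\<psi> ^^ n) 0) * of_nat n) \<longlonglongrightarrow> 0 \<and>
             (\<lambda>n. v (inv (\<psi> ^^ n) 0) * of_nat n) \<longlonglongrightarrow> 0)"
  then show "\<exists>H :: real \<Rightarrow> real. H \<in> O_M \<and> (\<forall>x. deriv H x \<noteq> 0) \<and> (\<forall>x. H (\<psi> x) = H x + 1)"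
    by (intro mixing_imp_Abel[OF assms]) (rule conjunct1)
qed

end
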